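(* Let $n\ge 1$ and let $g\in L^2_*(T^n)$. Then there exist $f_0,\dots,f_n\in \dot H^{n/2}(T^n)\cap C^0(T^n)$ such that $$g=(-\Delta)^{n/4}f_0+\sum_{j=1}^n(-\Delta)^{n/4}\,\overline{\mathcal{R}}_j f_j .$$
   Context: $T^n=\mathbb{R}^n/(2\pi\mathbb{Z})^n$; functions and distributions are complex-valued, with Fourier coefficients $\hat u(m)=\frac{1}{(2\pi)^n}\langle u,e^{-i\langle m,\cdot\rangle}\rangle$, $m\in\mathbb{Z}^n$. $L^2_*(T^n)$ is the space of mean-zero functions in $L^2(T^n)$. $\dot H^{n/2}(T^n)$ is the space of distributions $v$ on $T^n$ with $\sum_{m\in\mathbb{Z}^n}|m|^{n}|\hat v(m)|^2<\infty$. $C^0(T^n)$ is the space of continuous functions. $(-\Delta)^{n/4}$ is the Fourier multiplier operator with multiplier $|m|^{n/2}$. The Riesz transform $\mathcal{R}_j$ has multiplier $i\frac{m_j}{|m|}$ (and $0$ at $m=0$); $\overline{\mathcal{R}}_j$ is the conjugate (dual) operator, with multiplier $-i\frac{m_j}{|m|}$ (and $0$ at $m=0$). *)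

theory Defs
  imports "HOL-Analysis.Analysis"
begin

text \<open>
  The torus is \<open>T\<^sup>n = \<real>\<^sup>n / (2\<pi>\<int>)\<^sup>n\<close> with \<open>n = CARD('n)\<close>. Functions on the torus are
  functions on \<^typ>\<open>real^'n\<close> that are \<open>2\<pi>\<close>-periodic in each coordinate; they are integrated
  over a fundamental cell. Frequencies have type \<^typ>\<open>int^'n\<close>.
\<close>

definition torus_fun :: "(real^'n \<Rightarrow> complex) \<Rightarrow> bool" where
  "torus_fun f \<longleftrightarrow> (\<forall>x j. f (x + (2 * pi) *\<^sub>R axis j 1) = f x)"

definition torus_cell :: "(real^'n) set" where
  "torus_cell = cbox 0 (\<chi> j. 2 * pi)"

definition real_vec :: "int^'n \<Rightarrow> real^'n" where
  "real_vec m = (\<chi> j. real_of_int (m $ j))"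

definition character :: "int^'n \<Rightarrow> real^'n \<Rightarrow> complex" where
  "character m x = cis (real_vec m \<bullet> x)"

definition C0_torus :: "(real^'n \<Rightarrow> complex) set" where
  "C0_torus = {f. torus_fun f \<and> continuous_on UNIV f}"

definition L2_torus :: "(real^'n \<Rightarrow> complex) set" where
  "L2_torus = {f. torus_fun f \<and> f \<in> borel_measurable lebesgue \<and>
     set_integrable lebesgue torus_cell (\<lambda>x. (norm (f x))\<^sup>2)}"

definition L2_mean_zero :: "(real^'n \<Rightarrow> complex) set" where
  "L2_mean_zero = {f \<in> L2_torus. set_lebesgue_integral lebesgue torus_cell f = 0}"


subsection \<open>Test functions and distributions\<close>

primrec partials :: "'n list \<Rightarrow> (real^'n \<Rightarrow> complex) \<Rightarrow> real^'n \<Rightarrow> complex" where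
  "partials [] f = f"
| "partials (j # js) f = (\<lambda>x. frechet_derivative (partials js f) (at x) (axis j 1))"

definition test_functions :: "(real^'n \<Rightarrow> complex) set" where
  "test_functions = {\<phi>. torus_fun \<phi> \<and> (\<forall>js x. partials js \<phi> differentiable (at x))}"

definition Ck_norm :: "nat \<Rightarrow> (real^'n \<Rightarrow> complex) \<Rightarrow> real" where
  "Ck_norm N \<phi> = (SUP (js, x) \<in> {js. length js \<le> N} \<times> UNIV. norm (partials js \<phi> x))"

text \<open>
  A distribution is a functional of the following type that is linear and continuous on
  \<open>C\<^sup>\<infinity>(T\<^sup>n)\<close>. Its values outside \<open>test_functions\<close> carry no meaning, so two distributions
  are equal iff they agree on \<open>test_functions\<close>.
\<close>

type_synonym 'n functional = "(real^'n \<Rightarrow> complex) \<Rightarrow> complex"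

definition distributions :: "'n::finite functional set" where
  "distributions = {u.
     (\<forall>\<phi>\<in>test_functions. \<forall>\<psi>\<in>test_functions. u (\<lambda>x. \<phi> x + \<psi> x) = u \<phi> + u \<psi>) \<and>
     (\<forall>c. \<forall>\<phi>\<in>test_functions. u (\<lambda>x. c * \<phi> x) = c * u \<phi>) \<and>
     (\<exists>C N. \<forall>\<phi>\<in>test_functions. norm (u \<phi>) \<le> C * Ck_norm N \<phi>)}"

definition dist_of :: "(real^'n \<Rightarrow> complex) \<Rightarrow> 'n functional" where
  "dist_of f \<phi> = set_lebesgue_integral lebesgue torus_cell (\<lambda>x. f x * \<phi> x)"

definition fourier_coeff :: "'n::finite functional \<Rightarrow> int^'n \<Rightarrow> complex" where
  "fourier_coeff u m = u (character (- m)) / of_real ((2 * pi) ^ CARD('n))"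

definition Hdot :: "real \<Rightarrow> 'n::finite functional set" where
  "Hdot s = {v \<in> distributions.
     (\<lambda>m. norm (real_vec m) powr (2 * s) * (norm (fourier_coeff v m))\<^sup>2) summable_on UNIV}"


subsection \<open>Fourier multipliers\<close>

text \<open>
  The multiplier operator sends \<open>u\<close> to the distribution
  \<open>\<Sum>m. \<sigma> m * fourier_coeff u m * character m\<close>; the series converges absolutely when
  applied to a test function if \<open>u\<close> is a distribution and \<open>\<sigma>\<close> grows at most polynomially.
\<close>

definition fourier_multiplier ::
    "(int^'n \<Rightarrow> complex) \<Rightarrow> 'n::finite functional \<Rightarrow> 'n functional" where
  "fourier_multiplier \<sigma> u \<phi> = (\<Sum>\<^sub>\<infinity>m. \<sigma> m * fourier_coeff u m * dist_of (character m) \<phi>)"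

text \<open>The operator \<open>(-\<Delta>)\<^sup>s\<close> for \<open>s > 0\<close>; note \<open>0 powr (2 * s) = 0\<close>.\<close>

definition frac_laplacian :: "real \<Rightarrow> 'n::finite functional \<Rightarrow> 'n functional" where
  "frac_laplacian s = fourier_multiplier (\<lambda>m. of_real (norm (real_vec m) powr (2 * s)))"

definition conj_riesz :: "'n \<Rightarrow> 'n::finite functional \<Rightarrow> 'n functional" where
  "conj_riesz j = fourier_multiplier
     (\<lambda>m. if m = 0 then 0 else - \<i> * of_int (m $ j) / of_real (norm (real_vec m)))"

end

theory Submission
  imports Defs
begin

text \<open>
  On the Fourier side one must solve \<open>G m = |m|\<^bsup>n/2\<^esup> * (F\<^sub>0 m - \<i> * (\<Sum>j. m\<^sub>j / |m| * F\<^sub>j m))\<close> with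
  \<open>G\<close> square summable. It suffices to do this up to an error of half the norm of \<open>G\<close>, with
  trigonometric polynomials bounded in the sup norm and in the homogeneous Sobolev norm by a fixed
  multiple of the norm of \<open>G\<close>; iterating gives a geometric series.

  The approximate solution, as a function on a fine grid, minimises the squared residual plus
  \<open>lam\<close> times the squared Sobolev norm plus a penalty of high power \<open>2 * p\<close>, which imitates the
  sup norm. By the Euler-Lagrange equation \<open>|m|\<^bsup>n/2\<^esup>\<close> times the residual, and its Riesz
  transforms, are each a sum of a function that is small in \<open>L\<^sup>1\<close> and a distribution that is small
  in the dual Sobolev norm. Such a residual is small: the kernels with multiplier comparable to
  \<open>m\<^sub>j * |m|\<^bsup>-n-1\<^esup>\<close> are bounded, so pairing the first \<open>L\<^sup>1\<close> part with the others through them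
  costs only the product of \<open>L\<^sup>1\<close> norms, whereas on the Fourier side the pairing bounds the
  squared norm of the residual. Smoothing with a Fejer kernel turns the \<open>L\<^bsup>2p\<^esup>\<close> bound into a
  sup bound, because \<open>p\<close> may depend on the degree.
\<close>

section \<open>Characters and box sums\<close>

text \<open>Taking f_j = 0 and f_0 = (-Delta)^(-n/4) g fails: n/2 is the critical Sobolev exponent,
  so this f_0 need be neither bounded nor continuous. In dual terms, the kernel with multiplier
  |m|^(-n) has a logarithmic singularity, and pairing L^1 functions through it is not controlled by
  their L^1 norms. Oddness removes the singularity for m_j |m|^(-n-1). This is what the Riesz
  transforms buy: pairing the equation of f_0 with that of f_j produces, up to a unimodular
  constant, the factor m_j^2 / |m|^2, and these factors add up to 1. The constant of the
  approximation step may depend on n only, while the degree of the approximation depends on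
  \<open>G\<close>. Hence kernel bounds have to be uniform in the number of dyadic scales, and the
  estimates for the minimiser free of p. If 1 / A is the scale of the sup norm, the two errors in
  the residual estimate have orders A^2 and sqrt lam; the choice lam = A^4 balances them. The grid
  makes the variational problem finite-dimensional and is exact for all frequencies
  involved.\<close>

lemma character_prod: "character m x = (\<Prod>i\<in>UNIV. cis (of_int (m $ i) * x $ i))"
proof -
  have "cis (\<Sum>i\<in>S. f i) = (\<Prod>i\<in>S. cis (f i))" if "finite S" for S :: "'a set" and f
    using that by (induction S) (auto simp: cis_mult[symmetric])
  then show ?thesis
    by (simp add: character_def real_vec_def inner_vec_def)
qed

lemma real_vec_simps [simp]:
  "real_vec 0 = 0" "real_vec (m + k) = real_vec m + real_vec k"
  "real_vec (- m) = - real_vec m" "real_vec (m - k) = real_vec m - real_vec k"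
  by (auto simp: real_vec_def vec_eq_iff)

lemma real_vec_eq_0_iff [simp]: "real_vec m = 0 \<longleftrightarrow> m = 0"
  by (auto simp: real_vec_def vec_eq_iff)

lemma character_0 [simp]: "character 0 x = 1"
  by (simp add: character_def)

lemma character_add: "character (m + k) x = character m x * character k x"
  by (simp add: character_def inner_add_left cis_mult)

lemma character_uminus: "character (- m) x = cnj (character m x)"
  by (simp add: character_def cis_cnj)

lemma character_diff: "character (m - k) x = character m x * cnj (character k x)"
  using character_add[of m "- k" x] by (simp add: character_uminus)

lemma character_arg_diff: "character m (x - y) = character m x * cnj (character m y)"
  by (simp add: character_def inner_diff_right cis_cnj cis_mult)

lemma norm_character [simp]: "norm (character m x) = 1"
  by (simp add: character_def)

lemma character_axis: "character (axis j k) x = cis (of_int k * x $ j)"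
proof -
  have "real_vec (axis j k) \<bullet> x = of_int k * x $ j"
    by (simp add: real_vec_def inner_vec_def axis_def if_distrib if_distribR cong: if_cong)
  then show ?thesis by (simp add: character_def)
qed

definition box_of :: "int set \<Rightarrow> (int^'n) set" where
  "box_of B = {m. \<forall>i. m $ i \<in> B}"

lemma bij_betw_box_of: "bij_betw vec_lambda (PiE UNIV (\<lambda>_::'n::finite. B)) (box_of B)"
  by (rule bij_betw_byWitness[where f' = "vec_nth"]) (auto simp: box_of_def)

lemma finite_box_of [simp]: "finite B \<Longrightarrow> finite (box_of B)"
  using bij_betw_finite[OF bij_betw_box_of, of B] by (auto intro!: finite_PiE)

lemma card_box_of: "finite B \<Longrightarrow> card (box_of B :: (int^'n) set) = card B ^ CARD('n)"
  using bij_betw_same_card[OF bij_betw_box_of[where 'n='n], of B] by (simp add: card_PiE)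

lemma sum_box_of_prod:
  fixes f :: "'n::finite \<Rightarrow> int \<Rightarrow> 'a::comm_semiring_1"
  assumes "finite B"
  shows "(\<Sum>m\<in>box_of B. \<Prod>i\<in>UNIV. f i (m $ i)) = (\<Prod>i\<in>UNIV. \<Sum>k\<in>B. f i k)"
proof -
  have "(\<Sum>m\<in>box_of B. \<Prod>i\<in>UNIV. f i (m $ i)) = (\<Sum>g\<in>PiE UNIV (\<lambda>_::'n. B). \<Prod>i\<in>UNIV. f i (g i))"
    by (subst sum.reindex_bij_betw[OF bij_betw_box_of, symmetric]) simp
  also have "\<dots> = (\<Prod>i\<in>UNIV. \<Sum>k\<in>B. f i k)"
    by (rule prod_sum_PiE[symmetric]) (auto simp: assms)
  finally show ?thesis .
qed

section \<open>Discrete averages over a uniform grid of the torus\<close>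

definition grid_point :: "nat \<Rightarrow> int^'n \<Rightarrow> real^'n" where
  "grid_point L l = (\<chi> i. 2 * pi * of_int (l $ i) / of_nat L)"

definition grid :: "nat \<Rightarrow> (int^'n) set" where
  "grid L = box_of {0..<int L}"

lemma finite_grid [simp]: "finite (grid L)"
  by (simp add: grid_def)

lemma card_grid: "card (grid L :: (int^'n) set) = L ^ CARD('n)"
  by (simp add: grid_def card_box_of)

definition avg :: "nat \<Rightarrow> (int^'n \<Rightarrow> 'a::real_normed_field) \<Rightarrow> 'a" where
  "avg L h = (\<Sum>l\<in>grid L. h l) / of_nat (L ^ CARD('n))"

lemma avg_add: "avg L (\<lambda>l. f l + g l) = avg L f + avg L g"
  by (simp add: avg_def sum.distrib add_divide_distrib)

lemma avg_diff: "avg L (\<lambda>l. f l - g l) = avg L f - avg L g"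
  by (simp add: avg_def sum_subtractf diff_divide_distrib)

lemma avg_cmult: "avg L (\<lambda>l. c * f l) = c * avg L f"
  by (simp add: avg_def sum_distrib_left)

lemma avg_cmult_right: "avg L (\<lambda>l. f l * c) = avg L f * c"
  by (simp add: avg_def sum_distrib_right)

lemma avg_sum: "avg L (\<lambda>l. \<Sum>i\<in>S. f i l) = (\<Sum>i\<in>S. avg L (f i))"
  by (simp add: avg_def sum.swap[of _ S] sum_divide_distrib)

lemma avg_const: "L > 0 \<Longrightarrow> avg L (\<lambda>l::int^'n. c) = c"
  by (simp add: avg_def card_grid)

lemma avg_mono: "(\<And>l. l \<in> grid L \<Longrightarrow> f l \<le> g l) \<Longrightarrow> avg L f \<le> (avg L g :: real)"
  by (simp add: avg_def sum_mono divide_right_mono)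

lemma avg_nonneg: "(\<And>l. l \<in> grid L \<Longrightarrow> 0 \<le> f l) \<Longrightarrow> 0 \<le> (avg L f :: real)"
  by (simp add: avg_def sum_nonneg)

lemma norm_avg_le: "norm (avg L f) \<le> avg L (\<lambda>l. norm (f l))"
  by (auto simp: avg_def norm_divide norm_power intro!: divide_right_mono sum_norm_le)

lemma avg_of_real: "avg L (\<lambda>l. of_real (f l) :: complex) = of_real (avg L f)"
  by (simp add: avg_def)

lemma Re_avg: "Re (avg L f) = avg L (\<lambda>l. Re (f l))"
  by (simp add: avg_def flip: of_nat_power)

lemma sum_roots_of_unity:
  fixes k :: int
  assumes "\<bar>k\<bar> < int L"
  shows "(\<Sum>l\<in>{0..<int L}. cis (of_int k * (2 * pi * of_int l / of_nat L))) = (if k = 0 then of_nat L else 0)"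
proof (cases "k = 0")
  case False
  have L: "L > 0" using assms by auto
  define w where "w = cis (2 * pi * of_int k / of_nat L)"
  have "w ^ L = cis (2 * pi * of_int k)"
    using L by (simp add: w_def Complex.DeMoivre)
  also have "\<dots> = 1" by (rule cis_multiple_2pi) simp
  finally have wL: "w ^ L = 1" .
  have "w \<noteq> 1"
  proof
    assume "w = 1"
    then have "cos (2 * pi * of_int k / of_nat L) = 1"
      by (metis w_def cis.sel(1) one_complex.sel(1))
    then obtain z :: int where "2 * pi * of_int k / of_nat L = of_int z * (2 * pi)"
      by (auto simp: cos_one_2pi_int)
    then have "of_int k = (of_int z * of_nat L :: real)"
      using L by (simp add: field_simps)
    then have "k = z * int L" by (metis of_int_eq_iff of_int_mult of_int_of_nat_eq)
    with assms False dvd_imp_le_int[of k "int L"] show False by auto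
  qed
  have "(\<Sum>l\<in>{0..<int L}. cis (of_int k * (2 * pi * of_int l / of_nat L))) = (\<Sum>l<L. w ^ l)"
    by (rule sum.reindex_bij_witness[of _ int nat]) (auto simp: w_def Complex.DeMoivre field_simps)
  also have "\<dots> = 0" using \<open>w \<noteq> 1\<close> wL by (simp add: geometric_sum)
  finally show ?thesis using False by simp
qed simp

text \<open>A geometric sum in each coordinate. The strict bound excludes aliasing: a nonzero
  frequency whose coordinates are all multiples of \<open>L\<close> would average to 1 as
  well.\<close>

lemma avg_character:
  fixes m :: "int^'n"
  assumes "\<And>i. \<bar>m $ i\<bar> < int L"
  shows "avg L (\<lambda>l. character m (grid_point L l)) = (if m = 0 then 1 else 0)"
proof -
  have L: "L > 0" using assms[of undefined] by auto
  have "(\<Sum>l\<in>grid L. character m (grid_point L l))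
      = (\<Prod>i\<in>UNIV. \<Sum>l\<in>{0..<int L}. cis (of_int (m $ i) * (2 * pi * of_int l / of_nat L)))"
    unfolding grid_def character_prod
    by (subst sum_box_of_prod[symmetric]) (simp_all add: grid_point_def)
  also have "\<dots> = (\<Prod>i\<in>UNIV. if m $ i = 0 then of_nat L else 0)"
    by (intro prod.cong refl sum_roots_of_unity assms)
  also have "\<dots> = (if m = 0 then of_nat (L ^ CARD('n)) else 0)"
    by (auto simp: vec_eq_iff)
  finally show ?thesis using L by (simp add: avg_def)
qed

section \<open>Fejer kernels\<close>

text \<open>One-sided: its squared modulus collects each difference k of two indices N - |k| times,
  so that division by N gives the Fejer kernel with the tent \<open>tri1\<close> as coefficients,
  and positivity is immediate.\<close>

definition dirichlet_sum :: "nat \<Rightarrow> real \<Rightarrow> complex" where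
  "dirichlet_sum N t = (\<Sum>k<N. cis (of_nat k * t))"

definition fejer1 :: "nat \<Rightarrow> real \<Rightarrow> real" where
  "fejer1 N t = (norm (dirichlet_sum N t))\<^sup>2 / of_nat N"

definition tri1 :: "nat \<Rightarrow> int \<Rightarrow> real" where
  "tri1 N k = max 0 (1 - \<bar>of_int k\<bar> / of_nat N)"

text \<open>Induction on N: the products of the new term with the old sum and with itself give every
  frequency between -N and N exactly once, which raises each multiplicity N - |k| by one.\<close>

lemma dirichlet_sum_square:
  "of_real ((norm (dirichlet_sum N t))\<^sup>2) = (\<Sum>k\<in>{-int N<..<int N}. of_int (int N - \<bar>k\<bar>) * cis (of_int k * t))"
proof (induction N)
  case 0
  then show ?case by (simp add: dirichlet_sum_def)
next
  case (Suc N)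
  let ?D = "dirichlet_sum N t"
  let ?c = "cis (of_nat N * t)"
  have pos: "?D * cnj ?c = (\<Sum>k\<in>{-int N..<0}. cis (of_int k * t))"
    unfolding dirichlet_sum_def sum_distrib_right
    by (rule sum.reindex_bij_witness[of _ "\<lambda>k. nat (k + int N)" "\<lambda>k. int k - int N"])
       (auto simp: cis_cnj cis_mult algebra_simps)
  have neg: "cnj ?D * ?c = (\<Sum>k\<in>{0<..int N}. cis (of_int k * t))"
    unfolding dirichlet_sum_def cnj_sum sum_distrib_right
    by (rule sum.reindex_bij_witness[of _ "\<lambda>k. nat (int N - k)" "\<lambda>k. int N - int k"])
       (auto simp: cis_cnj cis_mult algebra_simps)
  have "{-int N..int N} = {-int N..<0} \<union> ({0} \<union> {0<..int N})" by auto
  then have all: "(\<Sum>k\<in>{-int N..int N}. cis (of_int k * t)) = ?D * cnj ?c + (1 + cnj ?D * ?c)"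
  proof -
    have "sum f {-int N..int N} = sum f {-int N..<0} + (f 0 + sum f {0<..int N})" for f :: "int \<Rightarrow> complex"
      unfolding \<open>{-int N..int N} = _\<close> by (subst sum.union_disjoint, simp, simp, force, subst sum.union_disjoint) auto
    from this[of "\<lambda>k. cis (of_int k * t)"] show ?thesis by (simp add: pos neg)
  qed
  have "of_real ((norm (dirichlet_sum (Suc N) t))\<^sup>2) = (?D + ?c) * cnj (?D + ?c)"
    by (simp only: complex_norm_square) (simp add: dirichlet_sum_def)
  also have "\<dots> = ?D * cnj ?D + (?D * cnj ?c + (1 + cnj ?D * ?c))"
    by (simp add: algebra_simps cis_cnj cis_mult)
  also have "?D * cnj ?D = (\<Sum>k\<in>{-int N<..<int N}. of_int (int N - \<bar>k\<bar>) * cis (of_int k * t))"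
    using Suc.IH by (simp only: complex_norm_square)
  \<comment> \<open>The endpoints k = -N and k = N enter with coefficient 0, so the old sum and the
    increment can be added over one range.\<close>
  also have "\<dots> = (\<Sum>k\<in>{-int N..int N}. of_int (int N - \<bar>k\<bar>) * cis (of_int k * t))"
    by (rule sum.mono_neutral_left) auto
  also have "\<dots> + (?D * cnj ?c + (1 + cnj ?D * ?c)) =
     (\<Sum>k\<in>{-int N..int N}. of_int (int (Suc N) - \<bar>k\<bar>) * cis (of_int k * t))"
    unfolding all[symmetric] sum.distrib[symmetric] by (rule sum.cong) (auto simp: algebra_simps)
  also have "{-int N..int N} = {-int (Suc N)<..<int (Suc N)}" by auto
  finally show ?case .
qed

lemma fejer1_eq:
  "N > 0 \<Longrightarrow> of_real (fejer1 N t) = (\<Sum>k\<in>{-int N<..<int N}. of_real (tri1 N k) * cis (of_int k * t))"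
proof -
  assume N: "N > 0"
  have *: "of_real (tri1 N k) = of_int (int N - \<bar>k\<bar>) / (of_nat N :: complex)" if "k \<in> {-int N<..<int N}" for k
  proof -
    have "\<bar>real_of_int k\<bar> < real N" using that by (auto simp: abs_if)
    then have "tri1 N k = of_int (int N - \<bar>k\<bar>) / of_nat N"
      using N by (simp add: tri1_def field_simps)
    then show ?thesis by (simp only: of_real_divide of_real_of_int_eq of_real_of_nat_eq)
  qed
  have "of_real (fejer1 N t) = of_real ((norm (dirichlet_sum N t))\<^sup>2) / (of_nat N :: complex)"
    by (simp add: fejer1_def)
  also have "\<dots> = (\<Sum>k\<in>{-int N<..<int N}. of_int (int N - \<bar>k\<bar>) * cis (of_int k * t) / of_nat N)"
    by (simp only: dirichlet_sum_square sum_divide_distrib)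
  also have "\<dots> = (\<Sum>k\<in>{-int N<..<int N}. of_real (tri1 N k) * cis (of_int k * t))"
    by (rule sum.cong) (simp_all add: *)
  finally show ?thesis .
qed

lemma fejer1_nonneg: "0 \<le> fejer1 N t"
  by (simp add: fejer1_def)

lemma fejer1_le: "fejer1 N t \<le> of_nat N"
proof -
  have "norm (dirichlet_sum N t) \<le> of_nat N"
    unfolding dirichlet_sum_def by (rule order.trans[OF norm_sum]) simp
  then have "(norm (dirichlet_sum N t))\<^sup>2 \<le> (of_nat N)\<^sup>2" by (intro power_mono) auto
  then show ?thesis by (cases "N = 0") (auto simp: fejer1_def field_simps power2_eq_square)
qed

lemma norm_one_minus_cis: "norm (1 - cis t) = 2 * \<bar>sin (t / 2)\<bar>"
proof -
  have "(norm (1 - cis t))\<^sup>2 = 2 - 2 * cos t"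
    using sin_cos_squared_add[of t] by (simp add: cmod_power2) (simp add: algebra_simps power2_eq_square)
  also have "\<dots> = (2 * \<bar>sin (t / 2)\<bar>)\<^sup>2"
    using cos_double_sin[of "t / 2"] by (simp add: power_mult_distrib)
  finally show ?thesis
    by (rule power2_eq_imp_eq) auto
qed

text \<open>Decay away from the multiples of 2 pi: the geometric sum times 1 - cis t is 1 - cis (N
  t), of modulus at most 2.\<close>

lemma fejer1_sin_le: "fejer1 N t * (sin (t / 2))\<^sup>2 \<le> 1 / of_nat N"
proof -
  have "dirichlet_sum N t * (1 - cis t) = 1 - cis (of_nat N * t)"
  proof (induction N)
    case (Suc N)
    have "dirichlet_sum (Suc N) t * (1 - cis t) = dirichlet_sum N t * (1 - cis t) + cis (of_nat N * t) * (1 - cis t)"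
      by (simp add: dirichlet_sum_def algebra_simps)
    also have "\<dots> = 1 - cis (of_nat (Suc N) * t)"
      unfolding Suc.IH by (simp add: algebra_simps cis_mult)
    finally show ?case .
  qed (simp add: dirichlet_sum_def)
  then have "norm (dirichlet_sum N t) * (2 * \<bar>sin (t / 2)\<bar>) = norm (1 - cis (of_nat N * t))"
    by (metis norm_mult norm_one_minus_cis)
  also have "\<dots> \<le> 2" by (simp add: norm_one_minus_cis)
  finally have "norm (dirichlet_sum N t) * \<bar>sin (t / 2)\<bar> \<le> 1" by simp
  then have "(norm (dirichlet_sum N t) * \<bar>sin (t / 2)\<bar>)\<^sup>2 \<le> 1"
    by (simp add: power_le_one)
  then show ?thesis
    by (simp add: fejer1_def power_mult_distrib divide_right_mono)
qed

lemma tri1_bounds [simp]: "0 \<le> tri1 N k" "tri1 N k \<le> 1"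
  by (auto simp: tri1_def)

lemma tri1_0 [simp]: "tri1 N 0 = 1"
  by (simp add: tri1_def)

lemma tri1_eq_0: "int N \<le> \<bar>k\<bar> \<Longrightarrow> N > 0 \<Longrightarrow> tri1 N k = 0"
proof -
  assume "int N \<le> \<bar>k\<bar>" "N > 0"
  then have "real N \<le> \<bar>of_int k\<bar>" by linarith
  with \<open>N > 0\<close> show ?thesis by (simp add: tri1_def)
qed

definition fejer :: "nat \<Rightarrow> real^'n \<Rightarrow> real" where
  "fejer N x = (\<Prod>i\<in>UNIV. fejer1 N (x $ i))"

definition tri :: "nat \<Rightarrow> int^'n \<Rightarrow> real" where
  "tri N m = (\<Prod>i\<in>UNIV. tri1 N (m $ i))"

lemma fejer_eq:
  fixes x :: "real^'n"
  assumes "N > 0"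
  shows "of_real (fejer N x) = (\<Sum>m\<in>box_of {-int N<..<int N}. of_real (tri N m) * character m x)"
proof -
  have "of_real (fejer N x) = (\<Prod>i\<in>UNIV. \<Sum>k\<in>{-int N<..<int N}. of_real (tri1 N k) * cis (of_int k * x $ i))"
    by (simp add: fejer_def fejer1_eq[OF assms])
  also have "\<dots> = (\<Sum>m\<in>box_of {-int N<..<int N}. \<Prod>i\<in>UNIV. of_real (tri1 N (m $ i)) * cis (of_int (m $ i) * x $ i))"
    by (rule sum_box_of_prod[symmetric]) simp
  finally show ?thesis by (simp add: tri_def character_prod prod.distrib)
qed

lemma fejer_nonneg: "0 \<le> fejer N x"
  by (simp add: fejer_def prod_nonneg fejer1_nonneg)

lemma fejer_le: "fejer N (x :: real^'n) \<le> of_nat N ^ CARD('n)"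
proof -
  have "fejer N x \<le> (\<Prod>i\<in>(UNIV :: 'n set). of_nat N)"
    unfolding fejer_def by (rule prod_mono) (auto simp: fejer1_nonneg fejer1_le)
  then show ?thesis by simp
qed

text \<open>The decay is taken in the coordinate \<open>i\<close> alone; every other factor is
  bounded by N.\<close>

lemma fejer_sin_le: "fejer N (x :: real^'n) * (sin (x $ i / 2))\<^sup>2 \<le> of_nat N ^ (CARD('n) - 1) / of_nat N"
proof -
  have "fejer N x * (sin (x $ i / 2))\<^sup>2 = (fejer1 N (x $ i) * (sin (x $ i / 2))\<^sup>2) * (\<Prod>k\<in>UNIV - {i}. fejer1 N (x $ k))"
    unfolding fejer_def by (subst prod.remove[of UNIV i]) auto
  also have "\<dots> \<le> (1 / of_nat N) * (\<Prod>k\<in>UNIV - {i}. of_nat N)"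
    by (intro mult_mono fejer1_sin_le prod_mono prod_nonneg) (auto simp: fejer1_nonneg fejer1_le)
  finally show ?thesis by (simp add: card_Diff_subset)
qed

lemma tri_bounds [simp]: "0 \<le> tri N m" "tri N m \<le> 1"
  by (auto simp: tri_def intro: prod_nonneg prod_le_1)

lemma tri_0 [simp]: "tri N 0 = 1"
  by (simp add: tri_def)

lemma tri_eq_0: "int N \<le> \<bar>m $ i\<bar> \<Longrightarrow> N > 0 \<Longrightarrow> tri N m = 0"
  unfolding tri_def by (rule prod_zero) (auto intro!: bexI[of _ i] tri1_eq_0)

section \<open>Bounded kernels of order \<open>- n\<close>\<close>

lemma abs_sin_mult_le: fixes t :: real shows "\<bar>sin (of_nat n * t)\<bar> \<le> of_nat n * \<bar>sin t\<bar>"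
proof (induction n)
  case (Suc n)
  have "sin (of_nat (Suc n) * t) = sin (of_nat n * t) * cos t + cos (of_nat n * t) * sin t"
    by (simp add: distrib_right sin_add)
  then have "\<bar>sin (of_nat (Suc n) * t)\<bar> \<le> \<bar>sin (of_nat n * t)\<bar> * \<bar>cos t\<bar> + \<bar>cos (of_nat n * t)\<bar> * \<bar>sin t\<bar>"
    by (metis abs_mult abs_triangle_ineq)
  also have "\<dots> \<le> \<bar>sin (of_nat n * t)\<bar> * 1 + 1 * \<bar>sin t\<bar>"
    by (intro add_mono mult_mono) auto
  finally show ?case using Suc by (simp add: algebra_simps)
qed simp

text \<open>With phi t = t / (1 + t), the majorant at t = 2^k z is c (phi (2 t) - phi t). The sum
  telescopes and stays below c for any number of scales, without splitting it where 2^k z passes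
  1.\<close>

lemma dyadic_sum_telescope:
  fixes b :: "nat \<Rightarrow> real" and z :: real
  assumes "z > 0" "\<And>k. b k \<le> c * (2 ^ k * z / ((1 + 2 ^ k * z) * (1 + 2 * (2 ^ k * z))))" "c \<ge> 0"
  shows "(\<Sum>k<K. b k) \<le> c"
proof -
  define \<phi> where "\<phi> t = t / (1 + t)" for t :: real
  have "(\<Sum>k<K. b k) \<le> (\<Sum>k<K. c * \<phi> (2 ^ Suc k * z) - c * \<phi> (2 ^ k * z))"
  proof (rule sum_mono)
    fix k
    have "t / ((1 + t) * (1 + 2 * t)) = \<phi> (2 * t) - \<phi> t" if "t > 0" for t
      using that by (simp add: \<phi>_def divide_simps) (simp add: algebra_simps)
    from this[of "2 ^ k * z"] assms(1) have "2 ^ k * z / ((1 + 2 ^ k * z) * (1 + 2 * (2 ^ k * z))) = \<phi> (2 ^ Suc k * z) - \<phi> (2 ^ k * z)"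
      by (simp add: mult.assoc)
    with assms(2)[of k] show "b k \<le> c * \<phi> (2 ^ Suc k * z) - c * \<phi> (2 ^ k * z)"
      by (simp only: right_diff_distrib)
  qed
  also have "\<dots> = c * \<phi> (2 ^ K * z) - c * \<phi> z"
    using sum_lessThan_telescope[of "\<lambda>k. c * \<phi> (2 ^ k * z)" K] by simp
  also have "\<dots> \<le> c * \<phi> (2 ^ K * z)"
    using assms by (simp add: \<phi>_def)
  also have "\<dots> \<le> c * 1"
  proof (rule mult_left_mono)
    have "2 ^ K * z > 0" using assms(1) by simp
    then show "\<phi> (2 ^ K * z) \<le> 1" by (simp add: \<phi>_def)
  qed (rule assms(3))
  finally show ?thesis by simp
qed

text \<open>With t = 2^k z, the terms are at most t for small t and t^(-2) for large t. Both regimes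
  lie under one telescoping majorant, which makes the bound independent of \<open>K\<close> and
  \<open>z\<close>.\<close>

lemma dyadic_min_sum:
  fixes z :: real
  assumes "z \<ge> 0" "\<And>k. b k \<le> 2 ^ k * z" "\<And>k. b k * (2 ^ k * z)\<^sup>2 \<le> 1"
  shows "(\<Sum>k<K. b k) \<le> 12"
proof (cases "z = 0")
  case True
  then have "(\<Sum>k<K. b k) \<le> 0" using assms(2) by (intro sum_nonpos) simp
  then show ?thesis by simp
next
  case False
  show ?thesis
  proof (rule dyadic_sum_telescope[of z])
    fix k
    define t where "t = 2 ^ k * z"
    have t: "t > 0" using False assms(1) by (simp add: t_def)
    have "b k * ((1 + t) * (1 + 2 * t)) \<le> 12 * t"
    proof (cases "b k \<le> 0")
      case True
      have "b k * ((1 + t) * (1 + 2 * t)) \<le> 0" using True t by (simp add: mult_nonpos_nonneg)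
      with t show ?thesis by simp
    next
      case False
      show ?thesis
      proof (cases "t \<le> 1")
        case True
        have "b k * ((1 + t) * (1 + 2 * t)) \<le> t * ((1 + 1) * (1 + 2 * 1))"
          using True t False assms(2)[of k] by (intro mult_mono) (auto simp: t_def)
        then show ?thesis using t by simp
      next
        case ge: False
        have "b k * ((1 + t) * (1 + 2 * t)) \<le> b k * ((t + t) * (t + 2 * t))"
          using ge False by (intro mult_left_mono mult_mono) auto
        also have "\<dots> = 6 * (b k * t\<^sup>2)" by (simp add: power2_eq_square)
        also have "\<dots> \<le> 6" using assms(3)[of k] by (simp add: t_def)
        finally show ?thesis using ge by simp
      qed
    qed
    then show "b k \<le> 12 * (2 ^ k * z / ((1 + 2 ^ k * z) * (1 + 2 * (2 ^ k * z))))"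
      using t unfolding t_def[symmetric] by (simp add: pos_le_divide_eq)
  qed (use False assms(1) in auto)
qed

text \<open>A geometric tail is governed by its first term, here of order at most 1 / z. The
  telescoping variable is 2^k / z, which exceeds 1 exactly on the tail.\<close>

lemma dyadic_tail_sum:
  fixes z :: real
  assumes "z > 0"
  shows "(\<Sum>k<K. if z < 2 ^ k then 1 / 2 ^ k else 0) \<le> 6 / z"
proof (rule dyadic_sum_telescope[of "1 / z"])
  fix k
  define t where "t = 2 ^ k * (1 / z)"
  have t: "t > 0" using assms by (simp add: t_def)
  show "(if z < 2 ^ k then 1 / 2 ^ k else 0) \<le> 6 / z * (2 ^ k * (1 / z) / ((1 + 2 ^ k * (1 / z)) * (1 + 2 * (2 ^ k * (1 / z)))))"
    unfolding t_def[symmetric]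
  proof (cases "z < 2 ^ k")
    case True
    then have t1: "t > 1" using assms by (simp add: t_def)
    have "(1 + t) * (1 + 2 * t) \<le> (t + t) * (t + 2 * t)"
      using t1 by (intro mult_mono) auto
    then have "1 / t \<le> 6 * (t / ((1 + t) * (1 + 2 * t)))"
      using t by (simp add: divide_simps)
    then have "1 / t / z \<le> 6 * (t / ((1 + t) * (1 + 2 * t))) / z"
      using assms by (intro divide_right_mono) auto
    moreover have "1 / t / z = 1 / 2 ^ k" using assms by (simp add: t_def)
    ultimately show "(if z < 2 ^ k then 1 / 2 ^ k else 0) \<le> 6 / z * (t / ((1 + t) * (1 + 2 * t)))"
      using True by (simp add: mult_ac)
  qed (use t assms in simp)
qed (use assms in auto)

text \<open>
  The dyadic sum of these kernels replaces the one with multiplier \<open>m\<^sub>j * |m|\<^bsup>-n-1\<^esup>\<close>: the sine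
  makes a term small where \<open>N * |x|\<close> is small, the decay of the Fejer kernel where it is large.
\<close>

definition odd_kernel :: "'n \<Rightarrow> nat \<Rightarrow> real^'n \<Rightarrow> real" where
  "odd_kernel j N x = 2 * sin (of_nat N * x $ j) * fejer N x / of_nat N ^ CARD('n)"

definition odd_coeff :: "'n \<Rightarrow> nat \<Rightarrow> int^'n \<Rightarrow> real" where
  "odd_coeff j N m = (tri N (m - axis j (int N)) - tri N (m + axis j (int N))) / of_nat N ^ CARD('n)"

text \<open>The factor 2 i sin (N x_j) is a difference of two characters, so the Fejer coefficients
  are moved by N and by -N along axis j and subtracted. Both copies lie where all |m_i| < 2 N,
  whence the condition on \<open>M\<close>.\<close>

lemma odd_kernel_eq:
  fixes x :: "real^'n"
  assumes N: "N > 0" and M: "2 * N \<le> M"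
  shows "\<i> * of_real (odd_kernel j N x) = (\<Sum>m\<in>box_of {-int M<..<int M}. of_real (odd_coeff j N m) * character m x)"
proof -
  let ?B = "box_of {-int M<..<int M} :: (int^'n) set"
  have shift: "(\<Sum>m\<in>?B. of_real (tri N (m - axis j s)) * character m x) = of_real (fejer N x) * cis (of_int s * x $ j)"
    if s: "\<bar>s\<bar> = int N" for s
  proof -
    have "(\<Sum>m\<in>?B. of_real (tri N (m - axis j s)) * character m x)
        = (\<Sum>m\<in>(+) (axis j s) ` box_of {-int N<..<int N}. of_real (tri N (m - axis j s)) * character m x)"
    proof (rule sum.mono_neutral_right)
      show "(+) (axis j s) ` box_of {-int N<..<int N} \<subseteq> ?B"
      proof safe
        fix k :: "int^'n" assume k: "k \<in> box_of {-int N<..<int N}"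
        have "(axis j s + k) $ i \<in> {-int M<..<int M}" for i
        proof -
          have "\<bar>axis j s $ i\<bar> \<le> int N" using s by (simp add: axis_def)
          moreover have "\<bar>k $ i\<bar> < int N" using k unfolding box_of_def abs_less_iff by (auto simp: minus_less_iff)
          ultimately have "\<bar>(axis j s + k) $ i\<bar> < int M" using M by simp
          then show ?thesis by auto
        qed
        then show "axis j s + k \<in> ?B" by (simp add: box_of_def)
      qed
      show "\<forall>m\<in>?B - (+) (axis j s) ` box_of {-int N<..<int N}. of_real (tri N (m - axis j s)) * character m x = 0"
      proof
        fix m :: "int^'n" assume m: "m \<in> ?B - (+) (axis j s) ` box_of {-int N<..<int N}"
        have "m - axis j s \<notin> box_of {-int N<..<int N}"
        proof
          assume "m - axis j s \<in> box_of {-int N<..<int N}"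
          then have "axis j s + (m - axis j s) \<in> (+) (axis j s) ` box_of {-int N<..<int N}" by blast
          with m show False by simp
        qed
        then obtain i where "(m - axis j s) $ i \<notin> {-int N<..<int N}" unfolding box_of_def by blast
        then have "int N \<le> \<bar>(m - axis j s) $ i\<bar>" by auto
        from tri_eq_0[OF this N] show "of_real (tri N (m - axis j s)) * character m x = 0" by simp
      qed
    qed simp
    also have "\<dots> = (\<Sum>k\<in>box_of {-int N<..<int N}. of_real (tri N k) * (character (axis j s) x * character k x))"
      by (subst sum.reindex) (simp_all add: character_add)
    also have "\<dots> = of_real (fejer N x) * character (axis j s) x"
      unfolding fejer_eq[OF N] sum_distrib_right by (simp add: mult_ac)
    finally show ?thesis by (simp add: character_axis)
  qed
  have minus: "m - axis j (- int N) = m + axis j (int N)" for m :: "int^'n"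
    by (auto simp: vec_eq_iff axis_def)
  have "\<i> * of_real (odd_kernel j N x) = of_real (fejer N x) * (2 * \<i> * of_real (sin (of_nat N * x $ j))) / of_nat N ^ CARD('n)"
    by (simp add: odd_kernel_def)
  also have "2 * \<i> * of_real (sin (of_nat N * x $ j)) = cis (of_int (int N) * x $ j) - cis (of_int (- int N) * x $ j)"
    by (simp add: complex_eq_iff)
  also have "of_real (fejer N x) * \<dots> / of_nat N ^ CARD('n) =
     ((\<Sum>m\<in>?B. of_real (tri N (m - axis j (int N))) * character m x)
      - (\<Sum>m\<in>?B. of_real (tri N (m + axis j (int N))) * character m x)) / of_nat N ^ CARD('n)"
    using shift[of "int N"] shift[of "- int N"] by (simp add: minus right_diff_distrib)
  also have "\<dots> = (\<Sum>m\<in>?B. of_real (odd_coeff j N m) * character m x)"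
    by (simp add: odd_coeff_def sum_divide_distrib diff_divide_distrib left_diff_distrib flip: sum_subtractf)
  finally show ?thesis .
qed

text \<open>The number s measures the periodic distance of x from the origin. At scale N = 2^k the
  sine factor is O(N s), and the Fejer factor divided by N^n is O((N s)^(-2)) by its decay in the
  coordinate where s is attained.\<close>

lemma sum_odd_kernel_bound: "\<bar>\<Sum>k<K. odd_kernel j (2 ^ k) (x :: real^'n)\<bar> \<le> 48"
proof -
  define s where "s = Max (range (\<lambda>i::'n. \<bar>sin (x $ i / 2)\<bar>))"
  obtain i where i: "s = \<bar>sin (x $ i / 2)\<bar>"
  proof -
    have "s \<in> range (\<lambda>i::'n. \<bar>sin (x $ i / 2)\<bar>)" unfolding s_def by (rule Max_in) auto
    then show ?thesis using that by auto
  qed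
  have sj: "\<bar>sin (x $ j / 2)\<bar> \<le> s" unfolding s_def by (rule Max_ge) auto
  have s0: "s \<ge> 0" using i by simp
  \<comment> \<open>Division by 4 makes both bounds hold with constant 1; the 48 is 4 times the 12
    of \<open>dyadic_min_sum\<close>.\<close>
  define b where "b k = \<bar>odd_kernel j (2 ^ k) x\<bar> / 4" for k :: nat
  have n: "CARD('n) \<ge> 1" by (simp add: Suc_le_eq)
  have eq: "b k = \<bar>sin (of_nat (2 ^ k) * x $ j)\<bar> / 2 * (fejer (2 ^ k) x / of_nat (2 ^ k) ^ CARD('n))" for k
    by (simp add: b_def odd_kernel_def abs_mult fejer_nonneg)
  have fq: "fejer N x / of_nat N ^ CARD('n) \<le> 1" "fejer N x / of_nat N ^ CARD('n) \<ge> 0" if "N > 0" for N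
    using fejer_le[of N x] fejer_nonneg[of N x] that by (auto simp: divide_simps)
  have "(\<Sum>k<K. b k) \<le> 12"
  proof (rule dyadic_min_sum[OF s0])
    fix k
    have "\<bar>sin (of_nat (2 ^ k) * x $ j)\<bar> = \<bar>sin (of_nat (2 * 2 ^ k) * (x $ j / 2))\<bar>" by (simp add: mult_ac)
    also have "\<dots> \<le> of_nat (2 * 2 ^ k) * \<bar>sin (x $ j / 2)\<bar>" by (rule abs_sin_mult_le)
    also have "\<dots> \<le> of_nat (2 * 2 ^ k) * s" by (intro mult_left_mono sj) auto
    finally have sb: "\<bar>sin (of_nat (2 ^ k) * x $ j)\<bar> / 2 \<le> 2 ^ k * s" by simp
    have "b k \<le> (2 ^ k * s) * 1"
      unfolding eq using s0 by (intro mult_mono sb fq) auto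
    then show "b k \<le> 2 ^ k * s" by simp
    have "b k \<le> 1 * (fejer (2 ^ k) x / of_nat (2 ^ k) ^ CARD('n))"
      unfolding eq using abs_sin_le_one[of "of_nat (2 ^ k) * x $ j"] by (intro mult_right_mono fq) (auto simp del: abs_sin_le_one)
    then have "b k * (2 ^ k * s)\<^sup>2 \<le> fejer (2 ^ k) x / of_nat (2 ^ k) ^ CARD('n) * (2 ^ k * s)\<^sup>2"
      by (intro mult_right_mono) auto
    also have "\<dots> = fejer (2 ^ k) x * (sin (x $ i / 2))\<^sup>2 * ((2 ^ k)\<^sup>2 / of_nat (2 ^ k) ^ CARD('n))"
      by (simp add: i power_mult_distrib)
    also have "\<dots> \<le> of_nat (2 ^ k) ^ (CARD('n) - 1) / of_nat (2 ^ k) * ((2 ^ k)\<^sup>2 / of_nat (2 ^ k) ^ CARD('n))"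
      by (intro mult_right_mono fejer_sin_le) auto
    also have "\<dots> = 1"
      using n by (simp add: power_diff power2_eq_square divide_simps)
    finally show "b k * (2 ^ k * s)\<^sup>2 \<le> 1" .
  qed
  moreover have "\<bar>\<Sum>k<K. odd_kernel j (2 ^ k) x\<bar> \<le> (\<Sum>k<K. 4 * b k)"
    by (rule order.trans[OF sum_abs]) (simp add: b_def)
  ultimately show ?thesis by (simp flip: sum_distrib_left)
qed

section \<open>Sign and size of the kernel coefficients\<close>

lemma tri_uminus: "tri N (- m) = tri N m"
  by (simp add: tri_def tri1_def)

lemma odd_coeff_0: "odd_coeff j N 0 = 0"
  using tri_uminus[of N "axis j (int N)"] by (simp add: odd_coeff_def)

lemma abs_odd_coeff_le: "\<bar>odd_coeff j N (m :: int^'n)\<bar> \<le> 1 / of_nat N ^ CARD('n)"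
proof -
  have "\<bar>tri N (m - axis j (int N)) - tri N (m + axis j (int N))\<bar> \<le> 1"
    using tri_bounds[of N "m - axis j (int N)"] tri_bounds[of N "m + axis j (int N)"] by linarith
  then show ?thesis by (simp add: odd_coeff_def divide_right_mono)
qed

lemma odd_coeff_eq_0:
  assumes "2 * int N \<le> \<bar>m $ i\<bar>" "N > 0"
  shows "odd_coeff j N m = 0"
proof -
  have "int N \<le> \<bar>(m - axis j (int N)) $ i\<bar>" "int N \<le> \<bar>(m + axis j (int N)) $ i\<bar>"
    using assms by (auto simp: axis_def)
  from this[THEN tri_eq_0] show ?thesis using assms by (simp add: odd_coeff_def)
qed

lemma tri_axis_split:
  "tri N (m + axis j s) = tri1 N (m $ j + s) * (\<Prod>i\<in>UNIV - {j}. tri1 N (m $ i))"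
proof -
  have "tri N (m + axis j s) = tri1 N ((m + axis j s) $ j) * (\<Prod>i\<in>UNIV - {j}. tri1 N ((m + axis j s) $ i))"
    unfolding tri_def by (subst prod.remove[of UNIV j]) auto
  also have "(\<Prod>i\<in>UNIV - {j}. tri1 N ((m + axis j s) $ i)) = (\<Prod>i\<in>UNIV - {j}. tri1 N (m $ i))"
    by (rule prod.cong) (auto simp: axis_def)
  finally show ?thesis by (simp add: axis_def)
qed

lemma odd_coeff_split:
  "odd_coeff j N m = (tri1 N (m $ j - int N) - tri1 N (m $ j + int N)) *
     (\<Prod>i\<in>UNIV - {j}. tri1 N (m $ i)) / of_nat N ^ CARD('n)" for m :: "int^'n"
proof -
  have "m - axis j (int N) = m + axis j (- int N)" by (auto simp: vec_eq_iff axis_def)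
  then show ?thesis by (simp only: odd_coeff_def tri_axis_split left_diff_distrib) simp
qed

lemma tri1_antimono: "\<bar>k\<bar> \<le> \<bar>l\<bar> \<Longrightarrow> tri1 N l \<le> tri1 N k"
proof -
  assume "\<bar>k\<bar> \<le> \<bar>l\<bar>"
  then have "\<bar>real_of_int k\<bar> \<le> \<bar>real_of_int l\<bar>" by linarith
  then have "\<bar>real_of_int k\<bar> / N \<le> \<bar>real_of_int l\<bar> / N" by (rule divide_right_mono) simp
  then show ?thesis by (auto simp: tri1_def)
qed

text \<open>For m_j nonnegative, m_j - N is no farther from 0 than m_j + N, and the tent decreases
  away from 0. Because of this sign nothing cancels when scales are added, so a lower bound at a
  single scale suffices.\<close>

lemma odd_coeff_sign: "odd_coeff j N m * of_int (m $ j) \<ge> 0"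
proof -
  have P: "(\<Prod>i\<in>UNIV - {j}. tri1 N (m $ i)) \<ge> 0" by (simp add: prod_nonneg)
  have "(tri1 N (m $ j - int N) - tri1 N (m $ j + int N)) * of_int (m $ j) \<ge> 0"
  proof (cases "m $ j \<ge> 0")
    case True
    then show ?thesis by (intro mult_nonneg_nonneg) (auto intro!: tri1_antimono)
  next
    case False
    then show ?thesis by (intro mult_nonpos_nonpos) (auto intro!: tri1_antimono)
  qed
  then have "(tri1 N (m $ j - int N) - tri1 N (m $ j + int N)) * of_int (m $ j) *
     ((\<Prod>i\<in>UNIV - {j}. tri1 N (m $ i)) / of_nat N ^ CARD('a)) \<ge> 0"
    by (intro mult_nonneg_nonneg[of "_ * of_int _"] divide_nonneg_nonneg P) auto
  then show ?thesis by (simp add: odd_coeff_split mult_ac)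
qed

text \<open>The scale N is comparable with the largest component m_j. Then the tents in the other
  coordinates are at least 1/2; of the two shifted tents the one on the side of m_j is at least 1/4,
  and the other vanishes. The power 8^n combines (1/2)^n with N^n \<le> (4 |m_j|)^n.\<close>

lemma odd_coeff_lower:
  fixes m :: "int^'n"
  assumes M: "\<And>i. \<bar>m $ i\<bar> \<le> \<bar>m $ j\<bar>" "m $ j \<noteq> 0"
    and N: "2 * \<bar>m $ j\<bar> \<le> int N" "int N \<le> 4 * \<bar>m $ j\<bar>"
  shows "odd_coeff j N m * of_int (m $ j) \<ge> \<bar>of_int (m $ j)\<bar> / (8 * 8 ^ CARD('n) * \<bar>of_int (m $ j)\<bar> ^ CARD('n))"
proof -
  define a where "a = \<bar>real_of_int (m $ j)\<bar>"
  have a: "a > 0" using M by (simp add: a_def)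
  have N0: "N > 0" using N M by linarith
  have Na: "2 * a \<le> N" "N \<le> 4 * a"
    using N unfolding a_def by linarith+
  have half: "1 / 2 \<le> tri1 N (m $ i)" for i
  proof -
    have "\<bar>real_of_int (m $ i)\<bar> \<le> a" using M(1)[of i] unfolding a_def by linarith
    then have "\<bar>real_of_int (m $ i)\<bar> / N \<le> 1 / 2" using Na N0 by (simp add: divide_simps)
    then show ?thesis unfolding tri1_def by linarith
  qed
  have "(1 / 2) ^ CARD('n) \<le> (1 / 2 :: real) ^ card (UNIV - {j})"
    by (rule power_decreasing) (auto simp: card_Diff_subset)
  also have "\<dots> = (\<Prod>i\<in>UNIV - {j}. 1 / 2)" by simp
  also have "\<dots> \<le> (\<Prod>i\<in>UNIV - {j}. tri1 N (m $ i))" by (intro prod_mono) (use half in auto)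
  finally have P: "(1 / 2) ^ CARD('n) \<le> (\<Prod>i\<in>UNIV - {j}. tri1 N (m $ i))" .
  have D: "(tri1 N (m $ j - int N) - tri1 N (m $ j + int N)) * of_int (m $ j) \<ge> a / 8"
  proof (cases "m $ j > 0")
    case True
    have "tri1 N (m $ j + int N) = 0" using True N0 by (intro tri1_eq_0) auto
    moreover have "tri1 N (m $ j - int N) \<ge> 1 / 4"
    proof -
      have "\<bar>real_of_int (m $ j - int N)\<bar> = N - a" using True Na a by (simp add: a_def)
      then have "\<bar>real_of_int (m $ j - int N)\<bar> / N \<le> 3 / 4" using Na N0 by (simp add: divide_simps)
      then show ?thesis unfolding tri1_def by linarith
    qed
    ultimately show ?thesis using True by (simp add: a_def)
  next
    case False
    then have neg: "m $ j < 0" using M by simp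
    have "tri1 N (m $ j - int N) = 0" using neg N0 by (intro tri1_eq_0) auto
    moreover have "tri1 N (m $ j + int N) \<ge> 1 / 4"
    proof -
      have "\<bar>real_of_int (m $ j + int N)\<bar> = N - a" using neg Na a by (simp add: a_def)
      then have "\<bar>real_of_int (m $ j + int N)\<bar> / N \<le> 3 / 4" using Na N0 by (simp add: divide_simps)
      then show ?thesis unfolding tri1_def by linarith
    qed
    ultimately show ?thesis using neg mult_right_mono[of "1/4" "tri1 N (m $ j + int N)" a] by (simp add: a_def)
  qed
  have "a / (8 * 8 ^ CARD('n) * a ^ CARD('n)) = a / 8 * (1 / 2) ^ CARD('n) / (4 * a) ^ CARD('n)"
    by (simp add: power_mult_distrib power_divide flip: power_mult_distrib[of 2 4])
  also have "\<dots> \<le> a / 8 * (1 / 2) ^ CARD('n) / of_nat N ^ CARD('n)"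
    using Na a N0 by (intro divide_left_mono power_mono mult_pos_pos) auto
  also have "\<dots> \<le> ((tri1 N (m $ j - int N) - tri1 N (m $ j + int N)) * of_int (m $ j)) *
     (\<Prod>i\<in>UNIV - {j}. tri1 N (m $ i)) / of_nat N ^ CARD('n)"
    using a by (intro divide_right_mono mult_mono D P) (auto intro: order.trans[OF _ D])
  also have "\<dots> = odd_coeff j N m * of_int (m $ j)" by (simp add: odd_coeff_split mult_ac)
  finally show ?thesis by (simp add: a_def)
qed

lemma norm_real_vec_le:
  fixes m :: "int^'n"
  assumes "\<And>i. \<bar>of_int (m $ i)\<bar> \<le> M"
  shows "norm (real_vec m) \<le> real CARD('n) * M"
proof -
  have "norm (real_vec m) \<le> (\<Sum>i\<in>UNIV. \<bar>real_vec m $ i\<bar>)" by (rule norm_le_l1_cart)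
  also have "\<dots> \<le> (\<Sum>i\<in>(UNIV::'n set). M)" using assms by (intro sum_mono) (simp add: real_vec_def)
  finally show ?thesis by simp
qed

lemma obtain_max_component:
  fixes m :: "int^'n"
  assumes "m \<noteq> 0"
  obtains j where "\<And>i. \<bar>m $ i\<bar> \<le> \<bar>m $ j\<bar>" "m $ j \<noteq> 0"
proof -
  define M where "M = Max (range (\<lambda>i. \<bar>m $ i\<bar>))"
  have "M \<in> range (\<lambda>i. \<bar>m $ i\<bar>)" unfolding M_def by (rule Max_in) auto
  then obtain j where j: "M = \<bar>m $ j\<bar>" by auto
  have le: "\<bar>m $ i\<bar> \<le> \<bar>m $ j\<bar>" for i unfolding j[symmetric] M_def by (rule Max_ge) auto
  moreover have "m $ j \<noteq> 0" using le assms by (fastforce simp: vec_eq_iff)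
  ultimately show ?thesis by (rule that)
qed

definition test_coeff :: "nat \<Rightarrow> 'n \<Rightarrow> int^'n \<Rightarrow> real" where
  "test_coeff K j m = (\<Sum>k<K. odd_coeff j (2 ^ k) m)"

lemma test_coeff_0: "test_coeff K j 0 = 0"
  by (simp add: test_coeff_def odd_coeff_0)

lemma test_coeff_sign: "0 \<le> test_coeff K j m * of_int (m $ j)"
  unfolding test_coeff_def sum_distrib_right by (intro sum_nonneg odd_coeff_sign)

text \<open>Every scale 2^k with k < K has its coefficients in this box, so the sum is i times a sum
  of odd kernels. The bound does not grow with \<open>K\<close>.\<close>

lemma test_kernel_bound:
  fixes x :: "real^'n"
  shows "norm (\<Sum>m\<in>box_of {-(2 ^ K)<..<2 ^ K}. of_real (test_coeff K j m) * character m x) \<le> 48"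
proof -
  have "(\<Sum>m\<in>box_of {-(2 ^ K)<..<2 ^ K}. of_real (test_coeff K j m) * character m x)
      = (\<Sum>k<K. \<Sum>m\<in>box_of {-(2 ^ K)<..<2 ^ K}. of_real (odd_coeff j (2 ^ k) m) * character m x)"
    unfolding test_coeff_def by (subst sum.swap) (simp add: sum_distrib_right)
  also have "\<dots> = (\<Sum>k<K. \<i> * of_real (odd_kernel j (2 ^ k) x))"
  proof (rule sum.cong[OF refl])
    fix k assume "k \<in> {..<K}"
    then have "2 * 2 ^ k \<le> (2 ^ K :: nat)"
      using power_increasing[of "Suc k" K "2::nat"] by simp
    from odd_kernel_eq[OF _ this, of j x]
    show "(\<Sum>m\<in>box_of {-(2 ^ K)<..<2 ^ K}. of_real (odd_coeff j (2 ^ k) m) * character m x) = \<i> * of_real (odd_kernel j (2 ^ k) x)"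
      by simp
  qed
  also have "\<dots> = \<i> * of_real (\<Sum>k<K. odd_kernel j (2 ^ k) x)"
    by (simp add: sum_distrib_left)
  finally show ?thesis using sum_odd_kernel_bound[where K=K and j=j and x=x] by (simp add: norm_mult del: of_real_sum)
qed

text \<open>Let M be the largest |m_i|. Only scales with 2^k > M / 2 reach m, each with at most
  2^(-k n). Of the n factors 2^(-k), n - 1 are replaced by 2 / M and the last one is summed by
  \<open>dyadic_tail_sum\<close>; this gives O(M^(-n)) also for n = 1.\<close>

lemma test_coeff_upper:
  fixes m :: "int^'n"
  shows "\<bar>test_coeff K j m\<bar> * norm (real_vec m) ^ CARD('n) \<le> 6 * (2 * real CARD('n)) ^ CARD('n)"
proof (cases "m = 0")
  case False
  then obtain i where i: "\<And>k. \<bar>m $ k\<bar> \<le> \<bar>m $ i\<bar>" "m $ i \<noteq> 0" using obtain_max_component by blast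
  define M where "M = \<bar>real_of_int (m $ i)\<bar>"
  have M: "M > 0" using i by (simp add: M_def)
  have n: "Suc (CARD('n) - 1) = CARD('n)" by (simp add: Suc_pred)
  have "\<bar>test_coeff K j m\<bar> \<le> (\<Sum>k<K. \<bar>odd_coeff j (2 ^ k) m\<bar>)"
    unfolding test_coeff_def by (rule sum_abs)
  also have "\<dots> \<le> (\<Sum>k<K. (2 / M) ^ (CARD('n) - 1) * (if M / 2 < 2 ^ k then 1 / 2 ^ k else 0))"
  proof (rule sum_mono)
    fix k
    show "\<bar>odd_coeff j (2 ^ k) m\<bar> \<le> (2 / M) ^ (CARD('n) - 1) * (if M / 2 < 2 ^ k then 1 / 2 ^ k else 0)"
    proof (cases "M / 2 < 2 ^ k")
      case True
      have "\<bar>odd_coeff j (2 ^ k) m\<bar> \<le> (1 / 2 ^ k) ^ CARD('n)"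
        using abs_odd_coeff_le[of j "2 ^ k" m] by (simp add: power_one_over)
      also have "\<dots> = (1 / 2 ^ k) ^ (CARD('n) - 1) * (1 / 2 ^ k)"
        by (subst n[symmetric], subst power_Suc) (simp only: mult.commute)
      also have "\<dots> \<le> (2 / M) ^ (CARD('n) - 1) * (1 / 2 ^ k)"
        using True M by (intro mult_right_mono power_mono) (auto simp: field_simps)
      finally show ?thesis using True by simp
    next
      case f: False
      then have "2 * real_of_int (int (2 ^ k)) \<le> real_of_int \<bar>m $ i\<bar>" by (simp add: M_def)
      then have "2 * int (2 ^ k) \<le> \<bar>m $ i\<bar>" by linarith
      from odd_coeff_eq_0[OF this] show ?thesis using f by simp
    qed
  qed
  also have "\<dots> = (2 / M) ^ (CARD('n) - 1) * (\<Sum>k<K. (if M / 2 < 2 ^ k then 1 / 2 ^ k else 0))"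
    by (simp add: sum_distrib_left)
  also have "\<dots> \<le> (2 / M) ^ (CARD('n) - 1) * (6 / (M / 2))"
    using M by (intro mult_left_mono dyadic_tail_sum) auto
  also have "\<dots> = 6 * ((2 / M) ^ (CARD('n) - 1) * (2 / M))" by simp
  also have "(2 / M) ^ (CARD('n) - 1) * (2 / M) = (2 / M) ^ CARD('n)"
    by (metis n power_Suc2)
  finally have "\<bar>test_coeff K j m\<bar> \<le> 6 * (2 / M) ^ CARD('n)" .
  moreover have "norm (real_vec m) \<le> real CARD('n) * M"
  proof (rule norm_real_vec_le)
    fix k show "\<bar>real_of_int (m $ k)\<bar> \<le> M" using i(1)[of k] unfolding M_def by linarith
  qed
  ultimately have "\<bar>test_coeff K j m\<bar> * norm (real_vec m) ^ CARD('n) \<le> 6 * (2 / M) ^ CARD('n) * (real CARD('n) * M) ^ CARD('n)"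
    using M by (intro mult_mono power_mono) auto
  also have "\<dots> = 6 * (2 / M * (real CARD('n) * M)) ^ CARD('n)" by (simp only: power_mult_distrib mult.assoc)
  also have "2 / M * (real CARD('n) * M) = 2 * real CARD('n)" using M by simp
  finally show ?thesis .
qed (simp add: test_coeff_0)

text \<open>All terms of the double sum over components and scales are nonnegative, so it is enough
  to keep a largest component j and one scale comparable with |m_j|. The condition 4 |m_i| < 2^K
  guarantees that this scale is among those summed.\<close>

lemma test_coeff_lower:
  fixes m :: "int^'n"
  assumes m: "m \<noteq> 0" "\<And>i. 4 * \<bar>m $ i\<bar> < 2 ^ K"
  shows "1 / (8 * 8 ^ CARD('n) * real CARD('n)) \<le>
    (\<Sum>j\<in>UNIV. test_coeff K j m * of_int (m $ j) / norm (real_vec m)) * norm (real_vec m) ^ CARD('n)"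
proof -
  obtain j where j: "\<And>k. \<bar>m $ k\<bar> \<le> \<bar>m $ j\<bar>" "m $ j \<noteq> 0" using obtain_max_component[OF m(1)] by blast
  define M where "M = \<bar>real_of_int (m $ j)\<bar>"
  define r where "r = norm (real_vec m)"
  have M: "M > 0" using j by (simp add: M_def)
  have r: "r > 0" using m by (simp add: r_def)
  have Mr: "M \<le> r" unfolding M_def r_def using component_le_norm_cart[of "real_vec m" j] by (simp add: real_vec_def)
  have rM: "r \<le> real CARD('n) * M"
    unfolding r_def
  proof (rule norm_real_vec_le)
    fix k show "\<bar>real_of_int (m $ k)\<bar> \<le> M" using j(1)[of k] unfolding M_def by linarith
  qed
  obtain k where k: "2 * \<bar>m $ j\<bar> \<le> 2 ^ k" "2 ^ k \<le> 4 * \<bar>m $ j\<bar>"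
  proof -
    \<comment> \<open>The least power of 2 that is not below 2 |m_j|: its predecessor fails, so it
      is at most 4 |m_j|; exponent 0 fails because |m_j| is at least 1.\<close>
    define P where "P k \<longleftrightarrow> 2 * \<bar>m $ j\<bar> \<le> 2 ^ k" for k
    have "P K" using m(2)[of j] unfolding P_def by linarith
    then have P: "P (LEAST k. P k)" by (rule LeastI)
    have "\<not> P 0" using j(2) unfolding P_def by simp
    with P obtain k' where k': "(LEAST k. P k) = Suc k'" by (metis not0_implies_Suc)
    then have "\<not> P k'" using not_less_Least[of k' P] by simp
    with P k' show ?thesis by (intro that[of "Suc k'"]) (auto simp: P_def)
  qed
  have "2 ^ k < (2 ^ K :: int)" using k(2) m(2)[of j] by linarith
  then have kK: "k < K" by simp
  have "M / (8 * 8 ^ CARD('n) * M ^ CARD('n)) \<le> odd_coeff j (2 ^ k) m * of_int (m $ j)"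
    unfolding M_def by (rule odd_coeff_lower[OF j]) (use k in auto)
  also have "\<dots> \<le> (\<Sum>k<K. odd_coeff j (2 ^ k) m * of_int (m $ j))"
    by (rule member_le_sum) (use kK odd_coeff_sign in auto)
  also have "\<dots> = test_coeff K j m * of_int (m $ j)" by (simp add: test_coeff_def sum_distrib_right)
  also have "\<dots> \<le> (\<Sum>j\<in>UNIV. test_coeff K j m * of_int (m $ j))"
    by (rule member_le_sum) (auto simp: test_coeff_sign)
  finally have "M / (8 * 8 ^ CARD('n) * M ^ CARD('n)) * (r ^ CARD('n) / r) \<le> (\<Sum>j\<in>UNIV. test_coeff K j m * of_int (m $ j)) * (r ^ CARD('n) / r)"
    using r by (intro mult_right_mono) auto
  also have "\<dots> = (\<Sum>j\<in>UNIV. test_coeff K j m * of_int (m $ j) / r) * r ^ CARD('n)"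
    by (simp add: sum_divide_distrib[symmetric])
  finally have *: "M / (8 * 8 ^ CARD('n) * M ^ CARD('n)) * (r ^ CARD('n) / r) \<le> \<dots>" .
  have "1 / (8 * 8 ^ CARD('n) * real CARD('n)) * 1 \<le> M / (8 * 8 ^ CARD('n) * r) * (r ^ CARD('n) / M ^ CARD('n))"
  proof (rule mult_mono)
    show "1 / (8 * 8 ^ CARD('n) * real CARD('n)) \<le> M / (8 * 8 ^ CARD('n) * r)"
      using rM M r by (simp add: divide_simps mult_ac)
    show "1 \<le> r ^ CARD('n) / M ^ CARD('n)" using Mr M by (simp add: power_mono)
  qed (use M r in auto)
  also have "\<dots> = M / (8 * 8 ^ CARD('n) * M ^ CARD('n)) * (r ^ CARD('n) / r)" by (simp add: mult_ac)
  finally show ?thesis using * unfolding r_def by linarith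
qed

section \<open>A penalised finite-dimensional problem\<close>

definition weight :: "int^'n \<Rightarrow> real" where
  "weight m = norm (real_vec m) powr (real CARD('n) / 2)"

text \<open>\<open>None\<close> stands for f_0 and \<open>Some i\<close> for f_i. At m = 0 the
  quotient is 0 / 0 = 0, in agreement with the convention in \<open>conj_riesz\<close>.\<close>

definition symbol :: "'n option \<Rightarrow> int^'n \<Rightarrow> complex" where
  "symbol j m = (case j of None \<Rightarrow> 1 | Some i \<Rightarrow> - \<i> * of_int (m $ i) / of_real (norm (real_vec m)))"

definition synth :: "('n option \<Rightarrow> int^'n \<Rightarrow> complex) \<Rightarrow> int^'n \<Rightarrow> complex" where
  "synth F m = of_real (weight m) * (\<Sum>j\<in>UNIV. symbol j m * F j m)"

definition grid_coeff :: "nat \<Rightarrow> (int^'n \<Rightarrow> complex) \<Rightarrow> int^'n \<Rightarrow> complex" where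
  "grid_coeff L f m = avg L (\<lambda>l. f l * cnj (character m (grid_point L l)))"

lemma weight_0 [simp]: "weight 0 = 0"
  by (simp add: weight_def)

lemma weight_nonneg [simp]: "0 \<le> weight m"
  by (simp add: weight_def)

lemma weight_square: "(weight (m :: int^'n))\<^sup>2 = norm (real_vec m) ^ CARD('n)"
  by (cases "m = 0") (simp_all add: weight_def power2_eq_square powr_realpow flip: powr_add)

lemma synth_add: "synth (\<lambda>j m. F j m + H j m) m = synth F m + synth H m"
  by (simp add: synth_def distrib_left sum.distrib)

lemma synth_cmult: "synth (\<lambda>j m. c m * F j m) m = c m * synth F m"
  by (simp add: synth_def sum_distrib_left mult_ac)

lemma grid_coeff_add: "grid_coeff L (\<lambda>l. f l + g l) m = grid_coeff L f m + grid_coeff L g m"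
  by (simp add: grid_coeff_def distrib_right avg_add)

lemma grid_coeff_cmult: "grid_coeff L (\<lambda>l. c * f l) m = c * grid_coeff L f m"
  by (simp add: grid_coeff_def mult.assoc avg_cmult)

text \<open>Tychonoff's theorem. Grid functions are represented as functions on all of Z^n, so the
  minimisation runs over an infinite product whose factors off the grid are singletons.\<close>

lemma compact_pointwise:
  fixes S :: "'a \<Rightarrow> 'b::topological_space set"
  assumes "\<And>i. compact (S i)"
  shows "compact {f. \<forall>i. f i \<in> S i}"
proof -
  have "compactin (product_topology (\<lambda>i. euclidean) UNIV) (PiE UNIV S)"
    using assms by (simp add: compactin_PiE)
  moreover have "PiE UNIV S = {f. \<forall>i. f i \<in> S i}" by (auto simp: PiE_def)
  ultimately show ?thesis by (simp add: euclidean_product_topology)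
qed

lemma deriv_norm_square_line:
  "((\<lambda>t::real. (norm (z + of_real t * w))\<^sup>2) has_real_derivative 2 * Re (z * cnj w)) (at 0)"
proof -
  have "(norm (z + of_real t * w))\<^sup>2 = (norm z)\<^sup>2 + t * (2 * Re (z * cnj w)) + t\<^sup>2 * (norm w)\<^sup>2" for t
    unfolding cmod_power2 by (simp add: power2_eq_square algebra_simps)
  moreover have "((\<lambda>t::real. (norm z)\<^sup>2 + t * (2 * Re (z * cnj w)) + t\<^sup>2 * (norm w)\<^sup>2)
      has_real_derivative 2 * Re (z * cnj w)) (at 0)"
    by (auto intro!: derivative_eq_intros)
  ultimately show ?thesis by simp
qed

text \<open>As the p-th power of the squared norm the term is visibly differentiable at z = 0.
  Dividing by p cancels the factor from the chain rule, so no p multiplies the Euler-Lagrange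
  equation.\<close>

lemma deriv_norm_power_line:
  assumes "p > 0"
  shows "((\<lambda>t::real. (A * norm (z + of_real t * w)) ^ (2 * p) / of_nat p) has_real_derivative
    2 * Re (of_real (A ^ (2 * p) * norm z ^ (2 * (p - 1))) * z * cnj w)) (at 0)"
proof -
  have eq: "(A * norm (z + of_real t * w)) ^ (2 * p) / of_nat p
      = A ^ (2 * p) / of_nat p * ((norm (z + of_real t * w))\<^sup>2) ^ p" for t
    by (simp add: power_mult_distrib power_mult)
  have "((\<lambda>t::real. A ^ (2 * p) / of_nat p * ((norm (z + of_real t * w))\<^sup>2) ^ p) has_real_derivative
      A ^ (2 * p) / of_nat p * (of_nat p * (2 * Re (z * cnj w) * ((norm (z + of_real 0 * w))\<^sup>2) ^ (p - Suc 0)))) (at 0)"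
    by (intro DERIV_cmult DERIV_power deriv_norm_square_line)
  moreover have "A ^ (2 * p) / of_nat p * (of_nat p * (2 * Re (z * cnj w) * ((norm (z + of_real 0 * w))\<^sup>2) ^ (p - Suc 0)))
      = 2 * Re (of_real (A ^ (2 * p) * norm z ^ (2 * (p - 1))) * z * cnj w)"
  proof -
    have "Re (of_real c * z * cnj w) = c * Re (z * cnj w)" for c by (simp add: algebra_simps)
    then show ?thesis using assms by (simp only: power_mult) simp
  qed
  ultimately show ?thesis unfolding eq by simp
qed

lemma tri_outside_box:
  assumes "N > 0" "m \<notin> box_of {-int N<..<int N}"
  shows "tri N m = 0"
proof -
  obtain i where "m $ i \<notin> {-int N<..<int N}" using assms unfolding box_of_def by blast
  then have "int N \<le> \<bar>m $ i\<bar>" by auto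
  then show ?thesis using assms by (intro tri_eq_0)
qed

text \<open>Discrete convolution with the Fejer kernel: orthogonality on the grid keeps only the
  coefficient at -k, provided that all sums m + k stay below \<open>L\<close>. The case k = 0 gives
  total mass 1, the case of a unit vector the second moment.\<close>

lemma avg_fejer_character:
  fixes x :: "real^'n"
  assumes q: "q > 0" and k: "\<And>i. \<bar>k $ i\<bar> + int q \<le> int L"
  shows "avg L (\<lambda>l. of_real (fejer q (x - grid_point L l)) * character k (x - grid_point L l)) = of_real (tri q k)"
proof -
  have "avg L (\<lambda>l. of_real (fejer q (x - grid_point L l)) * character k (x - grid_point L l))
     = (\<Sum>m\<in>box_of {-int q<..<int q}. avg L (\<lambda>l. of_real (tri q m) * character (m + k) (x - grid_point L l)))"
    unfolding fejer_eq[OF q] sum_distrib_right character_add mult.assoc by (rule avg_sum)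
  also have "\<dots> = (\<Sum>m\<in>(box_of {-int q<..<int q} :: (int^'n) set). if m = - k then of_real (tri q k) else 0)"
  proof (rule sum.cong[OF refl])
    fix m :: "int^'n" assume m: "m \<in> box_of {-int q<..<int q}"
    have "\<bar>(- (m + k)) $ i\<bar> < int L" for i
    proof -
      have "- int q < m $ i" "m $ i < int q" using m by (auto simp: box_of_def)
      then show ?thesis using k[of i] by simp
    qed
    from avg_character[OF this] have "avg L (\<lambda>l. cnj (character (m + k) (grid_point L l))) = (if m = - k then 1 else 0)"
      by (simp add: character_uminus add_eq_0_iff2 del: minus_add_distrib)
    then show "avg L (\<lambda>l. of_real (tri q m) * character (m + k) (x - grid_point L l)) = (if m = - k then of_real (tri q k) else 0)"
      unfolding character_arg_diff avg_cmult by (auto simp: tri_uminus)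
  qed
  also have "\<dots> = (if - k \<in> box_of {-int q<..<int q} then of_real (tri q k) else 0)"
    by (simp add: sum.delta)
  also have "\<dots> = of_real (tri q k)"
    using tri_outside_box[OF q, of "- k"] by (auto simp: tri_uminus)
  finally show ?thesis .
qed

lemma avg_fejer_grid:
  fixes x :: "real^'n"
  assumes q: "q > 0" "q \<le> L"
  shows "avg L (\<lambda>l. fejer q (x - grid_point L l)) = 1"
proof -
  have "complex_of_real (avg L (\<lambda>l. fejer q (x - grid_point L l))) = 1"
    using avg_fejer_character[of q 0 L x] q by (simp add: avg_of_real)
  then show ?thesis using of_real_eq_1_iff by blast
qed

text \<open>\<open>G\<close> is the target. The power penalty pushes the minimiser below a size of
  order 1 / A, in the sense of a high power mean, and \<open>lam\<close> keeps its Sobolev norm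
  below 1 / sqrt lam.\<close>

locale penalised =
  fixes G :: "int^'n \<Rightarrow> complex" and K p :: nat and lam A :: real
  assumes p: "p > 0" and lam: "lam > 0" and A: "A > 0" and G0: "G 0 = 0"
    and G1: "(\<Sum>m\<in>box_of {-(2 ^ K)<..<2 ^ K}. (norm (G m))\<^sup>2) \<le> 1"
begin

text \<open>Two frequencies in \<open>Freqs\<close> differ by less than this in each coordinate, so
  their characters are orthonormal on the grid.\<close>

abbreviation "L \<equiv> 2 * 2 ^ K :: nat"
abbreviation "Freqs \<equiv> box_of {-(2 ^ K)<..<2 ^ K} :: (int^'n) set"

definition resid :: "('n option \<Rightarrow> int^'n \<Rightarrow> complex) \<Rightarrow> int^'n \<Rightarrow> complex" where
  "resid f m = G m - synth (\<lambda>j. grid_coeff L (f j)) m"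

definition energy :: "('n option \<Rightarrow> int^'n \<Rightarrow> complex) \<Rightarrow> real" where
  "energy f = (\<Sum>m\<in>Freqs. (norm (resid f m))\<^sup>2)
     + lam * (\<Sum>m\<in>Freqs. (weight m)\<^sup>2 * (\<Sum>j\<in>UNIV. (norm (grid_coeff L (f j) m))\<^sup>2))
     + avg L (\<lambda>l. \<Sum>j\<in>UNIV. (A * norm (f j l)) ^ (2 * p) / of_nat p)"

lemma energy_parts_nonneg:
  "0 \<le> (\<Sum>m\<in>Freqs. (norm (resid f m))\<^sup>2)"
  "0 \<le> lam * (\<Sum>m\<in>Freqs. (weight m)\<^sup>2 * (\<Sum>j\<in>UNIV. (norm (grid_coeff L (f j) m))\<^sup>2))"
  "0 \<le> avg L (\<lambda>l. \<Sum>j\<in>UNIV. (A * norm (f j l)) ^ (2 * p) / of_nat p)"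
  using lam A by (auto intro!: sum_nonneg mult_nonneg_nonneg avg_nonneg)

lemma energy_cong:
  assumes "\<And>j l. l \<in> grid L \<Longrightarrow> f j l = h j l"
  shows "energy f = energy h"
proof -
  have "grid_coeff L (f j) = grid_coeff L (h j)" for j
    by (rule ext) (simp add: grid_coeff_def avg_def assms)
  then show ?thesis by (simp add: energy_def resid_def avg_def assms)
qed

lemma energy_zero: "energy (\<lambda>j l. 0) \<le> 1"
  using G1 p by (simp add: energy_def resid_def grid_coeff_def avg_def synth_def power_0_left)

lemma continuous_on_energy: "continuous_on S energy"
proof -
  have coord: "continuous_on S (\<lambda>f::'n option \<Rightarrow> int^'n \<Rightarrow> complex. f j l)" for j l
    by (rule continuous_on_product_then_coordinatewise[OF continuous_on_product_then_coordinatewise[OF continuous_on_id]])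
  show ?thesis
    unfolding energy_def resid_def synth_def grid_coeff_def avg_def
    by (intro continuous_on_const coord continuous_on_add continuous_on_diff continuous_on_sum continuous_on_divide
        continuous_on_mult continuous_on_power continuous_on_norm) (simp_all add: p)
qed

text \<open>The zero function has energy at most 1, whereas one grid value above B makes the penalty
  alone at least 1. So a minimum over the compact set of grid functions bounded by B is global;
  values off the grid do not enter the energy and may be set to 0.\<close>

lemma minimiser_exists: "\<exists>f. \<forall>h. energy f \<le> energy h"
proof -
  \<comment> \<open>A B exceeds p times the number of grid points. Since s \<le> s^(2 p) for s \<ge>
    1, this outweighs both the division by p and the averaging over the grid.\<close>
  define B where "B = (real p * (2 + 1) * of_nat (L ^ CARD('n)) + 1) / A"
  have B: "B > 0" unfolding B_def using A by (intro divide_pos_pos add_nonneg_pos) auto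
  define D where "D = {f :: 'n option \<Rightarrow> int^'n \<Rightarrow> complex. \<forall>j. f j \<in> {g. \<forall>l. g l \<in> (if l \<in> grid L then cball 0 B else {0})}}"
  have "compact D" unfolding D_def by (intro compact_pointwise) auto
  moreover have D0: "(\<lambda>j l. 0) \<in> D" using B by (auto simp: D_def)
  ultimately obtain f where f: "f \<in> D" "\<And>h. h \<in> D \<Longrightarrow> energy f \<le> energy h"
    using continuous_attains_inf[OF _ _ continuous_on_energy, of D] by (metis empty_iff)
  have "energy f \<le> energy h" for h
  proof (cases "\<exists>j. \<exists>l\<in>grid L. norm (h j l) > B")
    case False
    define h' where "h' j l = (if l \<in> grid L then h j l else 0)" for j l
    have "h' \<in> D" using False B by (auto simp: D_def h'_def not_less)
    then have "energy f \<le> energy h'" by (rule f)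
    also have "\<dots> = energy h" by (rule energy_cong) (simp add: h'_def)
    finally show ?thesis .
  next
    case True
    then obtain j l where jl: "l \<in> grid L" "norm (h j l) > B" by blast
    have "real p * of_nat (L ^ CARD('n)) + 1 \<le> A * B" unfolding B_def using A by simp
    also have "\<dots> \<le> A * norm (h j l)" using jl A by simp
    finally have b: "real p * of_nat (L ^ CARD('n)) + 1 \<le> A * norm (h j l)" .
    have b1: "1 \<le> A * norm (h j l)" by (rule order.trans[OF _ b]) simp
    have "real p * of_nat (L ^ CARD('n)) \<le> A * norm (h j l)" using b by linarith
    also have "\<dots> \<le> (A * norm (h j l)) ^ (2 * p)" using b1 p by (intro self_le_power) auto
    finally have "of_nat (L ^ CARD('n)) \<le> (A * norm (h j l)) ^ (2 * p) / of_nat p"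
      using p by (simp add: field_simps)
    also have "\<dots> \<le> (\<Sum>j\<in>UNIV. (A * norm (h j l)) ^ (2 * p) / of_nat p)"
      by (rule member_le_sum[of j UNIV "\<lambda>j. (A * norm (h j l)) ^ (2 * p) / of_nat p"]) (use A in auto)
    also have "\<dots> \<le> (\<Sum>l\<in>grid L. \<Sum>j\<in>UNIV. (A * norm (h j l)) ^ (2 * p) / of_nat p)"
      by (rule member_le_sum[of l _ "\<lambda>l. \<Sum>j\<in>UNIV. (A * norm (h j l)) ^ (2 * p) / of_nat p"])
         (use A jl in \<open>auto intro!: sum_nonneg\<close>)
    finally have "1 \<le> avg L (\<lambda>l. \<Sum>j\<in>UNIV. (A * norm (h j l)) ^ (2 * p) / of_nat p)"
      by (simp add: avg_def field_simps)
    then have "1 \<le> energy h" using energy_parts_nonneg[of h] by (simp add: energy_def)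
    moreover have "energy f \<le> 1" using f(2)[OF D0] energy_zero by linarith
    ultimately show ?thesis by linarith
  qed
  then show ?thesis by blast
qed

section \<open>First-order conditions at the minimiser\<close>

definition opt :: "'n option \<Rightarrow> int^'n \<Rightarrow> complex" where
  "opt = (SOME f. \<forall>h. energy f \<le> energy h)"

lemma energy_opt: "energy opt \<le> energy h"
  using someI_ex[OF minimiser_exists] unfolding opt_def by blast

text \<open>Half the gradient, at \<open>opt\<close>, of the integrand of the power penalty.\<close>

definition dual :: "'n option \<Rightarrow> int^'n \<Rightarrow> complex" where
  "dual j l = of_real (A ^ (2 * p) * norm (opt j l) ^ (2 * (p - 1))) * opt j l"

text \<open>The energy of \<open>opt\<close> + t phi is minimal at t = 0. Only real t occur, which
  is why the equation is one of real parts; complex information comes from varying phi.\<close>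

lemma euler_lagrange:
  fixes \<phi> :: "'n option \<Rightarrow> int^'n \<Rightarrow> complex"
  shows "(\<Sum>m\<in>Freqs. Re (resid opt m * cnj (synth (\<lambda>j. grid_coeff L (\<phi> j)) m))) =
     lam * (\<Sum>m\<in>Freqs. (weight m)\<^sup>2 * (\<Sum>j\<in>UNIV. Re (grid_coeff L (opt j) m * cnj (grid_coeff L (\<phi> j) m))))
     + avg L (\<lambda>l. \<Sum>j\<in>UNIV. Re (dual j l * cnj (\<phi> j l)))"
proof -
  let ?T = "synth (\<lambda>j. grid_coeff L (\<phi> j))"
  define E where "E t = energy (\<lambda>j l. opt j l + of_real t * \<phi> j l)" for t :: real
  have coeff: "grid_coeff L (\<lambda>l. opt j l + of_real t * \<phi> j l) = (\<lambda>m. grid_coeff L (opt j) m + of_real t * grid_coeff L (\<phi> j) m)" for j t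
    by (simp add: fun_eq_iff grid_coeff_add grid_coeff_cmult)
  have res: "resid (\<lambda>j l. opt j l + of_real t * \<phi> j l) m = resid opt m + of_real t * (- ?T m)" for t m
    using synth_add[of "\<lambda>j. grid_coeff L (opt j)" "\<lambda>j m. of_real t * grid_coeff L (\<phi> j) m" m]
      synth_cmult[of "\<lambda>_. of_real t" "\<lambda>j. grid_coeff L (\<phi> j)" m]
    by (simp add: resid_def coeff)
  have Eeq: "E t = (\<Sum>m\<in>Freqs. (norm (resid opt m + of_real t * (- ?T m)))\<^sup>2)
     + lam * (\<Sum>m\<in>Freqs. (weight m)\<^sup>2 * (\<Sum>j\<in>UNIV. (norm (grid_coeff L (opt j) m + of_real t * grid_coeff L (\<phi> j) m))\<^sup>2))
     + (\<Sum>l\<in>grid L. \<Sum>j\<in>UNIV. (A * norm (opt j l + of_real t * \<phi> j l)) ^ (2 * p) / of_nat p) / of_nat (L ^ CARD('n))" for t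
    unfolding E_def energy_def res coeff avg_def ..
  let ?D = "(\<Sum>m\<in>Freqs. 2 * Re (resid opt m * cnj (- ?T m)))
     + lam * (\<Sum>m\<in>Freqs. (weight m)\<^sup>2 * (\<Sum>j\<in>UNIV. 2 * Re (grid_coeff L (opt j) m * cnj (grid_coeff L (\<phi> j) m))))
     + (\<Sum>l\<in>grid L. \<Sum>j\<in>UNIV. 2 * Re (of_real (A ^ (2 * p) * norm (opt j l) ^ (2 * (p - 1))) * opt j l * cnj (\<phi> j l))) / of_nat (L ^ CARD('n))"
  have "(E has_real_derivative ?D) (at 0)"
    unfolding Eeq[abs_def]
    by (intro DERIV_add DERIV_sum DERIV_cmult DERIV_cdivide deriv_norm_square_line deriv_norm_power_line p)
  moreover have "E 0 \<le> E t" for t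
    using energy_opt by (simp add: E_def)
  ultimately have "?D = 0" by (intro DERIV_local_min[of E ?D 0 1]) auto
  moreover have "(\<Sum>m\<in>Freqs. 2 * Re (resid opt m * cnj (- ?T m))) = - 2 * (\<Sum>m\<in>Freqs. Re (resid opt m * cnj (?T m)))"
    unfolding sum_distrib_left by (intro sum.cong refl) simp
  moreover have "(\<Sum>m\<in>Freqs. (weight m)\<^sup>2 * (\<Sum>j\<in>UNIV. 2 * Re (grid_coeff L (opt j) m * cnj (grid_coeff L (\<phi> j) m))))
     = 2 * (\<Sum>m\<in>Freqs. (weight m)\<^sup>2 * (\<Sum>j\<in>UNIV. Re (grid_coeff L (opt j) m * cnj (grid_coeff L (\<phi> j) m))))"
    by (simp only: sum_distrib_left mult.left_commute[of _ 2])
  moreover have "(\<Sum>l\<in>grid L. \<Sum>j\<in>UNIV. 2 * Re (of_real (A ^ (2 * p) * norm (opt j l) ^ (2 * (p - 1))) * opt j l * cnj (\<phi> j l)))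
     = 2 * (\<Sum>l\<in>grid L. \<Sum>j\<in>UNIV. Re (dual j l * cnj (\<phi> j l)))"
    unfolding sum_distrib_left dual_def ..
  ultimately have "- 2 * (\<Sum>m\<in>Freqs. Re (resid opt m * cnj (?T m))) +
     lam * (2 * (\<Sum>m\<in>Freqs. (weight m)\<^sup>2 * (\<Sum>j\<in>UNIV. Re (grid_coeff L (opt j) m * cnj (grid_coeff L (\<phi> j) m)))))
     + 2 * avg L (\<lambda>l. \<Sum>j\<in>UNIV. Re (dual j l * cnj (\<phi> j l))) = 0"
    unfolding avg_def by (simp only: times_divide_eq_right)
  then show ?thesis by linarith
qed

lemma opt_bounds:
  "(\<Sum>m\<in>Freqs. (norm (resid opt m))\<^sup>2) \<le> 1"
  "lam * (\<Sum>m\<in>Freqs. (weight m)\<^sup>2 * (\<Sum>j\<in>UNIV. (norm (grid_coeff L (opt j) m))\<^sup>2)) \<le> 1"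
  using energy_opt[of "\<lambda>j l. 0"] energy_zero energy_parts_nonneg[of opt] unfolding energy_def by linarith+

text \<open>
  Testing the Euler-Lagrange equation with the minimiser itself avoids the factor \<open>p\<close> that
  the bound \<open>energy opt \<le> 1\<close> would cost.
\<close>

lemma avg_opt_power: "avg L (\<lambda>l. \<Sum>j\<in>UNIV. (A * norm (opt j l)) ^ (2 * p)) \<le> 1"
proof -
  have "avg L (\<lambda>l. \<Sum>j\<in>UNIV. (A * norm (opt j l)) ^ (2 * p)) = avg L (\<lambda>l. \<Sum>j\<in>UNIV. Re (dual j l * cnj (opt j l)))"
  proof -
    have "(A * norm z) ^ (2 * p) = Re (of_real (A ^ (2 * p) * norm z ^ (2 * (p - 1))) * z * cnj z)" for z
    proof -
      have "2 * p = 2 * (p - 1) + 2" using p by simp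
      then have "(A * norm z) ^ (2 * p) = A ^ (2 * p) * (norm z ^ (2 * (p - 1)) * (norm z)\<^sup>2)"
        by (metis power_add power_mult_distrib)
      also have "\<dots> = Re (of_real (A ^ (2 * p) * norm z ^ (2 * (p - 1))) * (z * cnj z))"
        unfolding complex_norm_square[symmetric] of_real_mult[symmetric] by simp
      finally show ?thesis by (simp only: mult.assoc)
    qed
    then show ?thesis unfolding dual_def by simp
  qed
  also have "\<dots> \<le> (\<Sum>m\<in>Freqs. Re (resid opt m * cnj (synth (\<lambda>j. grid_coeff L (opt j)) m)))"
  proof -
    have "0 \<le> lam * (\<Sum>m\<in>Freqs. (weight m)\<^sup>2 * (\<Sum>j\<in>UNIV. Re (grid_coeff L (opt j) m * cnj (grid_coeff L (opt j) m))))"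
      using lam by (intro mult_nonneg_nonneg sum_nonneg) auto
    then show ?thesis using euler_lagrange[of opt] by linarith
  qed
  also have "\<dots> \<le> (\<Sum>m\<in>Freqs. (norm (G m))\<^sup>2)"
  proof (rule sum_mono)
    fix m
    \<comment> \<open>Completing the square. Here u is the residual and v = \<open>G\<close>, so
      that v - u is the synthesised part.\<close>
    have "Re (u * cnj (v - u)) \<le> (norm v)\<^sup>2" for u v
    proof -
      have "0 \<le> (Re u - Re v / 2)\<^sup>2 + (Im u - Im v / 2)\<^sup>2 + 3 / 4 * ((Re v)\<^sup>2 + (Im v)\<^sup>2)" by simp
      also have "\<dots> = (norm v)\<^sup>2 - Re (u * cnj (v - u))"
        unfolding cmod_power2 by (simp add: power2_eq_square algebra_simps)
      finally show ?thesis by simp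
    qed
    from this[of "resid opt m" "G m"]
    show "Re (resid opt m * cnj (synth (\<lambda>j. grid_coeff L (opt j)) m)) \<le> (norm (G m))\<^sup>2"
      by (simp add: resid_def)
  qed
  also have "\<dots> \<le> 1" by (rule G1)
  finally show ?thesis .
qed

lemma avg_opt_power_single: "avg L (\<lambda>l. (A * norm (opt j l)) ^ (2 * p)) \<le> 1"
proof -
  have "avg L (\<lambda>l. (A * norm (opt j l)) ^ (2 * p)) \<le> avg L (\<lambda>l. \<Sum>j\<in>UNIV. (A * norm (opt j l)) ^ (2 * p))"
    by (intro avg_mono member_le_sum[where f = "\<lambda>j. (A * norm (opt j _)) ^ (2 * p)"]) (use A in auto)
  then show ?thesis using avg_opt_power by linarith
qed

text \<open>With s = A |opt|, the modulus of \<open>dual\<close> is A s^(2p-1), hence at most A (1 +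
  s^(2p)), and the power has average at most 1. The free factor A makes the L^1 norm small.\<close>

lemma avg_dual: "avg L (\<lambda>l. norm (dual j l)) \<le> 2 * A"
proof -
  have "norm (dual j l) \<le> A * (1 + (A * norm (opt j l)) ^ (2 * p))" for l
  proof -
    define s where "s = A * norm (opt j l)"
    have s: "s \<ge> 0" using A by (simp add: s_def)
    have p': "2 * p = Suc (2 * (p - 1) + 1)" using p by simp
    have "norm (dual j l) = A ^ (2 * p) * norm (opt j l) ^ (2 * (p - 1) + 1)"
      using A by (simp add: dual_def norm_mult norm_power)
    also have "\<dots> = A * s ^ (2 * (p - 1) + 1)"
      unfolding s_def power_mult_distrib by (subst p') simp
    also have "s ^ (2 * (p - 1) + 1) \<le> 1 + s ^ (2 * p)"
    proof (cases "s \<le> 1")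
      case True
      then have "s ^ (2 * (p - 1) + 1) \<le> 1" using s by (intro power_le_one) auto
      then show ?thesis using s by (simp add: add_increasing2)
    next
      case False
      then have "s ^ (2 * (p - 1) + 1) \<le> s ^ (2 * p)" using p by (intro power_increasing) auto
      then show ?thesis by simp
    qed
    finally show ?thesis using A by (simp add: s_def)
  qed
  then have "avg L (\<lambda>l. norm (dual j l)) \<le> avg L (\<lambda>l. A * (1 + (A * norm (opt j l)) ^ (2 * p)))"
    by (intro avg_mono)
  also have "\<dots> = A * (1 + avg L (\<lambda>l. (A * norm (opt j l)) ^ (2 * p)))"
  proof -
    have "avg L (\<lambda>l::int^'n. 1::real) = 1" by (rule avg_const) simp
    then show ?thesis by (simp only: avg_cmult avg_add)
  qed
  also have "\<dots> \<le> A * (1 + 1)" using A by (intro mult_left_mono add_mono avg_opt_power_single) auto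
  finally show ?thesis by simp
qed

lemma grid_coeff_character:
  assumes "k \<in> Freqs" "m \<in> Freqs"
  shows "grid_coeff L (\<lambda>l. character k (grid_point L l)) m = (if m = k then 1 else 0)"
proof -
  have "\<bar>(k - m) $ i\<bar> < int L" for i
  proof -
    have "-(2^K) < k $ i" "k $ i < 2^K" "-(2^K) < m $ i" "m $ i < 2^K" using assms by (auto simp: box_of_def)
    then show ?thesis by simp
  qed
  from avg_character[OF this] show ?thesis
    by (auto simp: grid_coeff_def character_diff)
qed

text \<open>Test the Euler-Lagrange equation with a multiple c of one character, in component j
  only. Solved for the term with the residual, it is the splitting into a part small in L^1 and a
  part small in the dual Sobolev norm.\<close>

lemma grid_coeff_dual:
  assumes k: "k \<in> Freqs"
  shows "grid_coeff L (dual j) k = of_real (weight k) * cnj (symbol j k) * resid opt k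
     - of_real (lam * (weight k)\<^sup>2) * grid_coeff L (opt j) k" (is "_ = ?R")
proof -
  have *: "Re (cnj c * (?R - grid_coeff L (dual j) k)) = 0" for c
  proof -
    define \<phi> where "\<phi> i l = (if i = j then c * character k (grid_point L l) else 0)" for i l
    have co: "grid_coeff L (\<phi> i) m = (if i = j \<and> m = k then c else 0)" if "m \<in> Freqs" for i m
    proof (cases "i = j")
      case True
      then have "\<phi> i = (\<lambda>l. c * character k (grid_point L l))" by (simp add: \<phi>_def fun_eq_iff)
      then show ?thesis using True by (simp add: grid_coeff_cmult grid_coeff_character[OF k that])
    next
      case False
      then show ?thesis by (simp add: \<phi>_def grid_coeff_def avg_def)
    qed
    have sy: "synth (\<lambda>j. grid_coeff L (\<phi> j)) m = (if m = k then of_real (weight k) * symbol j k * c else 0)" if "m \<in> Freqs" for m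
      by (auto simp: synth_def co[OF that] if_distrib[of "\<lambda>x. _ * x"] cong: if_cong)
    have "(\<Sum>m\<in>Freqs. Re (resid opt m * cnj (synth (\<lambda>j. grid_coeff L (\<phi> j)) m)))
        = (\<Sum>m\<in>Freqs. if m = k then Re (resid opt k * cnj (of_real (weight k) * symbol j k * c)) else 0)"
    proof (rule sum.cong[OF refl])
      fix m assume "m \<in> Freqs"
      from sy[OF this] show "Re (resid opt m * cnj (synth (\<lambda>j. grid_coeff L (\<phi> j)) m))
          = (if m = k then Re (resid opt k * cnj (of_real (weight k) * symbol j k * c)) else 0)"
        by (cases "m = k") (simp_all only: simp_thms if_True if_False complex_cnj_zero mult_zero_right zero_complex.sel)
    qed
    also have "\<dots> = Re (resid opt k * cnj (of_real (weight k) * symbol j k * c))"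
      by (simp only: sum.delta finite_box_of finite_greaterThanLessThan_int k if_True)
    finally have 1: "(\<Sum>m\<in>Freqs. Re (resid opt m * cnj (synth (\<lambda>j. grid_coeff L (\<phi> j)) m)))
        = Re (resid opt k * cnj (of_real (weight k) * symbol j k * c))" .
    have "(\<Sum>m\<in>Freqs. (weight m)\<^sup>2 * (\<Sum>i\<in>UNIV. Re (grid_coeff L (opt i) m * cnj (grid_coeff L (\<phi> i) m))))
       = (\<Sum>m\<in>Freqs. if m = k then (weight k)\<^sup>2 * Re (grid_coeff L (opt j) k * cnj c) else 0)"
    proof (rule sum.cong[OF refl])
      fix m assume m: "m \<in> Freqs"
      have "(\<Sum>i\<in>UNIV. Re (grid_coeff L (opt i) m * cnj (grid_coeff L (\<phi> i) m)))
         = (\<Sum>i\<in>UNIV. if i = j then (if m = k then Re (grid_coeff L (opt j) k * cnj c) else 0) else 0)"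
        by (rule sum.cong) (auto simp: co[OF m])
      then show "(weight m)\<^sup>2 * (\<Sum>i\<in>UNIV. Re (grid_coeff L (opt i) m * cnj (grid_coeff L (\<phi> i) m)))
        = (if m = k then (weight k)\<^sup>2 * Re (grid_coeff L (opt j) k * cnj c) else 0)"
        by (simp add: sum.delta)
    qed
    also have "\<dots> = (weight k)\<^sup>2 * Re (grid_coeff L (opt j) k * cnj c)"
      using k by (simp add: sum.delta)
    finally have 2: "(\<Sum>m\<in>Freqs. (weight m)\<^sup>2 * (\<Sum>i\<in>UNIV. Re (grid_coeff L (opt i) m * cnj (grid_coeff L (\<phi> i) m))))
        = (weight k)\<^sup>2 * Re (grid_coeff L (opt j) k * cnj c)" .
    have "(\<Sum>i\<in>UNIV. Re (dual i l * cnj (\<phi> i l))) = Re (cnj c * (dual j l * cnj (character k (grid_point L l))))" for l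
    proof -
      have "(\<Sum>i\<in>UNIV. Re (dual i l * cnj (\<phi> i l)))
        = (\<Sum>i\<in>UNIV. if i = j then Re (dual j l * cnj (c * character k (grid_point L l))) else 0)"
        by (rule sum.cong) (auto simp only: \<phi>_def complex_cnj_zero mult_zero_right zero_complex.sel split: if_splits)
      then show ?thesis by (simp only: sum.delta finite UNIV_I if_True complex_cnj_mult mult_ac)
    qed
    then have 3: "avg L (\<lambda>l. \<Sum>i\<in>UNIV. Re (dual i l * cnj (\<phi> i l))) = Re (cnj c * grid_coeff L (dual j) k)"
      by (simp only: Re_avg[symmetric] avg_cmult grid_coeff_def)
    have "Re (resid opt k * cnj (of_real (weight k) * symbol j k * c)) =
      lam * ((weight k)\<^sup>2 * Re (grid_coeff L (opt j) k * cnj c)) + Re (cnj c * grid_coeff L (dual j) k)"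
      using euler_lagrange[of \<phi>] unfolding 1 2 3 .
    moreover have "lam * ((weight k)\<^sup>2 * Re (grid_coeff L (opt j) k * cnj c)) = Re (cnj c * (of_real (lam * (weight k)\<^sup>2) * grid_coeff L (opt j) k))"
    proof -
      have "Re (x * (of_real r * y)) = r * Re (y * x)" for x y and r :: real by (simp add: algebra_simps)
      then show ?thesis by (simp only: mult.assoc)
    qed
    moreover have "Re (resid opt k * cnj (of_real (weight k) * symbol j k * c)) = Re (cnj c * (of_real (weight k) * cnj (symbol j k) * resid opt k))"
      by (simp only: complex_cnj_mult complex_cnj_complex_of_real mult_ac)
    ultimately show ?thesis by (simp only: right_diff_distrib minus_complex.sel)
  qed
  \<comment> \<open>The choices c = 1 and c = i yield the real and the imaginary part.\<close>
  from *[of 1] *[of \<i>] have "?R - grid_coeff L (dual j) k = 0" by (simp add: complex_eq_iff)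
  then show ?thesis by simp
qed

end

text \<open>Inserting the definition of the coefficients turns the form into a double average of
  a(l) times the conjugate of b(l') against the kernel at the difference of the two grid points; the
  kernel is then replaced by its sup norm.\<close>

lemma grid_form_bound:
  fixes a b :: "int^'n \<Rightarrow> complex" and S :: "(int^'n) set"
  assumes C: "\<And>x. norm (\<Sum>m\<in>S. \<kappa> m * character m x) \<le> C"
  shows "norm (\<Sum>m\<in>S. \<kappa> m * grid_coeff L a m * cnj (grid_coeff L b m)) \<le> C * avg L (\<lambda>l. norm (a l)) * avg L (\<lambda>l. norm (b l))"
proof -
  let ?g = "grid_point L :: int^'n \<Rightarrow> real^'n"
  have cnj_avg: "cnj (avg L f) = avg L (\<lambda>l. cnj (f l))" for f :: "int^'n \<Rightarrow> complex"
    by (simp add: avg_def cnj_sum)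
  have "(\<Sum>m\<in>S. \<kappa> m * grid_coeff L a m * cnj (grid_coeff L b m))
     = (\<Sum>m\<in>S. avg L (\<lambda>l. avg L (\<lambda>l'. a l * cnj (b l') * (\<kappa> m * character m (?g l' - ?g l)))))"
  proof (rule sum.cong[OF refl])
    fix m
    have "avg L (\<lambda>l. avg L (\<lambda>l'. a l * cnj (b l') * (\<kappa> m * character m (?g l' - ?g l))))
      = avg L (\<lambda>l. avg L (\<lambda>l'. (\<kappa> m * (a l * cnj (character m (?g l)))) * (cnj (b l') * character m (?g l'))))"
      by (simp only: character_arg_diff mult_ac)
    also have "\<dots> = \<kappa> m * grid_coeff L a m * cnj (grid_coeff L b m)"
      unfolding grid_coeff_def by (simp only: avg_cmult avg_cmult_right cnj_avg complex_cnj_mult complex_cnj_cnj)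
    finally show "\<kappa> m * grid_coeff L a m * cnj (grid_coeff L b m)
      = avg L (\<lambda>l. avg L (\<lambda>l'. a l * cnj (b l') * (\<kappa> m * character m (?g l' - ?g l))))" ..
  qed
  also have "\<dots> = avg L (\<lambda>l. avg L (\<lambda>l'. a l * cnj (b l') * (\<Sum>m\<in>S. \<kappa> m * character m (?g l' - ?g l))))"
    by (simp only: avg_sum[symmetric] sum_distrib_left)
  also have "norm \<dots> \<le> avg L (\<lambda>l. avg L (\<lambda>l'. norm (a l) * norm (b l') * C))"
  proof (rule order.trans[OF norm_avg_le avg_mono])
    fix l :: "int^'n"
    show "norm (avg L (\<lambda>l'. a l * cnj (b l') * (\<Sum>m\<in>S. \<kappa> m * character m (?g l' - ?g l)))) \<le> avg L (\<lambda>l'. norm (a l) * norm (b l') * C)"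
      by (rule order.trans[OF norm_avg_le avg_mono]) (auto simp: norm_mult intro!: mult_left_mono C)
  qed
  also have "\<dots> = C * avg L (\<lambda>l. norm (a l)) * avg L (\<lambda>l. norm (b l))"
    by (simp only: avg_cmult avg_cmult_right mult_ac)
  finally show ?thesis .
qed

lemma norm_symbol_le: "norm (symbol j m) \<le> 1"
proof (cases j)
  case (Some i)
  have "\<bar>real_of_int (m $ i)\<bar> \<le> norm (real_vec m)"
    using component_le_norm_cart[of "real_vec m" i] by (simp add: real_vec_def)
  then show ?thesis using Some by (simp add: symbol_def norm_mult norm_divide divide_le_eq)
qed (simp add: symbol_def)

lemma mult_le_half_squares: "x * y \<le> (x\<^sup>2 + y\<^sup>2) / 2" for x y :: real
  using sum_squares_bound[of x y] by simp

lemma sum_mult_le_1: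
  fixes x y :: "'a \<Rightarrow> real"
  assumes "(\<Sum>m\<in>S. (x m)\<^sup>2) \<le> 1" "(\<Sum>m\<in>S. (y m)\<^sup>2) \<le> 1"
  shows "(\<Sum>m\<in>S. x m * y m) \<le> 1"
proof -
  have "(\<Sum>m\<in>S. x m * y m) \<le> (\<Sum>m\<in>S. ((x m)\<^sup>2 + (y m)\<^sup>2) / 2)"
    by (intro sum_mono mult_le_half_squares)
  also have "\<dots> = ((\<Sum>m\<in>S. (x m)\<^sup>2) + (\<Sum>m\<in>S. (y m)\<^sup>2)) / 2"
    by (simp add: sum.distrib flip: sum_divide_distrib)
  also have "\<dots> \<le> (1 + 1) / 2"
    by (intro divide_right_mono add_mono assms) auto
  finally show ?thesis by simp
qed

context penalised
begin

text \<open>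
  The form \<open>\<Sum>j m. test_coeff K j m * a0(m) * cnj (aj(m))\<close>, where \<open>a0\<close> and \<open>aj\<close> are the
  coefficients of the dual functions, is bounded by their \<open>L\<^sup>1\<close> norms because the kernels are
  bounded. Up to terms of size \<open>sqrt lam\<close> it is \<open>- \<i>\<close> times a nonnegative quadratic form in
  the residual, which controls every low frequency.
\<close>

lemma resid_low:
  assumes lam1: "lam \<le> 1" and q: "4 * q \<le> 2 ^ K"
  shows "1 / (8 * 8 ^ CARD('n) * real CARD('n)) * (\<Sum>m\<in>box_of {-int q<..<int q}. (norm (resid opt m))\<^sup>2)
    \<le> real CARD('n) * (192 * A\<^sup>2 + 18 * (2 * real CARD('n)) ^ CARD('n) * sqrt lam)" (is "?c * _ \<le> _")
proof -
  define u where "u = resid opt"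
  define a where "a j m = grid_coeff L (dual j) m" for j m
  \<comment> \<open>Normalised to have l^2 norm at most 1 over \<open>Freqs\<close>. The modulus of
    \<open>b\<close> is sqrt lam times weight times \<open>y\<close>, so each factor
    \<open>b\<close> gains sqrt lam.\<close>
  define y where "y j m = sqrt lam * weight m * norm (grid_coeff L (opt j) m)" for j m
  define b where "b j m = of_real (lam * (weight m)\<^sup>2) * grid_coeff L (opt j) m" for j m
  define w where "w m = of_real (weight m) * u m" for m
  define v where "v j m = of_real (weight m) * cnj (symbol j m) * u m" for j m
  define t where "t i m = of_real (test_coeff K i m) * w m * cnj (v (Some i) m)" for i m
  \<comment> \<open>Since a = v - b, the product of the two v's equals the product of the two a's
    plus these terms, each of which contains a factor b.\<close>
  define e where "e i m = of_real (test_coeff K i m) * (b None m * cnj (v (Some i) m) + w m * cnj (b (Some i) m) - b None m * cnj (b (Some i) m))" for i m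
  define C where "C = 6 * (2 * real CARD('n)) ^ CARD('n)"
  have C: "C \<ge> 0" by (simp add: C_def)
  have w_eq: "w m = v None m" for m by (simp add: w_def v_def symbol_def)
  have u2: "(\<Sum>m\<in>Freqs. (norm (u m))\<^sup>2) \<le> 1" using opt_bounds(1) by (simp add: u_def)
  have y2: "(\<Sum>m\<in>Freqs. (y j m)\<^sup>2) \<le> 1" for j
  proof -
    have "(\<Sum>m\<in>Freqs. (y j m)\<^sup>2) \<le> (\<Sum>m\<in>Freqs. \<Sum>j\<in>UNIV. (y j m)\<^sup>2)"
      by (intro sum_mono member_le_sum) auto
    also have "\<dots> = lam * (\<Sum>m\<in>Freqs. (weight m)\<^sup>2 * (\<Sum>j\<in>UNIV. (norm (grid_coeff L (opt j) m))\<^sup>2))"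
      using lam by (simp add: y_def power_mult_distrib sum_distrib_left mult.assoc)
    finally show ?thesis using opt_bounds(2) by linarith
  qed
  have y0: "y j m \<ge> 0" for j m using lam by (simp add: y_def)
  have a_eq: "a j m = v j m - b j m" if "m \<in> Freqs" for j m
    using grid_coeff_dual[OF that, of j] by (simp add: a_def v_def b_def u_def)
  have split: "t i m = of_real (test_coeff K i m) * a None m * cnj (a (Some i) m) + e i m" if "m \<in> Freqs" for i m
    by (simp add: t_def e_def a_eq[OF that] w_eq algebra_simps)
  \<comment> \<open>The kernel contributes 48 and each of the two dual functions 2 A.\<close>
  have form: "norm (\<Sum>m\<in>Freqs. of_real (test_coeff K i m) * a None m * cnj (a (Some i) m)) \<le> 192 * A\<^sup>2" for i
  proof -
    have "norm (\<Sum>m\<in>Freqs. of_real (test_coeff K i m) * a None m * cnj (a (Some i) m))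
      \<le> 48 * avg L (\<lambda>l. norm (dual None l)) * avg L (\<lambda>l. norm (dual (Some i) l))"
      unfolding a_def by (rule grid_form_bound) (rule test_kernel_bound)
    also have "\<dots> \<le> 48 * (2 * A) * (2 * A)"
      using A by (intro mult_mono avg_dual avg_nonneg) auto
    finally show ?thesis by (simp add: power2_eq_square)
  qed
  have e_bound: "norm (e i m) \<le> C * sqrt lam * (y None m * norm (u m) + norm (u m) * y (Some i) m + y None m * y (Some i) m)" for i m
  proof -
    let ?s = "sqrt lam"
    have ss: "?s * ?s = lam" using lam by simp
    have nb: "norm (b j m) = weight m * (?s * y j m)" for j
    proof -
      have "norm (b j m) = lam * (weight m * weight m) * norm (grid_coeff L (opt j) m)"
        using lam by (simp add: b_def norm_mult power2_eq_square)
      also have "\<dots> = (?s * ?s) * (weight m * weight m) * norm (grid_coeff L (opt j) m)" by (simp only: ss)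
      also have "\<dots> = weight m * (?s * y j m)" by (simp add: y_def mult_ac)
      finally show ?thesis .
    qed
    have nw: "norm (w m) = weight m * norm (u m)" by (simp add: w_def norm_mult)
    have nv: "norm (v j m) \<le> weight m * norm (u m)" for j
      using mult_right_mono[OF mult_left_mono[OF norm_symbol_le[of j m], of "weight m"], of "norm (u m)"]
      by (simp add: v_def norm_mult)
    have s1: "?s \<le> 1" using lam1 by simp
    have "norm (b None m * cnj (v (Some i) m) + w m * cnj (b (Some i) m) - b None m * cnj (b (Some i) m))
      \<le> norm (b None m) * norm (v (Some i) m) + norm (w m) * norm (b (Some i) m) + norm (b None m) * norm (b (Some i) m)"
      by (rule order.trans[OF norm_triangle_ineq4]) (auto simp: norm_mult intro!: add_mono order.trans[OF norm_triangle_ineq])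
    \<comment> \<open>In the product of two b's one sqrt lam is replaced by 1, so that all three
      terms carry sqrt lam exactly once.\<close>
    also have "\<dots> \<le> weight m * (?s * y None m) * (weight m * norm (u m)) + weight m * norm (u m) * (weight m * (?s * y (Some i) m))
       + weight m * (?s * y None m) * (weight m * (1 * y (Some i) m))"
      unfolding nb nw using lam y0 s1 by (intro add_mono mult_mono nv order.refl mult_nonneg_nonneg) auto
    also have "\<dots> = norm (real_vec m) ^ CARD('n) * (?s * (y None m * norm (u m) + norm (u m) * y (Some i) m + y None m * y (Some i) m))"
      unfolding weight_square[symmetric] by (simp add: power2_eq_square algebra_simps)
    finally have "norm (e i m) \<le> \<bar>test_coeff K i m\<bar> * (norm (real_vec m) ^ CARD('n) * (?s * (y None m * norm (u m) + norm (u m) * y (Some i) m + y None m * y (Some i) m)))"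
      unfolding e_def norm_mult by (simp add: mult_left_mono)
    also have "\<dots> = (\<bar>test_coeff K i m\<bar> * norm (real_vec m) ^ CARD('n)) * (?s * (y None m * norm (u m) + norm (u m) * y (Some i) m + y None m * y (Some i) m))"
      by (simp only: mult.assoc)
    also have "\<dots> \<le> C * (?s * (y None m * norm (u m) + norm (u m) * y (Some i) m + y None m * y (Some i) m))"
      unfolding C_def using lam y0 by (intro mult_right_mono test_coeff_upper mult_nonneg_nonneg add_nonneg_nonneg) auto
    finally show ?thesis by (simp only: mult.assoc)
  qed
  have e_sum: "norm (\<Sum>m\<in>Freqs. e i m) \<le> C * sqrt lam * 3" for i
  proof -
    have "norm (\<Sum>m\<in>Freqs. e i m) \<le> (\<Sum>m\<in>Freqs. C * sqrt lam * (y None m * norm (u m) + norm (u m) * y (Some i) m + y None m * y (Some i) m))"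
      by (rule order.trans[OF norm_sum sum_mono[OF e_bound]])
    also have "\<dots> = C * sqrt lam * ((\<Sum>m\<in>Freqs. y None m * norm (u m)) + (\<Sum>m\<in>Freqs. norm (u m) * y (Some i) m) + (\<Sum>m\<in>Freqs. y None m * y (Some i) m))"
      by (simp only: sum_distrib_left[symmetric] sum.distrib)
    also have "\<dots> \<le> C * sqrt lam * (1 + 1 + 1)"
      using C lam by (intro mult_left_mono add_mono sum_mult_le_1 u2 y2) auto
    finally show ?thesis by simp
  qed
  have t_sum: "norm (\<Sum>m\<in>Freqs. t i m) \<le> 192 * A\<^sup>2 + C * sqrt lam * 3" for i
  proof -
    have "(\<Sum>m\<in>Freqs. t i m) = (\<Sum>m\<in>Freqs. of_real (test_coeff K i m) * a None m * cnj (a (Some i) m)) + (\<Sum>m\<in>Freqs. e i m)"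
      unfolding sum.distrib[symmetric] by (rule sum.cong[OF refl split])
    then show ?thesis by (simp only:) (rule order.trans[OF norm_triangle_ineq add_mono[OF form e_sum]])
  qed
  \<comment> \<open>The conjugate of \<open>v (Some i) m\<close> brings in - i m_i / |m|, and
    \<open>test_coeff K i m\<close> has the sign of m_i. So the sum of \<open>t i m\<close> over i
    is - i times a nonnegative multiple of the squared residual, and taking norms loses
    nothing.\<close>
  define D where "D m = (\<Sum>i\<in>UNIV. test_coeff K i m * of_int (m $ i) / norm (real_vec m)) * norm (real_vec m) ^ CARD('n)" for m :: "int^'n"
  have D0: "D m \<ge> 0" for m
    unfolding D_def by (intro mult_nonneg_nonneg sum_nonneg divide_nonneg_nonneg test_coeff_sign) auto
  have t_eq: "(\<Sum>i\<in>UNIV. t i m) = - \<i> * of_real (D m * (norm (u m))\<^sup>2)" for m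
  proof -
    have "(\<Sum>i\<in>UNIV. t i m) = (\<Sum>i\<in>UNIV. - \<i> * (of_real (test_coeff K i m * of_int (m $ i) / norm (real_vec m)) * of_real ((weight m)\<^sup>2 * (norm (u m))\<^sup>2)))"
      unfolding of_real_mult[of "(weight m)\<^sup>2"] complex_norm_square
      by (rule sum.cong) (simp_all add: t_def w_def v_def symbol_def power2_eq_square mult_ac)
    also have "\<dots> = - \<i> * of_real ((\<Sum>i\<in>UNIV. test_coeff K i m * of_int (m $ i) / norm (real_vec m)) * ((weight m)\<^sup>2 * (norm (u m))\<^sup>2))"
      by (simp only: of_real_mult of_real_sum sum_distrib_left sum_distrib_right)
    finally show ?thesis by (simp only: D_def weight_square mult.assoc)
  qed
  have "(\<Sum>m\<in>Freqs. D m * (norm (u m))\<^sup>2) = norm (- \<i> * of_real (\<Sum>m\<in>Freqs. D m * (norm (u m))\<^sup>2))"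
    using D0 by (simp add: norm_mult sum_nonneg del: of_real_sum)
  also have "- \<i> * of_real (\<Sum>m\<in>Freqs. D m * (norm (u m))\<^sup>2) = (\<Sum>m\<in>Freqs. \<Sum>i\<in>UNIV. t i m)"
    unfolding t_eq of_real_sum sum_distrib_left ..
  also have "\<dots> = (\<Sum>i\<in>UNIV. \<Sum>m\<in>Freqs. t i m)" by (rule sum.swap)
  also have "norm \<dots> \<le> (\<Sum>i\<in>(UNIV::'n set). 192 * A\<^sup>2 + C * sqrt lam * 3)"
    by (rule order.trans[OF norm_sum sum_mono[OF t_sum]])
  finally have upper: "(\<Sum>m\<in>Freqs. D m * (norm (u m))\<^sup>2) \<le> real CARD('n) * (192 * A\<^sup>2 + 18 * (2 * real CARD('n)) ^ CARD('n) * sqrt lam)"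
    by (simp add: C_def mult_ac)
  \<comment> \<open>The lower bound for D needs 4 |m_i| < 2^K, so only the box of radius q is
    controlled; the remaining frequencies are dropped because D is nonnegative.\<close>
  have "?c * (\<Sum>m\<in>box_of {-int q<..<int q}. (norm (u m))\<^sup>2) \<le> (\<Sum>m\<in>box_of {-int q<..<int q}. D m * (norm (u m))\<^sup>2)"
    unfolding sum_distrib_left
  proof (rule sum_mono)
    fix m :: "int^'n" assume m: "m \<in> box_of {-int q<..<int q}"
    show "?c * (norm (u m))\<^sup>2 \<le> D m * (norm (u m))\<^sup>2"
    proof (cases "m = 0")
      case True
      then have "u m = 0" using G0 by (simp add: u_def resid_def synth_def)
      then show ?thesis by simp
    next
      case False
      have "4 * \<bar>m $ i\<bar> < 2 ^ K" for i
      proof -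
        have "4 * int q \<le> 2 ^ K" using q by (simp flip: of_nat_le_iff[where 'a = int])
        moreover have "\<bar>m $ i\<bar> < int q" using m by (auto simp: box_of_def abs_less_iff minus_less_iff)
        ultimately show ?thesis by linarith
      qed
      from test_coeff_lower[OF False this] show ?thesis
        unfolding D_def by (rule mult_right_mono) simp
    qed
  qed
  also have "\<dots> \<le> (\<Sum>m\<in>Freqs. D m * (norm (u m))\<^sup>2)"
  proof (rule sum_mono2)
    have "q \<le> 2 ^ K" using q by linarith
    then have iq: "int q \<le> 2 ^ K" by (metis of_nat_le_iff of_nat_power of_nat_numeral)
    have "{-int q<..<int q} \<subseteq> {-(2 ^ K)<..<2 ^ K}"
    proof
      fix x assume "x \<in> {-int q<..<int q}"
      then show "x \<in> {-(2 ^ K)<..<2 ^ K}"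
        using iq unfolding greaterThanLessThan_iff by linarith
    qed
    then show "box_of {-int q<..<int q} \<subseteq> Freqs" unfolding box_of_def by blast
  qed (use D0 in auto)
  finally show ?thesis using upper unfolding u_def by linarith
qed

section \<open>Fejer smoothing of the minimiser\<close>

definition smooth_coeff :: "nat \<Rightarrow> 'n option \<Rightarrow> int^'n \<Rightarrow> complex" where
  "smooth_coeff q j m = of_real (tri q m) * grid_coeff L (opt j) m"

text \<open>Smoothing multiplies the residual by a factor supported in low frequencies, where
  \<open>resid_low\<close> applies. The price is the part 1 - tri of \<open>G\<close>, small for a
  large degree q.\<close>

lemma resid_smooth_coeff:
  "G m - synth (smooth_coeff q) m = of_real (1 - tri q m) * G m + of_real (tri q m) * resid opt m"
proof -
  have "synth (smooth_coeff q) m = of_real (tri q m) * (G m - resid opt m)"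
    using synth_cmult[of "\<lambda>m. of_real (tri q m)" "\<lambda>j. grid_coeff L (opt j)" m]
    by (simp add: smooth_coeff_def[abs_def] resid_def)
  then show ?thesis by (simp add: algebra_simps)
qed

lemma smooth_coeff_weight:
  assumes "B \<subseteq> Freqs"
  shows "(\<Sum>m\<in>B. (weight m * norm (smooth_coeff q j m))\<^sup>2) \<le> 1 / lam"
proof -
  have "(\<Sum>m\<in>B. (weight m * norm (smooth_coeff q j m))\<^sup>2) \<le> (\<Sum>m\<in>Freqs. (weight m * norm (smooth_coeff q j m))\<^sup>2)"
    by (rule sum_mono2) (use assms in auto)
  also have "\<dots> \<le> (\<Sum>m\<in>Freqs. (weight m)\<^sup>2 * (\<Sum>j\<in>UNIV. (norm (grid_coeff L (opt j) m))\<^sup>2))"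
  proof (rule sum_mono)
    fix m :: "int^'n"
    have "norm (smooth_coeff q j m) \<le> norm (grid_coeff L (opt j) m)"
      by (simp add: smooth_coeff_def norm_mult mult_left_le_one_le)
    then have "(norm (smooth_coeff q j m))\<^sup>2 \<le> (norm (grid_coeff L (opt j) m))\<^sup>2" by (intro power_mono) auto
    also have "\<dots> \<le> (\<Sum>j\<in>UNIV. (norm (grid_coeff L (opt j) m))\<^sup>2)"
      by (rule member_le_sum) auto
    finally show "(weight m * norm (smooth_coeff q j m))\<^sup>2 \<le> (weight m)\<^sup>2 * (\<Sum>j\<in>UNIV. (norm (grid_coeff L (opt j) m))\<^sup>2)"
      by (simp add: power_mult_distrib mult_left_mono)
  qed
  also have "\<dots> \<le> 1 / lam" using opt_bounds(2) lam by (simp add: field_simps)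
  finally show ?thesis .
qed

lemma sum_smooth_coeff:
  fixes x :: "real^'n"
  assumes q: "q > 0"
  shows "(\<Sum>m\<in>box_of {-int q<..<int q}. smooth_coeff q j m * character m x) = avg L (\<lambda>l. opt j l * of_real (fejer q (x - grid_point L l)))"
proof -
  have "(\<Sum>m\<in>box_of {-int q<..<int q}. smooth_coeff q j m * character m x)
     = (\<Sum>m\<in>box_of {-int q<..<int q}. avg L (\<lambda>l. opt j l * (of_real (tri q m) * character m (x - grid_point L l))))"
    by (rule sum.cong) (simp_all add: smooth_coeff_def grid_coeff_def character_arg_diff mult_ac flip: avg_cmult avg_cmult_right)
  also have "\<dots> = avg L (\<lambda>l. opt j l * of_real (fejer q (x - grid_point L l)))"
    unfolding fejer_eq[OF q] sum_distrib_left by (rule avg_sum[symmetric])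
  finally show ?thesis .
qed

text \<open>Use s \<le> 2 + 2 (s/2)^(2p) for s = A |opt|. Averaged against the Fejer kernel, of mass
  1, the constant gives 2. In the second term the kernel is bounded by q^n, the mean of s^(2p) by 1,
  and q^n / 2^(2p) is at most 1/2, which gives 1 more.\<close>

lemma smooth_coeff_sup:
  fixes x :: "real^'n"
  assumes q: "q > 0" "q \<le> L" and p2: "2 * q ^ CARD('n) \<le> 2 ^ (2 * p)"
  shows "A * norm (\<Sum>m\<in>box_of {-int q<..<int q}. smooth_coeff q j m * character m x) \<le> 3"
proof -
  let ?F = "\<lambda>l. fejer q (x - grid_point L l)"
  have s_le: "s \<le> 2 + 2 * (s / 2) ^ (2 * p)" if "s \<ge> 0" for s :: real
  proof (cases "s \<le> 2")
    case True
    then show ?thesis using that by (simp add: add_increasing2)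
  next
    case False
    then have "s / 2 \<le> (s / 2) ^ (2 * p)" using p by (intro self_le_power) auto
    then show ?thesis by simp
  qed
  have pw: "A * norm (opt j l * of_real (?F l)) \<le> 2 * ?F l + 2 * (of_nat q ^ CARD('n) / 2 ^ (2 * p)) * (A * norm (opt j l)) ^ (2 * p)" for l
  proof -
    have "A * norm (opt j l * of_real (?F l)) = (A * norm (opt j l)) * ?F l"
      by (simp add: norm_mult fejer_nonneg)
    also have "\<dots> \<le> (2 + 2 * (A * norm (opt j l) / 2) ^ (2 * p)) * ?F l"
      using A by (intro mult_right_mono s_le fejer_nonneg) auto
    also have "\<dots> = 2 * ?F l + 2 * ((A * norm (opt j l)) ^ (2 * p) / 2 ^ (2 * p)) * ?F l"
      by (simp add: power_divide distrib_right)
    also have "\<dots> \<le> 2 * ?F l + 2 * ((A * norm (opt j l)) ^ (2 * p) / 2 ^ (2 * p)) * of_nat q ^ CARD('n)"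
      using A by (intro add_left_mono mult_left_mono fejer_le) auto
    finally show ?thesis by (simp add: mult_ac)
  qed
  have "A * norm (\<Sum>m\<in>box_of {-int q<..<int q}. smooth_coeff q j m * character m x) \<le> A * avg L (\<lambda>l. norm (opt j l * of_real (?F l)))"
    unfolding sum_smooth_coeff[OF q(1)] using A by (intro mult_left_mono norm_avg_le) auto
  also have "\<dots> = avg L (\<lambda>l. A * norm (opt j l * of_real (?F l)))" by (simp only: avg_cmult)
  also have "\<dots> \<le> avg L (\<lambda>l. 2 * ?F l + 2 * (of_nat q ^ CARD('n) / 2 ^ (2 * p)) * (A * norm (opt j l)) ^ (2 * p))"
    by (rule avg_mono[OF pw])
  also have "\<dots> = 2 + 2 * (of_nat q ^ CARD('n) / 2 ^ (2 * p)) * avg L (\<lambda>l. (A * norm (opt j l)) ^ (2 * p))"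
    unfolding avg_add avg_cmult avg_fejer_grid[OF q] by simp
  also have "\<dots> \<le> 2 + 2 * (1 / 2) * 1"
  proof (intro add_left_mono mult_mono avg_opt_power_single)
    have "real (2 * q ^ CARD('n)) \<le> real (2 ^ (2 * p))" using p2 by (simp only: of_nat_le_iff)
    then show "of_nat q ^ CARD('n) / 2 ^ (2 * p) \<le> (1 / 2 :: real)" by (simp add: divide_le_eq)
  qed (use A in \<open>auto intro!: avg_nonneg\<close>)
  finally show ?thesis by simp
qed

end

section \<open>Approximate solutions\<close>

lemma tri_tendsto_1: "(\<lambda>k. tri (2 ^ k) m) \<longlonglongrightarrow> 1"
proof -
  have "(\<lambda>k. tri1 (2 ^ k) z) \<longlonglongrightarrow> 1" for z
  proof -
    have "(\<lambda>k. \<bar>real_of_int z\<bar> * (1 / 2) ^ k) \<longlonglongrightarrow> \<bar>real_of_int z\<bar> * 0"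
      by (intro tendsto_mult tendsto_const LIMSEQ_power_zero) auto
    then have "(\<lambda>k. max 0 (1 - \<bar>real_of_int z\<bar> * (1 / 2) ^ k)) \<longlonglongrightarrow> max 0 (1 - \<bar>real_of_int z\<bar> * 0)"
      by (intro tendsto_max tendsto_diff tendsto_const)
    moreover have "\<bar>real_of_int z\<bar> * (1 / 2) ^ k = \<bar>real_of_int z\<bar> / real (2 ^ k)" for k
      by (simp add: power_one_over)
    ultimately show ?thesis unfolding tri1_def by simp
  qed
  then have "(\<lambda>k. \<Prod>i\<in>UNIV. tri1 (2 ^ k) (m $ i)) \<longlonglongrightarrow> (\<Prod>i\<in>(UNIV :: 'a set). 1)"
    by (intro tendsto_prod) auto
  then show ?thesis by (simp add: tri_def)
qed

lemma finite_sums_tail: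
  fixes h :: "'a \<Rightarrow> real"
  assumes h: "\<And>m. h m \<ge> 0" and bound: "\<And>S. finite S \<Longrightarrow> sum h S \<le> B" and e: "e > 0"
  obtains S0 where "finite S0" "\<And>S. finite S \<Longrightarrow> S \<inter> S0 = {} \<Longrightarrow> sum h S \<le> e"
proof -
  define X where "X = sum h ` {S. finite S}"
  have bdd: "bdd_above X" unfolding X_def using bound by (auto intro!: bdd_aboveI)
  have ne: "X \<noteq> {}" unfolding X_def by blast
  have "Sup X - e < Sup X" using e by simp
  then obtain S0 where S0: "finite S0" "Sup X - e < sum h S0"
    using less_cSup_iff[OF ne bdd] unfolding X_def by blast
  show ?thesis
  proof (rule that[OF S0(1)])
    fix S :: "'a set" assume S: "finite S" "S \<inter> S0 = {}"
    have "sum h S + sum h S0 = sum h (S \<union> S0)" using S S0 by (simp add: sum.union_disjoint)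
    also have "\<dots> \<le> Sup X" by (rule cSup_upper[OF _ bdd]) (use S S0 in \<open>auto simp: X_def\<close>)
    finally show "sum h S \<le> e" using S0 by linarith
  qed
qed

text \<open>A finite set carries all but e / 2 of the squared norm of \<open>G\<close>; on it the
  Fejer factors tend to 1. The degree depends on \<open>G\<close>, which is harmless as long as no
  later constant depends on the degree.\<close>

lemma tri_remainder_small:
  fixes G :: "int^'n \<Rightarrow> complex"
  assumes bound: "\<And>S. finite S \<Longrightarrow> (\<Sum>m\<in>S. (norm (G m))\<^sup>2) \<le> B" and e: "e > 0"
  obtains k where "\<And>S. finite S \<Longrightarrow> (\<Sum>m\<in>S. (norm (of_real (1 - tri (2 ^ k) m) * G m))\<^sup>2) \<le> e"
proof -
  obtain S0 where S0: "finite S0" "\<And>S. finite S \<Longrightarrow> S \<inter> S0 = {} \<Longrightarrow> (\<Sum>m\<in>S. (norm (G m))\<^sup>2) \<le> e / 2"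
    using finite_sums_tail[of "\<lambda>m. (norm (G m))\<^sup>2" B "e / 2"] bound e by auto
  have "(\<lambda>k. \<Sum>m\<in>S0. ((1 - tri (2 ^ k) m) * norm (G m))\<^sup>2) \<longlonglongrightarrow> (\<Sum>m\<in>S0. ((1 - 1) * norm (G m))\<^sup>2)"
    by (intro tendsto_sum tendsto_power tendsto_mult tendsto_diff tendsto_const tri_tendsto_1)
  then have "\<forall>\<^sub>F k in sequentially. (\<Sum>m\<in>S0. ((1 - tri (2 ^ k) m) * norm (G m))\<^sup>2) < e / 2"
    by (rule order_tendstoD) (use e in simp)
  then obtain k where k: "(\<Sum>m\<in>S0. ((1 - tri (2 ^ k) m) * norm (G m))\<^sup>2) < e / 2"
    by (auto simp: eventually_sequentially)
  define h where "h m = (norm (of_real (1 - tri (2 ^ k) m) * G m))\<^sup>2" for m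
  have h_eq: "h m = ((1 - tri (2 ^ k) m) * norm (G m))\<^sup>2" for m
    unfolding h_def norm_mult norm_of_real using tri_bounds[of "2 ^ k" m] by simp
  have h_le: "h m \<le> (norm (G m))\<^sup>2" for m
    unfolding h_eq using tri_bounds[of "2 ^ k" m] by (intro power_mono) (auto simp: mult_left_le_one_le)
  show ?thesis
  proof (rule that[of k])
    fix S :: "(int^'n) set" assume S: "finite S"
    have "sum h S = sum h (S \<inter> S0) + sum h (S - S0)"
      using S by (rule sum.Int_Diff)
    also have "sum h (S \<inter> S0) \<le> sum h S0"
      by (rule sum_mono2) (use S0 in \<open>auto simp: h_def\<close>)
    also have "sum h S0 \<le> e / 2" using k unfolding h_eq by simp
    also have "sum h (S - S0) \<le> e / 2"
      by (rule order.trans[OF sum_mono[OF h_le] S0(2)]) (use S in auto)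
    finally show "(\<Sum>m\<in>S. (norm (of_real (1 - tri (2 ^ k) m) * G m))\<^sup>2) \<le> e" unfolding h_def by simp
  qed
qed

text \<open>Order of choices: tau depends on n only and fixes A = tau, lam = tau^4 and C; then
  \<open>G\<close> determines the degree q = 2^k, and q determines K and p. The truncation error and
  the low residual are at most 1/16 each, and squaring a sum costs a factor 2, whence 1/4.\<close>

lemma approx_step_unit:
  obtains C where "C > 0"
    "\<And>G :: int^'n \<Rightarrow> complex. G 0 = 0 \<Longrightarrow> (\<And>S. finite S \<Longrightarrow> (\<Sum>m\<in>S. (norm (G m))\<^sup>2) \<le> 1) \<Longrightarrow>
      \<exists>S F. finite S \<and> (\<forall>j. \<forall>m. m \<notin> S \<longrightarrow> F j m = 0) \<and>
        (\<forall>j x. norm (\<Sum>m\<in>S. F j m * character m x) \<le> C) \<and>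
        (\<forall>j. (\<Sum>m\<in>S. (weight m * norm (F j m))\<^sup>2) \<le> C\<^sup>2) \<and>
        (\<forall>T. finite T \<longrightarrow> (\<Sum>m\<in>T. (norm (G m - synth F m))\<^sup>2) \<le> 1 / 4)"
proof -
  define c where "c = 1 / (8 * 8 ^ CARD('n) * real CARD('n))"
  define M where "M = real CARD('n) * (192 + 18 * (2 * real CARD('n)) ^ CARD('n))"
  \<comment> \<open>\<open>resid_low\<close> gives c times the squared residual at most M tau^2. As
    tau is at most 1, this is at most M tau = c / 16.\<close>
  define \<tau> where "\<tau> = c / (16 * M)"
  have n1: "1 \<le> real CARD('n)" by (simp add: Suc_le_eq)
  have c: "c > 0" "c \<le> 1"
  proof -
    have "1 * 1 * 1 \<le> 8 * 8 ^ CARD('n) * real CARD('n)"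
      using n1 by (intro mult_mono) auto
    then show "c > 0" "c \<le> 1" unfolding c_def by auto
  qed
  have M: "M \<ge> 1"
  proof -
    have "1 * 1 \<le> M" unfolding M_def using n1 by (intro mult_mono) (auto simp: add_increasing2)
    then show ?thesis by simp
  qed
  have \<tau>: "0 < \<tau>" "\<tau> \<le> 1" using c M by (auto simp: \<tau>_def divide_le_eq)
  have \<tau>2: "\<tau>\<^sup>2 \<le> \<tau>" using \<tau> by (simp add: power2_eq_square mult_left_le_one_le)
  \<comment> \<open>Covers the sup bound 3 / A = 3 / tau and the Sobolev bound 1 / sqrt lam = 1 /
    tau^2.\<close>
  define C where "C = 3 / \<tau>\<^sup>2"
  have C: "C > 0" using \<tau> by (simp add: C_def)
  show ?thesis
  proof (rule that[OF C])
    fix G :: "int^'n \<Rightarrow> complex"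
    assume G0: "G 0 = 0" and G1: "\<And>S. finite S \<Longrightarrow> (\<Sum>m\<in>S. (norm (G m))\<^sup>2) \<le> 1"
    obtain k where k: "\<And>S. finite S \<Longrightarrow> (\<Sum>m\<in>S. (norm (of_real (1 - tri (2 ^ k) m) * G m))\<^sup>2) \<le> 1 / 16"
      using tri_remainder_small[of G 1 "1 / 16"] G1 by auto
    define q where "q = (2 ^ k :: nat)"
    \<comment> \<open>Makes 4 q = 2^K, as \<open>resid_low\<close> requires; p on the next line is
      large enough for q^n to be absorbed by 2^(2p).\<close>
    define K where "K = k + 2"
    define p where "p = 2 * q ^ CARD('n)"
    have q: "q > 0" "4 * q \<le> 2 ^ K" by (simp_all add: q_def K_def power_add)
    have p0: "p > 0" using q by (simp add: p_def)
    have p2: "2 * q ^ CARD('n) \<le> 2 ^ (2 * p)"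
    proof -
      have "2 * p < 2 ^ (2 * p)" by (rule less_exp)
      then show ?thesis unfolding p_def by linarith
    qed
    interpret P: penalised G K p "\<tau> ^ 4" \<tau>
      by unfold_locales (use p0 \<tau> G0 in \<open>auto intro!: G1\<close>)
    define F where "F = P.smooth_coeff q"
    define S where "S = (box_of {-int q<..<int q} :: (int^'n) set)"
    have Ssub: "S \<subseteq> P.Freqs"
    proof -
      have "q \<le> 2 ^ K" using q by linarith
      then have iq: "int q \<le> 2 ^ K" by (metis of_nat_le_iff of_nat_power of_nat_numeral)
      have "{-int q<..<int q} \<subseteq> {-(2 ^ K)<..<2 ^ K}"
      proof
        fix x assume "x \<in> {-int q<..<int q}"
        then show "x \<in> {-(2 ^ K)<..<2 ^ K}"
          using iq unfolding greaterThanLessThan_iff by linarith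
      qed
      then show ?thesis unfolding S_def box_of_def by blast
    qed
    have tri0: "tri q m = 0" if mS: "m \<notin> S" for m
      using tri_outside_box[OF q(1)] mS unfolding S_def by blast
    have \<tau>4: "\<tau> ^ 4 = (\<tau>\<^sup>2)\<^sup>2" by (simp add: power4_eq_xxxx power2_eq_square)
    have sq: "sqrt (\<tau> ^ 4) = \<tau>\<^sup>2" by (simp only: \<tau>4 real_sqrt_abs abs_power2)
    have low: "(\<Sum>m\<in>S. (norm (P.resid P.opt m))\<^sup>2) \<le> 1 / 16"
    proof -
      have "\<tau> ^ 4 \<le> 1" using \<tau> by (simp add: power_le_one)
      then have "c * (\<Sum>m\<in>S. (norm (P.resid P.opt m))\<^sup>2) \<le> real CARD('n) * (192 * \<tau>\<^sup>2 + 18 * (2 * real CARD('n)) ^ CARD('n) * \<tau>\<^sup>2)"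
        using P.resid_low[OF _ q(2)] by (simp only: S_def c_def sq)
      also have "\<dots> = M * \<tau>\<^sup>2" unfolding M_def by (simp add: algebra_simps)
      also have "\<dots> \<le> M * \<tau>" using M \<tau>2 by (intro mult_left_mono) auto
      also have "\<dots> = c * (1 / 16)" using M by (simp add: \<tau>_def)
      finally show ?thesis using c by (simp only: mult_le_cancel_left_pos)
    qed
    show "\<exists>S F. finite S \<and> (\<forall>j. \<forall>m. m \<notin> S \<longrightarrow> F j m = 0) \<and>
        (\<forall>j x. norm (\<Sum>m\<in>S. F j m * character m x) \<le> C) \<and>
        (\<forall>j. (\<Sum>m\<in>S. (weight m * norm (F j m))\<^sup>2) \<le> C\<^sup>2) \<and>
        (\<forall>T. finite T \<longrightarrow> (\<Sum>m\<in>T. (norm (G m - synth F m))\<^sup>2) \<le> 1 / 4)"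
    proof (intro exI[of _ S] exI[of _ F] conjI allI impI)
      show "finite S" by (simp add: S_def)
      show "F j m = 0" if "m \<notin> S" for j m
        using tri0[OF that] by (simp add: F_def P.smooth_coeff_def)
      show "norm (\<Sum>m\<in>S. F j m * character m x) \<le> C" for j x
      proof -
        have "q \<le> 2 * 2 ^ K" using q by linarith
        from P.smooth_coeff_sup[OF q(1) this p2, of j x]
        have "norm (\<Sum>m\<in>S. F j m * character m x) \<le> 3 / \<tau>"
          using \<tau> by (simp add: S_def F_def field_simps)
        also have "\<dots> \<le> C" unfolding C_def using \<tau> \<tau>2 by (intro divide_left_mono) auto
        finally show ?thesis .
      qed
      show "(\<Sum>m\<in>S. (weight m * norm (F j m))\<^sup>2) \<le> C\<^sup>2" for j
      proof -
        have "(\<Sum>m\<in>S. (weight m * norm (F j m))\<^sup>2) \<le> 1 / \<tau> ^ 4"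
          unfolding F_def by (rule P.smooth_coeff_weight[OF Ssub])
        also have "\<dots> \<le> 9 / \<tau> ^ 4" using \<tau> by (intro divide_right_mono) auto
        also have "\<dots> = C\<^sup>2" unfolding \<tau>4 C_def power_divide by simp
        finally show ?thesis .
      qed
      fix T :: "(int^'n) set" assume T: "finite T"
      have "(norm (G m - synth F m))\<^sup>2 \<le> 2 * (norm (of_real (1 - tri q m) * G m))\<^sup>2 + 2 * (if m \<in> S then (norm (P.resid P.opt m))\<^sup>2 else 0)" for m
      proof -
        have "norm (of_real (tri q m) * P.resid P.opt m) \<le> (if m \<in> S then norm (P.resid P.opt m) else 0)"
          using tri0[of m] by (auto simp: norm_mult mult_left_le_one_le)
        then have "norm (G m - synth F m) \<le> norm (of_real (1 - tri q m) * G m) + (if m \<in> S then norm (P.resid P.opt m) else 0)"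
          unfolding F_def P.resid_smooth_coeff by (intro order.trans[OF norm_triangle_ineq] add_left_mono)
        then have "(norm (G m - synth F m))\<^sup>2 \<le> (norm (of_real (1 - tri q m) * G m) + (if m \<in> S then norm (P.resid P.opt m) else 0))\<^sup>2"
          by (intro power_mono) auto
        also have "\<dots> \<le> 2 * (norm (of_real (1 - tri q m) * G m))\<^sup>2 + 2 * (if m \<in> S then norm (P.resid P.opt m) else 0)\<^sup>2"
        proof -
          have "(x + y)\<^sup>2 \<le> 2 * x\<^sup>2 + 2 * y\<^sup>2" for x y :: real
            using sum_squares_bound[of x y] by (simp add: power2_sum)
          then show ?thesis .
        qed
        finally show ?thesis by (simp split: if_splits)
      qed
      then have "(\<Sum>m\<in>T. (norm (G m - synth F m))\<^sup>2) \<le> (\<Sum>m\<in>T. 2 * (norm (of_real (1 - tri q m) * G m))\<^sup>2 + 2 * (if m \<in> S then (norm (P.resid P.opt m))\<^sup>2 else 0))"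
        by (intro sum_mono)
      also have "\<dots> = 2 * (\<Sum>m\<in>T. (norm (of_real (1 - tri q m) * G m))\<^sup>2) + 2 * (\<Sum>m\<in>T. if m \<in> S then (norm (P.resid P.opt m))\<^sup>2 else 0)"
        by (simp only: sum.distrib sum_distrib_left)
      also have "(\<Sum>m\<in>T. if m \<in> S then (norm (P.resid P.opt m))\<^sup>2 else 0) = (\<Sum>m\<in>T \<inter> S. (norm (P.resid P.opt m))\<^sup>2)"
        using T by (rule sum.inter_restrict[symmetric])
      also have "\<dots> \<le> (\<Sum>m\<in>S. (norm (P.resid P.opt m))\<^sup>2)"
        by (rule sum_mono2) (auto simp: S_def)
      also have "\<dots> \<le> 1 / 16" by (rule low)
      also have "(\<Sum>m\<in>T. (norm (of_real (1 - tri q m) * G m))\<^sup>2) \<le> 1 / 16"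
        unfolding q_def by (rule k[OF T])
      finally show "(\<Sum>m\<in>T. (norm (G m - synth F m))\<^sup>2) \<le> 1 / 4" by simp
    qed
  qed
qed

lemma approx_step:
  obtains C where "C > 0"
    "\<And>(G :: int^'n \<Rightarrow> complex) r. r > 0 \<Longrightarrow> G 0 = 0 \<Longrightarrow> (\<And>S. finite S \<Longrightarrow> (\<Sum>m\<in>S. (norm (G m))\<^sup>2) \<le> r\<^sup>2) \<Longrightarrow>
      \<exists>S F. finite S \<and> (\<forall>j. \<forall>m. m \<notin> S \<longrightarrow> F j m = 0) \<and>
        (\<forall>j x. norm (\<Sum>m\<in>S. F j m * character m x) \<le> C * r) \<and>
        (\<forall>j. (\<Sum>m\<in>S. (weight m * norm (F j m))\<^sup>2) \<le> (C * r)\<^sup>2) \<and>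
        (\<forall>T. finite T \<longrightarrow> (\<Sum>m\<in>T. (norm (G m - synth F m))\<^sup>2) \<le> (r / 2)\<^sup>2)"
proof -
  obtain C where C: "C > 0" and unit:
    "\<And>G :: int^'n \<Rightarrow> complex. G 0 = 0 \<Longrightarrow> (\<And>S. finite S \<Longrightarrow> (\<Sum>m\<in>S. (norm (G m))\<^sup>2) \<le> 1) \<Longrightarrow>
      \<exists>S F. finite S \<and> (\<forall>j. \<forall>m. m \<notin> S \<longrightarrow> F j m = 0) \<and>
        (\<forall>j x. norm (\<Sum>m\<in>S. F j m * character m x) \<le> C) \<and>
        (\<forall>j. (\<Sum>m\<in>S. (weight m * norm (F j m))\<^sup>2) \<le> C\<^sup>2) \<and>
        (\<forall>T. finite T \<longrightarrow> (\<Sum>m\<in>T. (norm (G m - synth F m))\<^sup>2) \<le> 1 / 4)"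
    using approx_step_unit by blast
  show ?thesis
  proof (rule that[OF C])
    fix G :: "int^'n \<Rightarrow> complex" and r :: real
    assume r: "r > 0" and G0: "G 0 = 0" and G1: "\<And>S. finite S \<Longrightarrow> (\<Sum>m\<in>S. (norm (G m))\<^sup>2) \<le> r\<^sup>2"
    have "(\<Sum>m\<in>S. (norm (G m / of_real r))\<^sup>2) \<le> 1" if "finite S" for S
    proof -
      have "(\<Sum>m\<in>S. (norm (G m / of_real r))\<^sup>2) = (\<Sum>m\<in>S. (norm (G m))\<^sup>2) / r\<^sup>2"
        using r by (simp add: norm_divide power_divide sum_divide_distrib)
      then show ?thesis using G1[OF that] r by (simp add: divide_le_eq)
    qed
    with unit[of "\<lambda>m. G m / of_real r"] G0 obtain S F where SF: "finite S" "\<And>j m. m \<notin> S \<Longrightarrow> F j m = 0"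
      "\<And>j x. norm (\<Sum>m\<in>S. F j m * character m x) \<le> C"
      "\<And>j. (\<Sum>m\<in>S. (weight m * norm (F j m))\<^sup>2) \<le> C\<^sup>2"
      "\<And>T. finite T \<Longrightarrow> (\<Sum>m\<in>T. (norm (G m / of_real r - synth F m))\<^sup>2) \<le> 1 / 4"
      by auto
    define F' where "F' j m = of_real r * F j m" for j m
    show "\<exists>S F. finite S \<and> (\<forall>j. \<forall>m. m \<notin> S \<longrightarrow> F j m = 0) \<and>
        (\<forall>j x. norm (\<Sum>m\<in>S. F j m * character m x) \<le> C * r) \<and>
        (\<forall>j. (\<Sum>m\<in>S. (weight m * norm (F j m))\<^sup>2) \<le> (C * r)\<^sup>2) \<and>
        (\<forall>T. finite T \<longrightarrow> (\<Sum>m\<in>T. (norm (G m - synth F m))\<^sup>2) \<le> (r / 2)\<^sup>2)"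
    proof (intro exI[of _ S] exI[of _ F'] conjI allI impI SF(1))
      show "F' j m = 0" if "m \<notin> S" for j m using SF(2)[OF that] by (simp add: F'_def)
      show "norm (\<Sum>m\<in>S. F' j m * character m x) \<le> C * r" for j x
      proof -
        have "(\<Sum>m\<in>S. F' j m * character m x) = of_real r * (\<Sum>m\<in>S. F j m * character m x)"
          by (simp add: F'_def sum_distrib_left mult_ac)
        then show ?thesis using SF(3)[of j x] r by (simp add: norm_mult mult.commute)
      qed
      show "(\<Sum>m\<in>S. (weight m * norm (F' j m))\<^sup>2) \<le> (C * r)\<^sup>2" for j
      proof -
        have "(\<Sum>m\<in>S. (weight m * norm (F' j m))\<^sup>2) = r\<^sup>2 * (\<Sum>m\<in>S. (weight m * norm (F j m))\<^sup>2)"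
          by (simp add: F'_def norm_mult power_mult_distrib sum_distrib_left mult_ac)
        also have "\<dots> \<le> r\<^sup>2 * C\<^sup>2" by (intro mult_left_mono SF) auto
        finally show ?thesis by (simp add: power_mult_distrib mult.commute)
      qed
      fix T :: "(int^'n) set" assume T: "finite T"
      have "G m - synth F' m = of_real r * (G m / of_real r - synth F m)" for m
        using synth_cmult[of "\<lambda>_. of_real r" F m] r by (simp add: F'_def[abs_def] right_diff_distrib)
      then have "(\<Sum>m\<in>T. (norm (G m - synth F' m))\<^sup>2) = r\<^sup>2 * (\<Sum>m\<in>T. (norm (G m / of_real r - synth F m))\<^sup>2)"
        by (simp add: norm_mult power_mult_distrib sum_distrib_left)
      also have "\<dots> \<le> r\<^sup>2 * (1 / 4)" by (intro mult_left_mono SF T) auto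
      finally show "(\<Sum>m\<in>T. (norm (G m - synth F' m))\<^sup>2) \<le> (r / 2)\<^sup>2" by (simp add: power_divide)
    qed
  qed
qed

section \<open>Fourier coefficients of functions on the torus\<close>

lemma set_integral_cell:
  fixes f :: "real^'n \<Rightarrow> 'b::{banach, second_countable_topology}"
  shows "set_lebesgue_integral lebesgue torus_cell f = integral\<^sup>L (lebesgue_on torus_cell) f"
  by (simp add: set_lebesgue_integral_def integral_restrict_space torus_cell_def)

lemma integral_cis_period:
  fixes k :: int
  shows "(\<integral>t. indicator {0..2 * pi} t *\<^sub>R cis (of_int k * t) \<partial>lborel) = (if k = 0 then of_real (2 * pi) else 0)"
proof (cases "k = 0")
  case False
  define F where "F t = cis (of_int k * t) / (\<i> * of_int k)" for t :: real
  have "(\<integral>t. indicator {0..2 * pi} t *\<^sub>R cis (of_int k * t) \<partial>lborel) = F (2 * pi) - F 0"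
  proof (rule integral_FTC_Icc)
    fix t :: real
    have "((\<lambda>z. exp (\<i> * of_int k * z) / (\<i> * of_int k)) has_field_derivative exp (\<i> * of_int k * of_real t)) (at (of_real t))"
      using False by (auto intro!: derivative_eq_intros)
    from has_vector_derivative_real_field[OF this]
    have "((\<lambda>t. exp (\<i> * of_int k * of_real t) / (\<i> * of_int k)) has_vector_derivative exp (\<i> * of_int k * of_real t)) (at t within {0..2 * pi})" .
    then show "(F has_vector_derivative cis (of_int k * t)) (at t within {0..2 * pi})"
      by (simp add: F_def[abs_def] cis_conv_exp mult.assoc)
  qed (auto intro!: continuous_intros)
  also have "F (2 * pi) = F 0"
  proof -
    have "cis (of_int k * (2 * pi)) = cis (2 * pi * of_int k)" by (simp add: mult.commute)
    also have "\<dots> = 1" by (rule cis_multiple_2pi) simp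
    finally show ?thesis by (simp add: F_def)
  qed
  finally show ?thesis using False by simp
qed (simp add: scaleR_conv_of_real)

text \<open>Fubini: Lebesgue measure is the image of a product of measures on the line, indexed by
  the basis.\<close>

lemma lborel_integral_prod:
  fixes h :: "'a::euclidean_space \<Rightarrow> real \<Rightarrow> complex"
  assumes "\<And>b. b \<in> Basis \<Longrightarrow> integrable lborel (h b)"
  shows "(\<integral>x. (\<Prod>b\<in>Basis. h b (x \<bullet> b)) \<partial>lborel) = (\<Prod>b\<in>Basis. \<integral>t. h b t \<partial>lborel)"
proof -
  interpret product_sigma_finite "\<lambda>b::'a. lborel :: real measure" ..
  have [measurable]: "h b \<in> borel_measurable borel" if "b \<in> Basis" for b
    using borel_measurable_integrable[OF assms[OF that]] by simp
  have "(\<integral>x. (\<Prod>b\<in>Basis. h b (x \<bullet> b)) \<partial>lborel) = (\<integral>f. (\<Prod>b\<in>Basis. h b ((\<Sum>c\<in>Basis. f c *\<^sub>R c) \<bullet> b)) \<partial>(\<Pi>\<^sub>M b\<in>(Basis :: 'a set). lborel))"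
    by (subst lborel_eq, subst integral_distr) (auto intro!: borel_measurable_prod)
  also have "\<dots> = (\<integral>f. (\<Prod>b\<in>Basis. h b (f b)) \<partial>(\<Pi>\<^sub>M b\<in>(Basis :: 'a set). lborel))"
    by (intro Bochner_Integration.integral_cong prod.cong refl) (simp add: inner_sum_left inner_Basis if_distrib cong: if_cong)
  also have "\<dots> = (\<Prod>b\<in>Basis. \<integral>t. h b t \<partial>lborel)"
    by (rule product_integral_prod) (auto intro: assms)
  finally show ?thesis .
qed

lemma integral_character:
  fixes m :: "int^'n"
  shows "integral\<^sup>L (lebesgue_on torus_cell) (character m) = (if m = 0 then of_real ((2 * pi) ^ CARD('n)) else 0)"
proof -
  define h where "h b t = indicator {0..2 * pi} t *\<^sub>R cis ((real_vec m \<bullet> b) * t)" for b :: "real^'n" and t :: real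
  have Basis: "(Basis :: (real^'n) set) = range (\<lambda>i. axis i 1)" by (auto simp: Basis_vec_def)
  have prod_Basis: "(\<Prod>b\<in>Basis. f b) = (\<Prod>i\<in>UNIV. f (axis i 1))" for f :: "real^'n \<Rightarrow> complex"
    unfolding Basis by (subst prod.reindex) (auto simp: inj_on_def axis_eq_axis)
  have ax: "v \<bullet> axis i 1 = v $ i" for v :: "real^'n" and i by (simp add: inner_axis)
  have rv: "real_vec m $ i = of_int (m $ i)" for i by (simp add: real_vec_def)
  have eq: "indicator torus_cell x *\<^sub>R character m x = (\<Prod>b\<in>Basis. h b (x \<bullet> b))" for x
  proof (cases "x \<in> torus_cell")
    case True
    then have "\<And>i. 0 \<le> x $ i \<and> x $ i \<le> 2 * pi" by (simp add: torus_cell_def mem_box_cart)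
    then show ?thesis using True by (simp add: prod_Basis h_def ax rv character_prod)
  next
    case False
    then obtain i where "\<not> (0 \<le> x $ i \<and> x $ i \<le> 2 * pi)" by (auto simp: torus_cell_def mem_box_cart)
    then have "h (axis i 1) (x \<bullet> axis i 1) = 0" by (auto simp: h_def ax)
    then have "(\<Prod>b\<in>Basis. h b (x \<bullet> b)) = 0" unfolding prod_Basis by (intro prod_zero) auto
    then show ?thesis using False by simp
  qed
  have "integral\<^sup>L (lebesgue_on torus_cell) (character m) = (\<integral>x. indicator torus_cell x *\<^sub>R character m x \<partial>lebesgue)"
    by (simp add: integral_restrict_space torus_cell_def)
  also have "\<dots> = (\<integral>x. indicator torus_cell x *\<^sub>R character m x \<partial>lborel)"
  proof (rule integral_completion)
    have "(\<lambda>x. character m x) \<in> borel_measurable borel"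
      unfolding character_def by (intro borel_measurable_continuous_onI continuous_intros)
    then show "(\<lambda>x. indicator torus_cell x *\<^sub>R character m x) \<in> borel_measurable lborel"
      by (simp add: torus_cell_def)
  qed
  also have "\<dots> = (\<Prod>b\<in>Basis. \<integral>t. h b t \<partial>lborel)"
    unfolding eq
  proof (rule lborel_integral_prod)
    fix b :: "real^'n"
    show "integrable lborel (h b)"
      unfolding h_def by (rule borel_integrable_compact) (auto intro!: continuous_intros)
  qed
  also have "\<dots> = (\<Prod>i\<in>UNIV. if m $ i = 0 then of_real (2 * pi) else 0)"
    unfolding prod_Basis h_def ax rv integral_cis_period ..
  also have "\<dots> = (if m = 0 then of_real ((2 * pi) ^ CARD('n)) else 0)"
    by (auto simp: vec_eq_iff)
  finally show ?thesis .
qed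

lemma finite_measure_cell: "finite_measure (lebesgue_on (torus_cell :: (real^'n) set))"
  by (rule finite_measure_lebesgue_on) (simp add: torus_cell_def)

lemma continuous_measurable_cell:
  "continuous_on UNIV f \<Longrightarrow> f \<in> borel_measurable (lebesgue_on (torus_cell :: (real^'n) set))"
  by (rule continuous_imp_measurable_on_sets_lebesgue) (auto simp: torus_cell_def intro: continuous_on_subset)

lemma continuous_character [continuous_intros]: "continuous_on S (character m)"
  unfolding character_def by (intro continuous_intros)

lemma integrable_cell_bounded:
  fixes f :: "real^'n \<Rightarrow> 'b::{banach, second_countable_topology}"
  assumes "f \<in> borel_measurable (lebesgue_on torus_cell)" "\<And>x. norm (f x) \<le> B"
  shows "integrable (lebesgue_on torus_cell) f"
  by (rule finite_measure.integrable_const_bound[OF finite_measure_cell, of _ B]) (use assms in auto)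

lemma integrable_cell_mult:
  fixes g h :: "real^'n \<Rightarrow> complex"
  assumes g: "integrable (lebesgue_on torus_cell) g"
    and h: "h \<in> borel_measurable (lebesgue_on torus_cell)" "\<And>x. norm (h x) \<le> B"
  shows "integrable (lebesgue_on torus_cell) (\<lambda>x. g x * h x)"
proof (rule Bochner_Integration.integrable_bound)
  show "integrable (lebesgue_on torus_cell) (\<lambda>x. norm (g x) * B)" using g by simp
  show "AE x in lebesgue_on torus_cell. norm (g x * h x) \<le> norm (norm (g x) * B)"
  proof (rule AE_I2)
    fix x :: "real^'n"
    have "norm (g x) * norm (h x) \<le> norm (g x) * B" by (intro mult_left_mono h) auto
    also have "\<dots> \<le> norm (norm (g x) * B)" by simp
    finally show "norm (g x * h x) \<le> norm (norm (g x) * B)" by (simp add: norm_mult)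
  qed
  show "(\<lambda>x. g x * h x) \<in> borel_measurable (lebesgue_on torus_cell)"
    using borel_measurable_integrable[OF g] h(1) by simp
qed

section \<open>Bessel's inequality on one cell\<close>

definition L2_cell :: "(real^'n \<Rightarrow> complex) \<Rightarrow> bool" where
  "L2_cell g \<longleftrightarrow> g \<in> borel_measurable (lebesgue_on torus_cell) \<and> integrable (lebesgue_on torus_cell) (\<lambda>x. (norm (g x))\<^sup>2)"

lemma L2_cell_integrable:
  assumes "L2_cell g"
  shows "integrable (lebesgue_on torus_cell) g"
proof (rule Bochner_Integration.integrable_bound)
  show "integrable (lebesgue_on torus_cell) (\<lambda>x. 1 + (norm (g x))\<^sup>2)"
    using assms unfolding L2_cell_def
    by (intro Bochner_Integration.integrable_add finite_measure.integrable_const[OF finite_measure_cell]) auto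
  show "AE x in lebesgue_on torus_cell. norm (g x) \<le> norm (1 + (norm (g x))\<^sup>2)"
  proof (rule AE_I2)
    fix x
    have "2 * norm (g x) * 1 \<le> (norm (g x))\<^sup>2 + 1\<^sup>2" by (rule sum_squares_bound)
    moreover have "0 \<le> norm (g x)" by simp
    ultimately have "norm (g x) \<le> 1 + (norm (g x))\<^sup>2" unfolding power_one mult_1_right by linarith
    then show "norm (g x) \<le> norm (1 + (norm (g x))\<^sup>2)" by simp
  qed
  show "g \<in> borel_measurable (lebesgue_on torus_cell)" using assms by (simp add: L2_cell_def)
qed

lemma bounded_L2_cell:
  assumes "f \<in> borel_measurable (lebesgue_on torus_cell)" "\<And>x. norm (f x) \<le> B"
  shows "L2_cell f"
  unfolding L2_cell_def
proof
  have "norm ((norm (f x))\<^sup>2) \<le> B\<^sup>2" for x using assms(2)[of x] by (simp add: power_mono)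
  then show "integrable (lebesgue_on torus_cell) (\<lambda>x. (norm (f x))\<^sup>2)"
    by (intro integrable_cell_bounded[of _ "B\<^sup>2"]) (use assms(1) in auto)
qed fact

text \<open>Expand the nonnegative integral of |V g - P|^2, where V is the volume of the cell and P
  the trigonometric polynomial built from the integrals a(m). Scaling g by V avoids dividing the
  coefficients.\<close>

lemma bessel:
  fixes g :: "real^'n \<Rightarrow> complex"
  assumes g: "L2_cell g" and S: "finite S"
  shows "(\<Sum>m\<in>S. (norm (\<integral>x. g x * character m x \<partial>lebesgue_on torus_cell))\<^sup>2)
     \<le> (2 * pi) ^ CARD('n) * (\<integral>x. (norm (g x))\<^sup>2 \<partial>lebesgue_on torus_cell)"
proof -
  let ?M = "lebesgue_on (torus_cell :: (real^'n) set)"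
  define V where "V = (2 * pi) ^ CARD('n)"
  have V: "V > 0" by (simp add: V_def)
  define a where "a m = (\<integral>x. g x * character m x \<partial>?M)" for m
  define P where "P x = (\<Sum>m\<in>S. a m * cnj (character m x))" for x
  have int_g: "integrable ?M g" using g by (rule L2_cell_integrable)
  have meas: "character m \<in> borel_measurable ?M" for m by (intro continuous_measurable_cell continuous_intros)
  have int_gc: "integrable ?M (\<lambda>x. g x * character m x)" for m
    by (rule integrable_cell_mult[OF int_g meas, of _ 1]) simp
  have int_c: "integrable ?M (character m)" for m
    by (rule integrable_cell_bounded[OF meas, of _ 1]) simp
  have gP_eq: "g x * cnj (P x) = (\<Sum>m\<in>S. cnj (a m) * (g x * character m x))" for x
    by (simp add: P_def sum_distrib_left mult_ac)
  have int_gP: "integrable ?M (\<lambda>x. g x * cnj (P x))"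
    unfolding gP_eq by (intro Bochner_Integration.integrable_sum integrable_mult_right int_gc)
  have gP: "(\<integral>x. g x * cnj (P x) \<partial>?M) = of_real (\<Sum>m\<in>S. (norm (a m))\<^sup>2)"
    unfolding gP_eq of_real_sum complex_norm_square
    by (subst Bochner_Integration.integral_sum) (auto simp: int_gc a_def mult.commute)
  have PP_eq: "P x * cnj (P x) = (\<Sum>m\<in>S. \<Sum>k\<in>S. a m * cnj (a k) * character (k - m) x)" for x
    by (simp add: P_def sum_product character_diff mult_ac)
  have int_PP: "integrable ?M (\<lambda>x. P x * cnj (P x))"
    unfolding PP_eq by (intro Bochner_Integration.integrable_sum integrable_mult_right int_c)
  have PP: "(\<integral>x. P x * cnj (P x) \<partial>?M) = of_real (V * (\<Sum>m\<in>S. (norm (a m))\<^sup>2))"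
  proof -
    have "(\<integral>x. P x * cnj (P x) \<partial>?M) = (\<Sum>m\<in>S. \<Sum>k\<in>S. a m * cnj (a k) * integral\<^sup>L ?M (character (k - m)))"
      unfolding PP_eq by (subst Bochner_Integration.integral_sum, intro Bochner_Integration.integrable_sum integrable_mult_right int_c,
        subst Bochner_Integration.integral_sum, intro integrable_mult_right int_c) simp
    also have "\<dots> = (\<Sum>m\<in>S. \<Sum>k\<in>S. if k = m then a m * cnj (a m) * of_real V else 0)"
      by (intro sum.cong refl) (simp add: integral_character V_def)
    also have "\<dots> = (\<Sum>m\<in>S. of_real (V * (norm (a m))\<^sup>2))"
      unfolding of_real_mult complex_norm_square using S by (intro sum.cong refl) (simp add: mult_ac)
    finally show ?thesis by (simp add: sum_distrib_left)
  qed
  have int_g2: "integrable ?M (\<lambda>x. (norm (g x))\<^sup>2)" using g by (simp add: L2_cell_def)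
  have sq: "(norm (of_real V * g x - P x))\<^sup>2 = V\<^sup>2 * (norm (g x))\<^sup>2 - 2 * V * Re (g x * cnj (P x)) + Re (P x * cnj (P x))" for x
    unfolding cmod_power2 by (simp add: power2_eq_square algebra_simps)
  have "0 \<le> (\<integral>x. (norm (of_real V * g x - P x))\<^sup>2 \<partial>?M)" by (rule Bochner_Integration.integral_nonneg) simp
  also have "\<dots> = V\<^sup>2 * (\<integral>x. (norm (g x))\<^sup>2 \<partial>?M) - 2 * V * (\<integral>x. Re (g x * cnj (P x)) \<partial>?M) + (\<integral>x. Re (P x * cnj (P x)) \<partial>?M)"
    unfolding sq
    using integrable_Re[OF int_gP] integrable_Re[OF int_PP] int_g2
    by (subst Bochner_Integration.integral_add, simp, simp, subst Bochner_Integration.integral_diff) (simp_all del: times_complex.sel)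
  also have "\<dots> = V\<^sup>2 * (\<integral>x. (norm (g x))\<^sup>2 \<partial>?M) - V * (\<Sum>m\<in>S. (norm (a m))\<^sup>2)"
    unfolding integral_Re[OF int_gP] integral_Re[OF int_PP] gP PP by simp
  finally have "V * (\<Sum>m\<in>S. (norm (a m))\<^sup>2) \<le> V * (V * (\<integral>x. (norm (g x))\<^sup>2 \<partial>?M))"
    by (simp add: power2_eq_square)
  then show ?thesis using V unfolding a_def V_def[symmetric] by simp
qed

section \<open>Density of trigonometric polynomials and Parseval's formula\<close>

lemma torus_fun_shift:
  fixes \<phi> :: "real^'n \<Rightarrow> complex"
  assumes "torus_fun \<phi>"
  shows "\<phi> (x + (2 * pi) *\<^sub>R real_vec k) = \<phi> x"
proof -
  have step: "\<phi> (y + (2 * pi) *\<^sub>R axis j 1) = \<phi> y" for y j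
    using assms by (simp add: torus_fun_def)
  have nat: "\<phi> (y + (real n * (2 * pi)) *\<^sub>R axis j 1) = \<phi> y" for n y j
  proof (induction n)
    case (Suc n)
    have "y + (real (Suc n) * (2 * pi)) *\<^sub>R axis j 1 = (y + (real n * (2 * pi)) *\<^sub>R axis j 1) + (2 * pi) *\<^sub>R axis j 1"
      by (simp add: algebra_simps)
    then show ?case using step Suc by metis
  qed simp
  have int: "\<phi> (y + (of_int z * (2 * pi)) *\<^sub>R axis j 1) = \<phi> y" for z y j
  proof (cases "z \<ge> 0")
    case True
    then show ?thesis using nat[of y "nat z" j] by simp
  next
    case False
    then show ?thesis using nat[of "y + (of_int z * (2 * pi)) *\<^sub>R axis j 1" "nat (- z)" j]
      by (simp flip: scaleR_left_distrib)
  qed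
  have sum: "finite S \<Longrightarrow> \<phi> (x + (\<Sum>j\<in>S. (of_int (k $ j) * (2 * pi)) *\<^sub>R axis j 1)) = \<phi> x" for S
  proof (induction S rule: finite_induct)
    case (insert j S)
    have "x + (\<Sum>i\<in>insert j S. (of_int (k $ i) * (2 * pi)) *\<^sub>R axis i 1)
        = (x + (\<Sum>i\<in>S. (of_int (k $ i) * (2 * pi)) *\<^sub>R axis i 1)) + (of_int (k $ j) * (2 * pi)) *\<^sub>R axis j 1"
      using insert by (simp add: algebra_simps)
    then show ?case by (simp only: int insert.IH)
  qed simp
  have "(2 * pi) *\<^sub>R real_vec k = (\<Sum>j\<in>UNIV. (of_int (k $ j) * (2 * pi)) *\<^sub>R axis j 1)"
    by (simp add: vec_eq_iff real_vec_def axis_def if_distrib cong: if_cong)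
  then show ?thesis using sum[of UNIV] by simp
qed

lemma shift_into_interval:
  fixes x c :: "real^'n"
  obtains k where "\<And>i. c $ i - pi \<le> (x + (2 * pi) *\<^sub>R real_vec k) $ i" "\<And>i. (x + (2 * pi) *\<^sub>R real_vec k) $ i \<le> c $ i + pi"
proof (rule that)
  let ?k = "\<chi> i. - \<lfloor>(x $ i - c $ i + pi) / (2 * pi)\<rfloor>"
  fix i
  define t where "t = (x $ i - c $ i + pi) / (2 * pi)"
  have x: "x $ i = c $ i - pi + 2 * pi * t" by (simp add: t_def)
  have eq: "(x + (2 * pi) *\<^sub>R real_vec ?k) $ i = c $ i - pi + 2 * pi * (t - of_int \<lfloor>t\<rfloor>)"
    by (simp add: real_vec_def x algebra_simps flip: t_def)
  have "0 \<le> 2 * pi * (t - of_int \<lfloor>t\<rfloor>)" by (intro mult_nonneg_nonneg) auto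
  then show "c $ i - pi \<le> (x + (2 * pi) *\<^sub>R real_vec ?k) $ i" unfolding eq by simp
  have "t - of_int \<lfloor>t\<rfloor> \<le> 1" by linarith
  then have "2 * pi * (t - of_int \<lfloor>t\<rfloor>) \<le> 2 * pi * 1" by (intro mult_left_mono) auto
  then show "(x + (2 * pi) *\<^sub>R real_vec ?k) $ i \<le> c $ i + pi" unfolding eq by simp
qed

lemma C0_torus_bounded:
  fixes \<phi> :: "real^'n \<Rightarrow> complex"
  assumes "\<phi> \<in> C0_torus"
  obtains B where "B > 0" "\<And>x. norm (\<phi> x) \<le> B"
proof -
  have "compact (\<phi> ` cbox (\<chi> i. - pi) (\<chi> i. pi))"
    using assms by (intro compact_continuous_image) (auto simp: C0_torus_def intro: continuous_on_subset)
  then have "bounded (\<phi> ` cbox (\<chi> i. - pi) (\<chi> i. pi))" by (rule compact_imp_bounded)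
  then obtain B where B: "B > 0" "\<And>y. y \<in> cbox (\<chi> i. - pi) (\<chi> i. pi) \<Longrightarrow> norm (\<phi> y) \<le> B"
    unfolding bounded_pos by blast
  show ?thesis
  proof (rule that[OF B(1)])
    fix x :: "real^'n"
    obtain k where k: "\<And>i. (0 :: real^'n) $ i - pi \<le> (x + (2 * pi) *\<^sub>R real_vec k) $ i" "\<And>i. (x + (2 * pi) *\<^sub>R real_vec k) $ i \<le> (0 :: real^'n) $ i + pi"
      using shift_into_interval[of 0 x] by blast
    then have "x + (2 * pi) *\<^sub>R real_vec k \<in> cbox (\<chi> i. - pi) (\<chi> i. pi)" by (simp add: mem_box_cart)
    from B(2)[OF this] show "norm (\<phi> x) \<le> B"
      using torus_fun_shift[of \<phi> x k] assms by (simp add: C0_torus_def)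
  qed
qed

lemma sin_half_square: "(sin (t / 2))\<^sup>2 = (1 - cos t) / 2" for t :: real
  using cos_double_sin[of "t / 2"] by simp

lemma sin_half_shift: "(sin ((t + 2 * pi * of_int k) / 2))\<^sup>2 = (sin (t / 2))\<^sup>2" for t :: real
proof -
  have "cos (t + 2 * pi * of_int k) = cos t" by (simp add: cos_add)
  then show ?thesis by (simp only: sin_half_square)
qed

text \<open>Uniform continuity in a form that can be averaged against the Fejer kernel: the sum of
  squared sines is comparable with the squared periodic distance. Near points contribute e; for far
  points the sum is at least s, and C = 2 B / s absorbs the trivial bound 2 B.\<close>

lemma C0_torus_modulus:
  fixes \<phi> :: "real^'n \<Rightarrow> complex"
  assumes \<phi>: "\<phi> \<in> C0_torus" and e: "e > 0"
  obtains C where "C > 0" "\<And>x y. norm (\<phi> x - \<phi> y) \<le> e + C * (\<Sum>i\<in>UNIV. (sin ((x - y) $ i / 2))\<^sup>2)"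
proof -
  obtain B where B: "B > 0" "\<And>x. norm (\<phi> x) \<le> B" using C0_torus_bounded[OF \<phi>] by blast
  have tf: "torus_fun \<phi>" and cont: "continuous_on UNIV \<phi>" using \<phi> by (auto simp: C0_torus_def)
  define Q where "Q = (cbox (\<chi> i. - 2 * pi) (\<chi> i. 2 * pi) :: (real^'n) set)"
  have "uniformly_continuous_on Q \<phi>"
    unfolding Q_def by (intro compact_uniformly_continuous continuous_on_subset[OF cont]) auto
  then obtain d where d: "d > 0" "\<And>x y. x \<in> Q \<Longrightarrow> y \<in> Q \<Longrightarrow> dist x y < d \<Longrightarrow> dist (\<phi> x) (\<phi> y) < e"
    using e unfolding uniformly_continuous_on_def by metis
  define \<eta> where "\<eta> = min (d / (2 * real CARD('n))) pi"
  have \<eta>: "0 < \<eta>" "\<eta> \<le> pi" using d by (auto simp: \<eta>_def)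
  define s where "s = (sin (\<eta> / 2))\<^sup>2"
  have s: "s > 0" unfolding s_def using sin_gt_zero[of "\<eta> / 2"] \<eta> by simp
  show ?thesis
  proof (rule that[of "2 * B / s"])
    show "2 * B / s > 0" using B s by simp
    fix x y :: "real^'n"
    obtain k where k: "\<And>i. (0 :: real^'n) $ i - pi \<le> (y + (2 * pi) *\<^sub>R real_vec k) $ i" "\<And>i. (y + (2 * pi) *\<^sub>R real_vec k) $ i \<le> (0 :: real^'n) $ i + pi"
      using shift_into_interval[of 0 y] by blast
    \<comment> \<open>First y is moved into the cube of half-width pi, then x to within pi of it in
      each coordinate. Both points lie in Q, and half of each coordinate difference stays where the
      sine is monotone.\<close>
    define y' where "y' = y + (2 * pi) *\<^sub>R real_vec k"
    obtain l where l: "\<And>i. y' $ i - pi \<le> (x + (2 * pi) *\<^sub>R real_vec l) $ i" "\<And>i. (x + (2 * pi) *\<^sub>R real_vec l) $ i \<le> y' $ i + pi"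
      using shift_into_interval[of y' x] by blast
    define x' where "x' = x + (2 * pi) *\<^sub>R real_vec l"
    have y'b: "- pi \<le> y' $ i" "y' $ i \<le> pi" for i using k[of i] unfolding y'_def by auto
    have x'b: "y' $ i - pi \<le> x' $ i" "x' $ i \<le> y' $ i + pi" for i using l[of i] unfolding x'_def by auto
    have "- (2 * pi) \<le> x' $ i" "x' $ i \<le> 2 * pi" for i using y'b[of i] x'b[of i] by linarith+
    then have "x' \<in> Q" by (simp add: Q_def mem_box_cart)
    have "- (2 * pi) \<le> y' $ i" "y' $ i \<le> 2 * pi" for i using y'b[of i] pi_gt_zero by linarith+
    then have "y' \<in> Q" by (simp add: Q_def mem_box_cart)
    have \<phi>xy: "\<phi> x' = \<phi> x" "\<phi> y' = \<phi> y" unfolding x'_def y'_def by (rule torus_fun_shift[OF tf])+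
    have sin_eq: "(sin ((x' - y') $ i / 2))\<^sup>2 = (sin ((x - y) $ i / 2))\<^sup>2" for i
    proof -
      have "(x' - y') $ i = (x - y) $ i + 2 * pi * of_int (l $ i - k $ i)"
        by (simp add: x'_def y'_def real_vec_def algebra_simps)
      then show ?thesis by (simp only: sin_half_shift)
    qed
    show "norm (\<phi> x - \<phi> y) \<le> e + 2 * B / s * (\<Sum>i\<in>UNIV. (sin ((x - y) $ i / 2))\<^sup>2)"
    proof (cases "dist x' y' < d")
      case True
      then have "norm (\<phi> x - \<phi> y) < e"
        using d(2)[OF \<open>x' \<in> Q\<close> \<open>y' \<in> Q\<close>] \<phi>xy by (simp add: dist_norm)
      moreover have "0 \<le> 2 * B / s * (\<Sum>i\<in>UNIV. (sin ((x - y) $ i / 2))\<^sup>2)"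
        using B s by (intro mult_nonneg_nonneg sum_nonneg) auto
      ultimately show ?thesis by linarith
    next
      case False
      have "\<exists>i. \<eta> \<le> \<bar>(x' - y') $ i\<bar>"
      proof (rule ccontr)
        assume "\<nexists>i. \<eta> \<le> \<bar>(x' - y') $ i\<bar>"
        then have small: "\<bar>(x' - y') $ i\<bar> \<le> \<eta>" for i by (simp add: not_le less_imp_le)
        have "dist x' y' \<le> (\<Sum>i\<in>UNIV. \<bar>(x' - y') $ i\<bar>)" unfolding dist_norm by (rule norm_le_l1_cart)
        also have "\<dots> \<le> (\<Sum>i\<in>(UNIV::'n set). \<eta>)" by (intro sum_mono small)
        also have "\<dots> = real CARD('n) * \<eta>" by simp
        also have "\<dots> \<le> real CARD('n) * (d / (2 * real CARD('n)))" by (intro mult_left_mono) (auto simp: \<eta>_def)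
        also have "\<dots> < d" using d by simp
        finally show False using False by simp
      qed
      then obtain i where i: "\<eta> \<le> \<bar>(x' - y') $ i\<bar>" by blast
      have le: "\<bar>(x' - y') $ i\<bar> \<le> pi" using x'b[of i] by (auto simp: abs_le_iff)
      have "sin (\<eta> / 2) \<le> sin (\<bar>(x' - y') $ i\<bar> / 2)"
        using \<eta> i le by (intro sin_monotone_2pi_le) auto
      then have "s \<le> (sin (\<bar>(x' - y') $ i\<bar> / 2))\<^sup>2"
        unfolding s_def using sin_gt_zero[of "\<eta> / 2"] \<eta> by (intro power_mono) auto
      also have "\<dots> = (sin ((x - y) $ i / 2))\<^sup>2"
        unfolding sin_eq[symmetric] by (simp only: sin_half_square cos_abs_real)
      also have "\<dots> \<le> (\<Sum>i\<in>UNIV. (sin ((x - y) $ i / 2))\<^sup>2)" by (rule member_le_sum) auto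
      finally have "2 * B / s * s \<le> 2 * B / s * (\<Sum>i\<in>UNIV. (sin ((x - y) $ i / 2))\<^sup>2)"
        using B s by (intro mult_left_mono) auto
      moreover have "norm (\<phi> x - \<phi> y) \<le> 2 * B"
        using norm_triangle_ineq4[of "\<phi> x" "\<phi> y"] B(2)[of x] B(2)[of y] by linarith
      ultimately show ?thesis using s e by simp
    qed
  qed
qed

text \<open>Since sin^2 (t/2) = (1 - cos t) / 2, only the mass 1 and the first Fejer coefficient 1 -
  1/q matter.\<close>

lemma avg_fejer_sin:
  fixes x :: "real^'n"
  assumes q: "q > 0"
  shows "avg (2 * q) (\<lambda>l. fejer q (x - grid_point (2 * q) l) * (sin ((x - grid_point (2 * q) l) $ i / 2))\<^sup>2) \<le> 1 / real q"
proof -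
  let ?g = "\<lambda>l. x - grid_point (2 * q) l"
  have tri: "tri q (axis i 1 :: int^'n) = 1 - 1 / real q"
  proof -
    have "tri q (axis i 1 :: int^'n) = (\<Prod>j\<in>UNIV. if j = i then tri1 q 1 else 1)"
      unfolding tri_def by (intro prod.cong refl) (auto simp: axis_def)
    also have "\<dots> = tri1 q 1" by simp
    also have "\<dots> = 1 - 1 / real q" using q by (simp add: tri1_def)
    finally show ?thesis .
  qed
  have "avg (2 * q) (\<lambda>l. of_real (fejer q (?g l)) * character (axis i 1) (?g l)) = of_real (1 - 1 / real q)"
    unfolding tri[symmetric] by (rule avg_fejer_character) (use q in \<open>auto simp: axis_def\<close>)
  then have "Re (avg (2 * q) (\<lambda>l. of_real (fejer q (?g l)) * character (axis i 1) (?g l))) = 1 - 1 / real q"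
    by simp
  then have cosavg: "avg (2 * q) (\<lambda>l. fejer q (?g l) * cos (?g l $ i)) = 1 - 1 / real q"
    by (simp add: Re_avg character_axis)
  have "fejer q (?g l) * (sin (?g l $ i / 2))\<^sup>2 = 1 / 2 * fejer q (?g l) - 1 / 2 * (fejer q (?g l) * cos (?g l $ i))" for l
    unfolding sin_half_square by (simp add: right_diff_distrib diff_divide_distrib)
  then have "avg (2 * q) (\<lambda>l. fejer q (?g l) * (sin (?g l $ i / 2))\<^sup>2) = avg (2 * q) (\<lambda>l. 1 / 2 * fejer q (?g l) - 1 / 2 * (fejer q (?g l) * cos (?g l $ i)))"
    by presburger
  also have "\<dots> = 1 / 2 * avg (2 * q) (\<lambda>l. fejer q (?g l)) - 1 / 2 * avg (2 * q) (\<lambda>l. fejer q (?g l) * cos (?g l $ i))"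
    by (simp only: avg_diff avg_cmult)
  also have "\<dots> \<le> 1 / real q"
    unfolding cosavg using avg_fejer_grid[of q "2 * q" x] q by (simp add: field_simps)
  finally show ?thesis .
qed

text \<open>The approximant is a Fejer mean taken over a grid instead of an integral. Kernel
  positivity, mass 1 and the second moment O(1/q) suffice, as in Korovkin's argument.\<close>

lemma trig_poly_dense:
  fixes \<phi> :: "real^'n \<Rightarrow> complex"
  assumes \<phi>: "\<phi> \<in> C0_torus" and e: "e > 0"
  obtains S a where "finite S" "\<And>x. norm (\<phi> x - (\<Sum>m\<in>S. a m * character m x)) \<le> e"
proof -
  obtain C where C: "C > 0" "\<And>x y. norm (\<phi> x - \<phi> y) \<le> e / 2 + C * (\<Sum>i\<in>UNIV. (sin ((x - y) $ i / 2))\<^sup>2)"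
    using C0_torus_modulus[OF \<phi>, of "e / 2"] e by auto
  \<comment> \<open>The moment term is C n / q, at most e / 2 for this q.\<close>
  obtain q :: nat where q0: "2 * C * real CARD('n) / e < real q" using reals_Archimedean2 by blast
  have q: "q > 0"
  proof -
    have "0 \<le> 2 * C * real CARD('n) / e" using C e by simp
    then have "0 < real q" using q0 by linarith
    then show ?thesis by simp
  qed
  let ?g = "grid_point (2 * q) :: int^'n \<Rightarrow> real^'n"
  define a where "a m = of_real (tri q m) * grid_coeff (2 * q) (\<lambda>l. \<phi> (?g l)) m" for m
  show ?thesis
  proof (rule that[of "box_of {-int q<..<int q}" a])
    fix x :: "real^'n"
    have "(\<Sum>m\<in>box_of {-int q<..<int q}. a m * character m x)
       = (\<Sum>m\<in>box_of {-int q<..<int q}. avg (2 * q) (\<lambda>l. \<phi> (?g l) * (of_real (tri q m) * character m (x - ?g l))))"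
      by (rule sum.cong) (simp_all add: a_def grid_coeff_def character_arg_diff mult_ac flip: avg_cmult avg_cmult_right)
    also have "\<dots> = avg (2 * q) (\<lambda>l. \<phi> (?g l) * of_real (fejer q (x - ?g l)))"
      unfolding fejer_eq[OF q] sum_distrib_left by (rule avg_sum[symmetric])
    finally have P: "(\<Sum>m\<in>box_of {-int q<..<int q}. a m * character m x) = avg (2 * q) (\<lambda>l. \<phi> (?g l) * of_real (fejer q (x - ?g l)))" .
    have one: "avg (2 * q) (\<lambda>l. fejer q (x - ?g l)) = 1" by (rule avg_fejer_grid) (use q in auto)
    then have \<phi>x: "\<phi> x = avg (2 * q) (\<lambda>l. \<phi> x * of_real (fejer q (x - ?g l)))"
      by (simp add: avg_cmult avg_of_real)
    have "norm (\<phi> x - (\<Sum>m\<in>box_of {-int q<..<int q}. a m * character m x))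
        = norm (avg (2 * q) (\<lambda>l. (\<phi> x - \<phi> (?g l)) * of_real (fejer q (x - ?g l))))"
      unfolding P left_diff_distrib avg_diff \<phi>x[symmetric] ..
    also have "\<dots> \<le> avg (2 * q) (\<lambda>l. norm (\<phi> x - \<phi> (?g l)) * fejer q (x - ?g l))"
      by (rule order.trans[OF norm_avg_le avg_mono]) (simp add: norm_mult fejer_nonneg)
    also have "\<dots> \<le> avg (2 * q) (\<lambda>l. (e / 2 + C * (\<Sum>i\<in>UNIV. (sin ((x - ?g l) $ i / 2))\<^sup>2)) * fejer q (x - ?g l))"
      by (intro avg_mono mult_right_mono C fejer_nonneg)
    also have "\<dots> = e / 2 * avg (2 * q) (\<lambda>l. fejer q (x - ?g l))
        + C * (\<Sum>i\<in>UNIV. avg (2 * q) (\<lambda>l. fejer q (x - ?g l) * (sin ((x - ?g l) $ i / 2))\<^sup>2))"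
    proof -
      have "(e / 2 + C * (\<Sum>i\<in>UNIV. (sin ((x - ?g l) $ i / 2))\<^sup>2)) * fejer q (x - ?g l)
         = e / 2 * fejer q (x - ?g l) + C * (\<Sum>i\<in>UNIV. fejer q (x - ?g l) * (sin ((x - ?g l) $ i / 2))\<^sup>2)" for l
        unfolding sum_distrib_left[of "fejer q _", symmetric] by (simp add: algebra_simps)
      then show ?thesis by (simp only: avg_sum[symmetric] avg_cmult[symmetric] avg_add[symmetric])
    qed
    also have "\<dots> \<le> e / 2 * 1 + C * (\<Sum>i\<in>(UNIV::'n set). 1 / real q)"
      unfolding one using C(1) by (intro add_left_mono mult_left_mono sum_mono avg_fejer_sin q) auto
    also have "\<dots> \<le> e"
    proof -
      have "2 * C * real CARD('n) < real q * e" using q0 e by (simp add: divide_less_eq)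
      then have "C * real CARD('n) / real q \<le> e / 2" using q by (simp add: divide_le_eq mult_ac)
      then have "e / 2 + C * real CARD('n) / real q \<le> e" by linarith
      then show ?thesis by simp
    qed
    finally show "norm (\<phi> x - (\<Sum>m\<in>box_of {-int q<..<int q}. a m * character m x)) \<le> e" .
  qed simp
qed

section \<open>Parseval's formula for a square integrable function against a continuous one\<close>

lemma measure_cell: "measure (lebesgue_on (torus_cell :: (real^'n) set)) torus_cell = (2 * pi) ^ CARD('n)"
proof -
  have sp: "space (lebesgue_on (torus_cell :: (real^'n) set)) = torus_cell" by simp
  have "character (0 :: int^'n) = (\<lambda>x. 1)" by (simp add: fun_eq_iff)
  with integral_character[of "0 :: int^'n"]
  have "complex_of_real (measure (lebesgue_on (torus_cell :: (real^'n) set)) (space (lebesgue_on torus_cell))) = of_real ((2 * pi) ^ CARD('n))"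
    by (simp add: scaleR_conv_of_real)
  then show ?thesis unfolding sp of_real_eq_iff .
qed

lemma integral_cell_le:
  fixes f :: "real^'n \<Rightarrow> real"
  assumes "integrable (lebesgue_on torus_cell) f" "\<And>x. f x \<le> B"
  shows "integral\<^sup>L (lebesgue_on torus_cell) f \<le> (2 * pi) ^ CARD('n) * B"
proof -
  have "integral\<^sup>L (lebesgue_on torus_cell) f \<le> integral\<^sup>L (lebesgue_on (torus_cell :: (real^'n) set)) (\<lambda>x. B)"
    using assms finite_measure.integrable_const[OF finite_measure_cell] by (intro integral_mono) auto
  then show ?thesis by (simp add: measure_cell)
qed

text \<open>The formula is exact on trigonometric polynomials. For the uniform error psi = phi - P,
  bounded by d, the series is estimated by Cauchy-Schwarz and Bessel for both factors, and the
  integral by d times the L^1 norm of g.\<close>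

lemma parseval:
  fixes g \<phi> :: "real^'n \<Rightarrow> complex"
  assumes g: "L2_cell g" and \<phi>: "\<phi> \<in> C0_torus"
  shows "((\<lambda>m. (\<integral>x. g x * character (- m) x \<partial>lebesgue_on torus_cell) / of_real ((2 * pi) ^ CARD('n))
      * (\<integral>x. character m x * \<phi> x \<partial>lebesgue_on torus_cell)) has_sum (\<integral>x. g x * \<phi> x \<partial>lebesgue_on torus_cell)) UNIV"
proof -
  let ?M = "lebesgue_on (torus_cell :: (real^'n) set)"
  define V where "V = (2 * pi) ^ CARD('n)"
  have V: "V > 0" by (simp add: V_def)
  define a where "a m = (\<integral>x. g x * character (- m) x \<partial>?M)" for m
  define b where "b \<psi> m = (\<integral>x. character m x * \<psi> x \<partial>?M)" for \<psi> m
  define g2 where "g2 = (\<integral>x. (norm (g x))\<^sup>2 \<partial>?M)"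
  define g1 where "g1 = (\<integral>x. norm (g x) \<partial>?M)"
  have g2: "g2 \<ge> 0" unfolding g2_def by (rule Bochner_Integration.integral_nonneg) simp
  have g1: "g1 \<ge> 0" unfolding g1_def by (rule Bochner_Integration.integral_nonneg) simp
  have int_g: "integrable ?M g" using g by (rule L2_cell_integrable)
  have mc: "character m \<in> borel_measurable ?M" for m by (intro continuous_measurable_cell continuous_intros)
  have int_gc: "integrable ?M (\<lambda>x. g x * character m x)" for m
    by (rule integrable_cell_mult[OF int_g mc, of _ 1]) simp
  have int_c: "integrable ?M (character m)" for m by (rule integrable_cell_bounded[OF mc, of _ 1]) simp
  have cont: "continuous_on UNIV \<phi>" using \<phi> by (simp add: C0_torus_def)
  \<comment> \<open>The first summand is the Cauchy-Schwarz bound: sqrt (V g2) from Bessel for g, V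
    d from Bessel for psi, and the 1 / V of the coefficients. The second is the L^1 norm of
    g.\<close>
  define H where "H = sqrt (V * g2) / V * V + g1"
  have H: "H \<ge> 0" unfolding H_def using V g1 g2 by simp
  have key: "\<exists>F0. finite F0 \<and> (\<forall>F. finite F \<and> F0 \<subseteq> F \<longrightarrow> norm ((\<Sum>m\<in>F. a m / of_real V * b \<phi> m) - (\<integral>x. g x * \<phi> x \<partial>?M)) \<le> d * H)"
    if d: "d > 0" for d
  proof -
    obtain S c where S: "finite S" and approx: "\<And>x. norm (\<phi> x - (\<Sum>m\<in>S. c m * character m x)) \<le> d"
      using trig_poly_dense[OF \<phi> d] by blast
    define P where "P x = (\<Sum>m\<in>S. c m * character m x)" for x
    define \<psi> where "\<psi> x = \<phi> x - P x" for x
    have \<psi>d: "norm (\<psi> x) \<le> d" for x using approx by (simp add: \<psi>_def P_def)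
    have contP: "continuous_on UNIV P" unfolding P_def by (intro continuous_intros)
    have mP: "P \<in> borel_measurable ?M" by (rule continuous_measurable_cell[OF contP])
    have m\<psi>: "\<psi> \<in> borel_measurable ?M" unfolding \<psi>_def by (intro continuous_measurable_cell continuous_intros cont contP)
    have P_bound: "norm (P x) \<le> (\<Sum>m\<in>S. norm (c m))" for x
      unfolding P_def by (rule order.trans[OF norm_sum]) (simp add: norm_mult)
    have int_gP: "integrable ?M (\<lambda>x. g x * P x)" by (rule integrable_cell_mult[OF int_g mP P_bound])
    have int_g\<psi>: "integrable ?M (\<lambda>x. g x * \<psi> x)" by (rule integrable_cell_mult[OF int_g m\<psi> \<psi>d])
    have int_cP: "integrable ?M (\<lambda>x. character m x * P x)" for m by (rule integrable_cell_mult[OF int_c mP P_bound])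
    have int_c\<psi>: "integrable ?M (\<lambda>x. character m x * \<psi> x)" for m by (rule integrable_cell_mult[OF int_c m\<psi> \<psi>d])
    have \<phi>_eq: "\<phi> x = \<psi> x + P x" for x by (simp add: \<psi>_def)
    have b\<phi>: "b \<phi> m = b \<psi> m + b P m" for m
      unfolding b_def \<phi>_eq distrib_left by (rule Bochner_Integration.integral_add[OF int_c\<psi> int_cP])
    have g\<phi>: "(\<integral>x. g x * \<phi> x \<partial>?M) = (\<integral>x. g x * \<psi> x \<partial>?M) + (\<integral>x. g x * P x \<partial>?M)"
      unfolding \<phi>_eq distrib_left by (rule Bochner_Integration.integral_add[OF int_g\<psi> int_gP])
    have bP: "b P m = (if - m \<in> S then c (- m) * of_real V else 0)" for m
    proof -
      have "b P m = (\<integral>x. (\<Sum>s\<in>S. c s * character (m + s) x) \<partial>?M)"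
        unfolding b_def P_def by (simp add: sum_distrib_left character_add mult_ac)
      also have "\<dots> = (\<Sum>s\<in>S. c s * integral\<^sup>L ?M (character (m + s)))"
        by (subst Bochner_Integration.integral_sum) (auto intro!: integrable_mult_right int_c)
      also have "\<dots> = (\<Sum>s\<in>S. if s = - m then c s * of_real V else 0)"
        by (intro sum.cong refl) (auto simp: integral_character V_def add_eq_0_iff)
      also have "\<dots> = (if - m \<in> S then c (- m) * of_real V else 0)" using S by simp
      finally show ?thesis .
    qed
    have gP: "(\<integral>x. g x * P x \<partial>?M) = (\<Sum>s\<in>S. c s * a (- s))"
    proof -
      have "(\<integral>x. g x * P x \<partial>?M) = (\<integral>x. (\<Sum>s\<in>S. c s * (g x * character s x)) \<partial>?M)"
        unfolding P_def by (simp add: sum_distrib_left mult_ac)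
      also have "\<dots> = (\<Sum>s\<in>S. c s * (\<integral>x. g x * character s x \<partial>?M))"
        by (subst Bochner_Integration.integral_sum) (auto intro!: integrable_mult_right int_gc)
      finally show ?thesis by (simp add: a_def)
    qed
    show ?thesis
    \<comment> \<open>The pairing of P with character m sees only the frequency -m of P, so every
      finite set containing -S gives the exact value for P.\<close>
    proof (intro exI[of _ "uminus ` S"] conjI allI impI)
      show "finite (uminus ` S)" using S by simp
      fix F assume F: "finite F \<and> uminus ` S \<subseteq> F"
      have FP: "(\<Sum>m\<in>F. a m / of_real V * b P m) = (\<integral>x. g x * P x \<partial>?M)"
      proof -
        have "(\<Sum>m\<in>F. a m / of_real V * b P m) = (\<Sum>m\<in>uminus ` S. a m / of_real V * b P m)"
        proof (rule sum.mono_neutral_right)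
          show "\<forall>m\<in>F - uminus ` S. a m / of_real V * b P m = 0"
          proof
            fix m assume "m \<in> F - uminus ` S"
            then have "- m \<notin> S" by (metis DiffD2 image_eqI minus_minus)
            then show "a m / of_real V * b P m = 0" by (simp add: bP)
          qed
        qed (use F in auto)
        also have "\<dots> = (\<Sum>s\<in>S. c s * a (- s))"
          using V by (subst sum.reindex) (auto simp: inj_on_def bP intro!: sum.cong)
        finally show ?thesis unfolding gP .
      qed
      have diff: "(\<Sum>m\<in>F. a m / of_real V * b \<phi> m) - (\<integral>x. g x * \<phi> x \<partial>?M)
          = (\<Sum>m\<in>F. a m / of_real V * b \<psi> m) - (\<integral>x. g x * \<psi> x \<partial>?M)"
        unfolding b\<phi> g\<phi> FP[symmetric] by (simp add: distrib_left sum.distrib)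
      have 1: "norm (\<Sum>m\<in>F. a m / of_real V * b \<psi> m) \<le> sqrt (V * g2) / V * (V * d)"
      proof -
        have "norm (\<Sum>m\<in>F. a m / of_real V * b \<psi> m) \<le> (\<Sum>m\<in>F. \<bar>norm (a m)\<bar> * \<bar>norm (b \<psi> m)\<bar>) / V"
          unfolding sum_divide_distrib by (rule order.trans[OF norm_sum]) (use V in \<open>simp add: norm_mult norm_divide\<close>)
        also have "\<dots> \<le> (L2_set (\<lambda>m. norm (a m)) F * L2_set (\<lambda>m. norm (b \<psi> m)) F) / V"
          using V by (intro divide_right_mono L2_set_mult_ineq) auto
        also have "\<dots> \<le> (sqrt (V * g2) * (V * d)) / V"
        proof (intro divide_right_mono mult_mono)
          have "(\<Sum>m\<in>F. (norm (a m))\<^sup>2) = (\<Sum>m\<in>uminus ` F. (norm (\<integral>x. g x * character m x \<partial>?M))\<^sup>2)"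
            by (subst sum.reindex) (auto simp: inj_on_def a_def)
          also have "\<dots> \<le> V * g2" unfolding V_def g2_def by (rule bessel[OF g]) (use F in auto)
          finally show "L2_set (\<lambda>m. norm (a m)) F \<le> sqrt (V * g2)" unfolding L2_set_def by simp
          have "(\<Sum>m\<in>F. (norm (b \<psi> m))\<^sup>2) = (\<Sum>m\<in>F. (norm (\<integral>x. \<psi> x * character m x \<partial>?M))\<^sup>2)"
            by (simp add: b_def mult.commute)
          also have "\<dots> \<le> V * (\<integral>x. (norm (\<psi> x))\<^sup>2 \<partial>?M)"
            unfolding V_def by (rule bessel[OF bounded_L2_cell[OF m\<psi> \<psi>d]]) (use F in auto)
          also have "\<dots> \<le> V * (V * d\<^sup>2)"
          proof (rule mult_left_mono)
            show "(\<integral>x. (norm (\<psi> x))\<^sup>2 \<partial>?M) \<le> V * d\<^sup>2"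
              unfolding V_def
            proof (rule integral_cell_le)
              show "integrable ?M (\<lambda>x. (norm (\<psi> x))\<^sup>2)" using bounded_L2_cell[OF m\<psi> \<psi>d] by (simp add: L2_cell_def)
              show "(norm (\<psi> x))\<^sup>2 \<le> d\<^sup>2" for x using \<psi>d[of x] by (intro power_mono) auto
            qed
          qed (use V in simp)
          also have "\<dots> = (V * d)\<^sup>2" by (simp add: power2_eq_square)
          finally show "L2_set (\<lambda>m. norm (b \<psi> m)) F \<le> V * d"
            unfolding L2_set_def using V d by (intro real_le_lsqrt) auto
        qed (use V d g2 in auto)
        finally show ?thesis by simp
      qed
      have 2: "norm (\<integral>x. g x * \<psi> x \<partial>?M) \<le> g1 * d"
      proof -
        have "norm (\<integral>x. g x * \<psi> x \<partial>?M) \<le> (\<integral>x. norm (g x * \<psi> x) \<partial>?M)" by (rule integral_norm_bound)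
        also have "\<dots> \<le> (\<integral>x. norm (g x) * d \<partial>?M)"
          using int_g int_g\<psi> \<psi>d by (intro integral_mono integrable_norm integrable_mult_left) (auto simp: norm_mult intro!: mult_left_mono)
        also have "\<dots> = g1 * d" by (simp add: g1_def)
        finally show ?thesis .
      qed
      have "norm ((\<Sum>m\<in>F. a m / of_real V * b \<psi> m) - (\<integral>x. g x * \<psi> x \<partial>?M)) \<le> sqrt (V * g2) / V * (V * d) + g1 * d"
        by (rule order.trans[OF norm_triangle_ineq4 add_mono[OF 1 2]])
      also have "\<dots> = d * H" by (simp add: H_def algebra_simps)
      finally show "norm ((\<Sum>m\<in>F. a m / of_real V * b \<phi> m) - (\<integral>x. g x * \<phi> x \<partial>?M)) \<le> d * H"
        unfolding diff .
    qed
  qed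
  have "((\<lambda>m. a m / of_real V * b \<phi> m) has_sum (\<integral>x. g x * \<phi> x \<partial>?M)) UNIV"
    unfolding has_sum_def
  proof (rule tendstoI)
    fix e :: real assume e: "e > 0"
    \<comment> \<open>Adding 1 covers H = 0 and makes the final inequality strict.\<close>
    have "e / (H + 1) > 0" using e H by simp
    from key[OF this] obtain F0 where F0: "finite F0"
      "\<And>F. finite F \<Longrightarrow> F0 \<subseteq> F \<Longrightarrow> norm ((\<Sum>m\<in>F. a m / of_real V * b \<phi> m) - (\<integral>x. g x * \<phi> x \<partial>?M)) \<le> e / (H + 1) * H" by blast
    have "e / (H + 1) * H < e" using e H by (simp add: field_simps)
    then show "\<forall>\<^sub>F F in finite_subsets_at_top UNIV. dist (\<Sum>m\<in>F. a m / of_real V * b \<phi> m) (\<integral>x. g x * \<phi> x \<partial>?M) < e"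
      unfolding eventually_finite_subsets_at_top using F0 by (intro exI[of _ F0]) (fastforce simp: dist_norm)
  qed
  then show ?thesis unfolding a_def b_def V_def .
qed

section \<open>Summation of the approximate solutions\<close>

definition torus_coeff :: "(real^'n \<Rightarrow> complex) \<Rightarrow> int^'n \<Rightarrow> complex" where
  "torus_coeff f m = (\<integral>x. f x * character (- m) x \<partial>lebesgue_on torus_cell) / of_real ((2 * pi) ^ CARD('n))"

lemma torus_fun_character: "torus_fun (character m)"
proof -
  have "cis (real_vec m \<bullet> ((2 * pi) *\<^sub>R axis j 1)) = 1" for j
  proof -
    have "real_vec m \<bullet> ((2 * pi) *\<^sub>R axis j 1) = 2 * pi * of_int (m $ j)"
      by (simp add: inner_axis real_vec_def)
    then show ?thesis by (simp only:) (rule cis_multiple_2pi, simp)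
  qed
  then show ?thesis by (simp add: torus_fun_def character_def inner_add_right flip: cis_mult)
qed

lemma trig_poly_in_C0: "(\<lambda>x. \<Sum>m\<in>S. c m * character m x) \<in> C0_torus"
proof -
  have shift: "character m (x + (2 * pi) *\<^sub>R axis j 1) = character m x" for m x j
    using torus_fun_character[of m] unfolding torus_fun_def by blast
  have "torus_fun (\<lambda>x. \<Sum>m\<in>S. c m * character m x)"
    unfolding torus_fun_def by (intro allI) (simp only: shift)
  then show ?thesis by (simp add: C0_torus_def continuous_intros)
qed

lemma C0_torus_sum:
  fixes f :: "'i \<Rightarrow> real^'n \<Rightarrow> complex"
  shows "(\<And>i. i \<in> I \<Longrightarrow> f i \<in> C0_torus) \<Longrightarrow> (\<lambda>x. \<Sum>i\<in>I. f i x) \<in> C0_torus"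
proof -
  assume f: "\<And>i. i \<in> I \<Longrightarrow> f i \<in> C0_torus"
  have "torus_fun (\<lambda>x. \<Sum>i\<in>I. f i x)"
    unfolding torus_fun_def
  proof (intro allI sum.cong refl)
    fix x :: "real^'n" and j i assume "i \<in> I"
    then show "f i (x + (2 * pi) *\<^sub>R axis j 1) = f i x"
      using f unfolding C0_torus_def torus_fun_def by blast
  qed
  then show ?thesis using f by (auto simp: C0_torus_def intro!: continuous_on_sum)
qed

lemma C0_torus_integrable:
  fixes f :: "real^'n \<Rightarrow> complex"
  assumes "f \<in> C0_torus"
  shows "integrable (lebesgue_on torus_cell) f"
proof -
  obtain B where "\<And>x. norm (f x) \<le> B" using C0_torus_bounded[OF assms] by blast
  moreover have "f \<in> borel_measurable (lebesgue_on torus_cell)"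
    using assms by (intro continuous_measurable_cell) (simp add: C0_torus_def)
  ultimately show ?thesis by (rule integrable_cell_bounded[rotated])
qed

lemma C0_torus_mult: "f \<in> C0_torus \<Longrightarrow> g \<in> C0_torus \<Longrightarrow> (\<lambda>x. f x * g x) \<in> C0_torus"
  by (auto simp: C0_torus_def torus_fun_def intro!: continuous_intros)

lemma character_in_C0: "character m \<in> C0_torus"
  by (simp add: C0_torus_def torus_fun_character continuous_intros)

lemma torus_coeff_sum:
  fixes f :: "'i \<Rightarrow> real^'n \<Rightarrow> complex"
  assumes "\<And>i. i \<in> I \<Longrightarrow> f i \<in> C0_torus"
  shows "torus_coeff (\<lambda>x. \<Sum>i\<in>I. f i x) m = (\<Sum>i\<in>I. torus_coeff (f i) m)"
  unfolding torus_coeff_def sum_distrib_right sum_divide_distrib[symmetric]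
  by (subst Bochner_Integration.integral_sum) (auto intro: C0_torus_integrable[OF C0_torus_mult[OF assms character_in_C0]])

lemma integral_character_mult:
  fixes m k :: "int^'n"
  shows "(\<integral>x. character m x * character (- k) x \<partial>lebesgue_on torus_cell) = (if m = k then of_real ((2 * pi) ^ CARD('n)) else 0)"
  using integral_character[of "m - k"] by (simp flip: character_add)

lemma torus_coeff_trig_poly:
  fixes c :: "int^'n \<Rightarrow> complex"
  assumes "finite S" "\<And>m. m \<notin> S \<Longrightarrow> c m = 0"
  shows "torus_coeff (\<lambda>x. \<Sum>m\<in>S. c m * character m x) k = c k"
proof -
  have "torus_coeff (\<lambda>x. \<Sum>m\<in>S. c m * character m x) k
      = (\<Sum>m\<in>S. c m * (\<integral>x. character m x * character (- k) x \<partial>lebesgue_on torus_cell)) / of_real ((2 * pi) ^ CARD('n))"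
    unfolding torus_coeff_def sum_distrib_right mult.assoc
    by (subst Bochner_Integration.integral_sum)
       (auto intro!: integrable_mult_right C0_torus_integrable[OF C0_torus_mult[OF character_in_C0 character_in_C0]])
  also have "\<dots> = c k"
    unfolding integral_character_mult using assms by (simp add: if_distrib cong: if_cong)
  finally show ?thesis .
qed

lemma norm_torus_coeff_diff_le:
  fixes f h :: "real^'n \<Rightarrow> complex"
  assumes f: "f \<in> C0_torus" and h: "h \<in> C0_torus" and d: "\<And>x. norm (f x - h x) \<le> d"
  shows "norm (torus_coeff f m - torus_coeff h m) \<le> d"
proof -
  let ?M = "lebesgue_on (torus_cell :: (real^'n) set)"
  have int: "integrable ?M (\<lambda>x. p x * character (- m) x)" if "p \<in> C0_torus" for p
    by (intro C0_torus_integrable C0_torus_mult character_in_C0 that)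
  have "torus_coeff f m - torus_coeff h m = (\<integral>x. (f x - h x) * character (- m) x \<partial>?M) / of_real ((2 * pi) ^ CARD('n))"
    unfolding torus_coeff_def left_diff_distrib Bochner_Integration.integral_diff[OF int[OF f] int[OF h]] by (rule diff_divide_distrib[symmetric])
  then have "norm (torus_coeff f m - torus_coeff h m) = norm (\<integral>x. (f x - h x) * character (- m) x \<partial>?M) / (2 * pi) ^ CARD('n)"
    by (simp add: norm_divide norm_power norm_mult)
  also have "\<dots> \<le> ((2 * pi) ^ CARD('n) * d) / (2 * pi) ^ CARD('n)"
  proof (rule divide_right_mono)
    have "norm (\<integral>x. (f x - h x) * character (- m) x \<partial>?M) \<le> (\<integral>x. norm ((f x - h x) * character (- m) x) \<partial>?M)"
      by (rule integral_norm_bound)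
    also have "\<dots> \<le> (2 * pi) ^ CARD('n) * d"
      using Bochner_Integration.integrable_diff[OF int[OF f] int[OF h]] d
      by (intro integral_cell_le integrable_norm) (auto simp: norm_mult left_diff_distrib[symmetric])
    finally show "norm (\<integral>x. (f x - h x) * character (- m) x \<partial>?M) \<le> (2 * pi) ^ CARD('n) * d" .
  qed simp
  finally show ?thesis by simp
qed

lemma L2_set_sum_le: "L2_set (\<lambda>m. \<Sum>k<N::nat. a k m) T \<le> (\<Sum>k<N. L2_set (a k) T)"
proof (induction N)
  case 0
  then show ?case by (simp add: L2_set_def)
next
  case (Suc N)
  have "L2_set (\<lambda>m. \<Sum>k<Suc N. a k m) T \<le> L2_set (\<lambda>m. \<Sum>k<N. a k m) T + L2_set (a N) T"
    unfolding sum.lessThan_Suc by (rule L2_set_triangle_ineq)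
  then show ?case using Suc by simp
qed

lemma geometric_half_sum_le: "(\<Sum>k<N. r / 2 ^ k) \<le> 2 * r" if "r \<ge> 0" for r :: real
proof -
  have "(\<Sum>k<N. r / 2 ^ k) = 2 * r - 2 * r / 2 ^ N"
    by (induction N) (simp_all add: field_simps)
  then show ?thesis using that by simp
qed

text \<open>\<open>Gs k\<close> is the remainder after k corrections, of norm at most r / 2^k; the
  correction \<open>F k\<close> has sup and Sobolev norms at most C r / 2^k. Uniform convergence
  yields continuity and lets Fourier coefficients pass to the limit, while the remainder tends to 0
  at each frequency.\<close>

lemma synthesis:
  fixes G :: "int^'n \<Rightarrow> complex"
  assumes G0: "G 0 = 0" and G: "\<And>S. finite S \<Longrightarrow> (\<Sum>m\<in>S. (norm (G m))\<^sup>2) \<le> r\<^sup>2" and r: "r > 0"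
  obtains f :: "'n option \<Rightarrow> real^'n \<Rightarrow> complex" and R where
    "\<And>j. f j \<in> C0_torus"
    "\<And>j T. finite T \<Longrightarrow> (\<Sum>m\<in>T. (weight m * norm (torus_coeff (f j) m))\<^sup>2) \<le> R\<^sup>2"
    "\<And>m. G m = synth (\<lambda>j. torus_coeff (f j)) m"
proof -
  define Q where "Q C H s S F \<longleftrightarrow> finite S \<and> (\<forall>j. \<forall>m. m \<notin> S \<longrightarrow> F j m = 0) \<and>
        (\<forall>j x. norm (\<Sum>m\<in>S. F j m * character m x) \<le> C * s) \<and>
        (\<forall>j. (\<Sum>m\<in>S. (weight m * norm (F j m))\<^sup>2) \<le> (C * s)\<^sup>2) \<and>
        (\<forall>T. finite T \<longrightarrow> (\<Sum>m\<in>T. (norm (H m - synth F m))\<^sup>2) \<le> (s / 2)\<^sup>2)"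
    for C s :: real and H :: "int^'n \<Rightarrow> complex" and S F
  obtain C where C: "C > 0" and step: "\<And>H s. s > 0 \<Longrightarrow> H 0 = 0 \<Longrightarrow>
      (\<And>S. finite S \<Longrightarrow> (\<Sum>m\<in>S. (norm (H m))\<^sup>2) \<le> s\<^sup>2) \<Longrightarrow> \<exists>S F. Q C H s S F"
    unfolding Q_def using approx_step[where 'n = 'n] by blast
  define sol where "sol H s = (SOME p. Q C H s (fst p) (snd p))" for H s
  define rk where "rk k = r / 2 ^ k" for k :: nat
  define Gs where "Gs = rec_nat G (\<lambda>k H m. H m - synth (snd (sol H (rk k))) m)"
  define S where "S k = fst (sol (Gs k) (rk k))" for k
  define F where "F k = snd (sol (Gs k) (rk k))" for k
  have Gs0: "Gs 0 = G" by (simp add: Gs_def)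
  have GsSuc: "Gs (Suc k) m = Gs k m - synth (F k) m" for k m by (simp add: Gs_def F_def)
  have rk: "rk k > 0" "rk (Suc k) = rk k / 2" for k using r by (auto simp: rk_def)
  have Q_of: "Q C (Gs k) (rk k) (S k) (F k)"
    if Gsk: "Gs k 0 = 0" "\<And>T. finite T \<Longrightarrow> (\<Sum>m\<in>T. (norm (Gs k m))\<^sup>2) \<le> (rk k)\<^sup>2" for k
  proof -
    obtain S' F' where "Q C (Gs k) (rk k) S' F'" using step[OF rk(1) Gsk] by blast
    then have "\<exists>p. Q C (Gs k) (rk k) (fst p) (snd p)" by (intro exI[of _ "(S', F')"]) simp
    from someI_ex[OF this] show ?thesis unfolding S_def F_def sol_def .
  qed
  have inv: "Gs k 0 = 0 \<and> (\<forall>T. finite T \<longrightarrow> (\<Sum>m\<in>T. (norm (Gs k m))\<^sup>2) \<le> (rk k)\<^sup>2)" for k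
  proof (induction k)
    case 0
    then show ?case using G0 G by (simp add: Gs0 rk_def)
  next
    case (Suc k)
    then have "Q C (Gs k) (rk k) (S k) (F k)" by (intro Q_of) auto
    then have "\<And>T. finite T \<Longrightarrow> (\<Sum>m\<in>T. (norm (Gs k m - synth (F k) m))\<^sup>2) \<le> (rk k / 2)\<^sup>2" unfolding Q_def by blast
    then show ?case using Suc by (simp add: GsSuc rk(2) synth_def)
  qed
  have Qk: "Q C (Gs k) (rk k) (S k) (F k)" for k by (rule Q_of) (use inv in auto)
  have finS: "finite (S k)" and F0: "\<And>j m. m \<notin> S k \<Longrightarrow> F k j m = 0" for k using Qk[of k] unfolding Q_def by blast+
  define P where "P k j x = (\<Sum>m\<in>S k. F k j m * character m x)" for k j x
  have P_le: "norm (P k j x) \<le> C * rk k" for k j x using Qk[of k] unfolding Q_def P_def by blast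
  have wF: "(\<Sum>m\<in>S k. (weight m * norm (F k j m))\<^sup>2) \<le> (C * rk k)\<^sup>2" for k j using Qk[of k] unfolding Q_def by blast
  have P_C0: "P k j \<in> C0_torus" for k j unfolding P_def by (rule trig_poly_in_C0)
  have coeff_P: "torus_coeff (P k j) m = F k j m" for k j m
    unfolding P_def by (rule torus_coeff_trig_poly[OF finS F0])
  define f where "f j x = (\<Sum>k. P k j x)" for j x
  have rk_geom: "rk = (\<lambda>k. r * (1 / 2) ^ k)" by (simp add: fun_eq_iff rk_def power_one_over)
  have summ: "summable (\<lambda>k. C * rk k)"
    unfolding rk_geom by (intro summable_mult summable_geometric) simp
  have unif: "uniform_limit UNIV (\<lambda>N x. \<Sum>k<N. P k j x) (f j) sequentially" for j
    unfolding f_def by (rule Weierstrass_m_test[OF _ summ]) (rule P_le)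
  have part_C0: "(\<lambda>x. \<Sum>k<N. P k j x) \<in> C0_torus" for N j by (rule C0_torus_sum) (rule P_C0)
  have f_C0: "f j \<in> C0_torus" for j
  proof -
    have "continuous_on UNIV (f j)"
      by (rule uniform_limit_theorem[OF _ unif]) (use part_C0 in \<open>auto simp: C0_torus_def\<close>)
    moreover have "torus_fun (f j)" using P_C0 by (simp add: C0_torus_def torus_fun_def f_def)
    ultimately show ?thesis by (simp add: C0_torus_def)
  qed
  have lim: "(\<lambda>N. \<Sum>k<N. F k j m) \<longlonglongrightarrow> torus_coeff (f j) m" for j m
  proof (rule LIMSEQ_I)
    fix e :: real assume e: "e > 0"
    have "\<forall>\<^sub>F N in sequentially. \<forall>x\<in>UNIV. dist (\<Sum>k<N. P k j x) (f j x) < e / 2"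
      using uniform_limitD[OF unif, of "e / 2"] e by simp
    then obtain N0 where N0: "\<And>N x. N \<ge> N0 \<Longrightarrow> dist (\<Sum>k<N. P k j x) (f j x) < e / 2"
      by (auto simp: eventually_sequentially)
    have "norm ((\<Sum>k<N. F k j m) - torus_coeff (f j) m) < e" if "N \<ge> N0" for N
    proof -
      have "norm (torus_coeff (\<lambda>x. \<Sum>k<N. P k j x) m - torus_coeff (f j) m) \<le> e / 2"
        by (rule norm_torus_coeff_diff_le[OF part_C0 f_C0]) (use N0[OF that] in \<open>simp add: dist_norm less_imp_le\<close>)
      then show ?thesis using e by (simp add: torus_coeff_sum[OF P_C0] coeff_P)
    qed
    then show "\<exists>N0. \<forall>N\<ge>N0. norm ((\<Sum>k<N. F k j m) - torus_coeff (f j) m) < e" by blast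
  qed
  show ?thesis
  proof (rule that[of f "2 * (C * r)"])
    show "f j \<in> C0_torus" for j by (rule f_C0)
    \<comment> \<open>On a finite T the bound passes to the limit. For partial sums it is
      Minkowski's inequality, and the geometric series gives 2 C r.\<close>
    show "(\<Sum>m\<in>T. (weight m * norm (torus_coeff (f j) m))\<^sup>2) \<le> (2 * (C * r))\<^sup>2" if T: "finite T" for j T
    proof (rule tendsto_upperbound)
      show "(\<lambda>N. \<Sum>m\<in>T. (weight m * norm (\<Sum>k<N. F k j m))\<^sup>2) \<longlonglongrightarrow> (\<Sum>m\<in>T. (weight m * norm (torus_coeff (f j) m))\<^sup>2)"
        by (intro tendsto_sum tendsto_power tendsto_mult tendsto_const tendsto_norm lim)
      show "\<forall>\<^sub>F N in sequentially. (\<Sum>m\<in>T. (weight m * norm (\<Sum>k<N. F k j m))\<^sup>2) \<le> (2 * (C * r))\<^sup>2"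
      proof (rule always_eventually, rule allI)
        fix N
        have "L2_set (\<lambda>m. weight m * norm (F k j m)) T \<le> C * r / 2 ^ k" for k
        proof -
          have "(\<Sum>m\<in>T. (weight m * norm (F k j m))\<^sup>2) = (\<Sum>m\<in>T \<inter> S k. (weight m * norm (F k j m))\<^sup>2)"
            by (rule sum.mono_neutral_right) (use T F0 in auto)
          also have "\<dots> \<le> (\<Sum>m\<in>S k. (weight m * norm (F k j m))\<^sup>2)"
            by (rule sum_mono2) (use finS in auto)
          also have "\<dots> \<le> (C * rk k)\<^sup>2" by (rule wF)
          finally have "L2_set (\<lambda>m. weight m * norm (F k j m)) T \<le> C * rk k"
            unfolding L2_set_def using C rk(1)[of k] by (intro real_le_lsqrt) auto
          then show ?thesis by (simp add: rk_def)
        qed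
        then have "(\<Sum>k<N. L2_set (\<lambda>m. weight m * norm (F k j m)) T) \<le> (\<Sum>k<N. C * r / 2 ^ k)" by (rule sum_mono)
        also have "\<dots> \<le> 2 * (C * r)" using C r by (intro geometric_half_sum_le) simp
        finally have le: "(\<Sum>k<N. L2_set (\<lambda>m. weight m * norm (F k j m)) T) \<le> 2 * (C * r)" .
        have "L2_set (\<lambda>m. weight m * norm (\<Sum>k<N. F k j m)) T \<le> L2_set (\<lambda>m. \<Sum>k<N. weight m * norm (F k j m)) T"
          unfolding sum_distrib_left[symmetric] by (intro L2_set_mono mult_left_mono norm_sum) auto
        also have "\<dots> \<le> 2 * (C * r)" by (rule order.trans[OF L2_set_sum_le le])
        finally have "(L2_set (\<lambda>m. weight m * norm (\<Sum>k<N. F k j m)) T)\<^sup>2 \<le> (2 * (C * r))\<^sup>2"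
          by (intro power_mono L2_set_nonneg)
        then show "(\<Sum>m\<in>T. (weight m * norm (\<Sum>k<N. F k j m))\<^sup>2) \<le> (2 * (C * r))\<^sup>2"
          by (simp add: L2_set_def sum_nonneg)
      qed
    qed simp
    show "G m = synth (\<lambda>j. torus_coeff (f j)) m" for m
    proof -
      have GsN: "Gs N m = G m - synth (\<lambda>j m. \<Sum>k<N. F k j m) m" for N
      proof (induction N)
        case 0
        then show ?case by (simp add: Gs0 synth_def)
      next
        case (Suc N)
        then show ?case using synth_add[of "\<lambda>j m. \<Sum>k<N. F k j m" "F N" m] by (simp add: GsSuc)
      qed
      have "(\<lambda>N. G m - synth (\<lambda>j m. \<Sum>k<N. F k j m) m) \<longlonglongrightarrow> G m - synth (\<lambda>j. torus_coeff (f j)) m"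
        unfolding synth_def by (intro tendsto_diff tendsto_mult tendsto_sum tendsto_const lim)
      moreover have "(\<lambda>N. Gs N m) \<longlonglongrightarrow> 0"
      proof (rule Lim_null_comparison[of _ rk])
        have "norm (Gs N m) \<le> rk N" for N
        proof -
          have "(norm (Gs N m))\<^sup>2 \<le> (rk N)\<^sup>2" using inv[of N, THEN conjunct2, rule_format, of "{m}"] by simp
          then show ?thesis by (rule power2_le_imp_le) (use rk(1)[of N] in simp)
        qed
        then show "\<forall>\<^sub>F N in sequentially. norm (Gs N m) \<le> rk N" by simp
        have "(\<lambda>k. r * (1 / 2) ^ k) \<longlonglongrightarrow> r * 0"
          by (intro tendsto_mult tendsto_const LIMSEQ_power_zero) simp
        then show "rk \<longlonglongrightarrow> 0" by (simp add: rk_geom)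
      qed
      ultimately have "G m - synth (\<lambda>j. torus_coeff (f j)) m = 0"
        unfolding GsN using LIMSEQ_unique by blast
      then show ?thesis by simp
    qed
  qed
qed

section \<open>Distributions and multipliers\<close>

lemma dist_of_eq: "dist_of f \<phi> = (\<integral>x. f x * \<phi> x \<partial>lebesgue_on torus_cell)"
  by (simp add: dist_of_def set_integral_cell)

lemma fourier_coeff_dist_of: "fourier_coeff (dist_of f) m = torus_coeff f m"
  by (simp add: fourier_coeff_def dist_of_eq torus_coeff_def)

lemma test_functions_C0: "\<phi> \<in> test_functions \<Longrightarrow> \<phi> \<in> C0_torus"
proof -
  assume \<phi>: "\<phi> \<in> test_functions"
  then have "partials [] \<phi> differentiable (at x)" for x unfolding test_functions_def by blast
  then have "continuous_on UNIV \<phi>"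
    by (intro continuous_at_imp_continuous_on) (simp add: differentiable_imp_continuous_within)
  then show ?thesis using \<phi> by (simp add: C0_torus_def test_functions_def)
qed

lemma norm_le_Ck_norm:
  assumes "\<phi> \<in> C0_torus"
  shows "norm (\<phi> x) \<le> Ck_norm 0 \<phi>"
proof -
  obtain B where B: "\<And>x. norm (\<phi> x) \<le> B" using C0_torus_bounded[OF assms] by blast
  have "(\<lambda>(js, x). norm (partials js \<phi> x)) ([], x) \<le> (SUP p \<in> {js. length js \<le> 0} \<times> UNIV. (\<lambda>(js, x). norm (partials js \<phi> x)) p)"
    by (rule cSUP_upper) (use B in \<open>auto intro!: bdd_aboveI[of _ B]\<close>)
  then show ?thesis by (simp add: Ck_norm_def)
qed

lemma dist_of_distribution:
  fixes f :: "real^'n \<Rightarrow> complex"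
  assumes f: "f \<in> C0_torus"
  shows "dist_of f \<in> distributions"
proof -
  let ?M = "lebesgue_on (torus_cell :: (real^'n) set)"
  have int: "integrable ?M (\<lambda>x. f x * \<phi> x)" if "\<phi> \<in> test_functions" for \<phi>
    by (intro C0_torus_integrable C0_torus_mult f test_functions_C0 that)
  obtain B where B: "B > 0" "\<And>x. norm (f x) \<le> B" using C0_torus_bounded[OF f] by blast
  have add: "dist_of f (\<lambda>x. \<phi> x + \<psi> x) = dist_of f \<phi> + dist_of f \<psi>" if "\<phi> \<in> test_functions" "\<psi> \<in> test_functions" for \<phi> \<psi>
    unfolding dist_of_eq distrib_left by (rule Bochner_Integration.integral_add[OF int[OF that(1)] int[OF that(2)]])
  have cmult: "dist_of f (\<lambda>x. c * \<phi> x) = c * dist_of f \<phi>" for c \<phi>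
    unfolding dist_of_eq mult.left_commute[of _ c] by (rule integral_mult_right_zero)
  have "norm (dist_of f \<phi>) \<le> ((2 * pi) ^ CARD('n) * B) * Ck_norm 0 \<phi>" if \<phi>: "\<phi> \<in> test_functions" for \<phi>
  proof -
    have "norm (dist_of f \<phi>) \<le> (\<integral>x. norm (f x * \<phi> x) \<partial>?M)" unfolding dist_of_eq by (rule integral_norm_bound)
    also have "\<dots> \<le> (2 * pi) ^ CARD('n) * (B * Ck_norm 0 \<phi>)"
    proof (rule integral_cell_le)
      show "integrable ?M (\<lambda>x. norm (f x * \<phi> x))" by (rule integrable_norm[OF int[OF \<phi>]])
      show "norm (f x * \<phi> x) \<le> B * Ck_norm 0 \<phi>" for x
        unfolding norm_mult using B by (intro mult_mono norm_le_Ck_norm test_functions_C0 \<phi>) auto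
    qed
    finally show ?thesis by (simp only: mult.assoc)
  qed
  then show ?thesis using add cmult unfolding distributions_def by blast
qed

text \<open>Against a character the defining series has a single nonzero term, so no convergence
  question arises and \<open>u\<close> may be any functional. This allows the composition with
  \<open>conj_riesz\<close>.\<close>

lemma fourier_coeff_multiplier:
  fixes u :: "'n::finite functional"
  shows "fourier_coeff (fourier_multiplier \<sigma> u) m = \<sigma> m * fourier_coeff u m"
proof -
  have "fourier_multiplier \<sigma> u (character (- m)) = (\<Sum>\<^sub>\<infinity>k\<in>{m}. \<sigma> k * fourier_coeff u k * dist_of (character k) (character (- m)))"
    unfolding fourier_multiplier_def
    by (rule infsum_cong_neutral) (auto simp: dist_of_eq integral_character_mult)
  also have "\<dots> = \<sigma> m * fourier_coeff u m * of_real ((2 * pi) ^ CARD('n))"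
    by (simp add: dist_of_eq integral_character_mult)
  finally show ?thesis by (simp add: fourier_coeff_def)
qed

lemma weight_powr: "norm (real_vec (m :: int^'n)) powr (2 * (real CARD('n) / 2)) = (weight m)\<^sup>2"
  by (cases "m = 0") (simp_all add: weight_square powr_realpow)

lemma weight_powr_quarter: "norm (real_vec (m :: int^'n)) powr (2 * (real CARD('n) / 4)) = weight m"
  by (simp add: weight_def)

lemma dist_of_Hdot:
  fixes f :: "real^'n \<Rightarrow> complex"
  assumes f: "f \<in> C0_torus" and R: "\<And>T. finite T \<Longrightarrow> (\<Sum>m\<in>T. (weight m * norm (torus_coeff f m))\<^sup>2) \<le> R\<^sup>2"
  shows "dist_of f \<in> Hdot (real CARD('n) / 2)"
proof -
  have "(\<lambda>m. (weight m)\<^sup>2 * (norm (torus_coeff f m))\<^sup>2) summable_on UNIV"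
  proof (rule nonneg_bdd_above_summable_on)
    show "bdd_above (sum (\<lambda>m. (weight m)\<^sup>2 * (norm (torus_coeff f m))\<^sup>2) ` {F. F \<subseteq> UNIV \<and> finite F})"
      by (rule bdd_aboveI[of _ "R\<^sup>2"]) (use R in \<open>auto simp: power_mult_distrib\<close>)
  qed simp
  then show ?thesis
    unfolding Hdot_def weight_powr fourier_coeff_dist_of using dist_of_distribution[OF f] by (simp add: fourier_coeff_dist_of)
qed

text \<open>Both factors are square summable, the second by Bessel for phi, so their product is
  absolutely summable.\<close>

lemma summable_test_pairing:
  fixes \<phi> :: "real^'n \<Rightarrow> complex"
  assumes H: "\<And>T. finite T \<Longrightarrow> (\<Sum>m\<in>T. (norm (H m))\<^sup>2) \<le> B" and \<phi>: "\<phi> \<in> C0_torus"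
  shows "(\<lambda>m. H m * dist_of (character m) \<phi>) summable_on UNIV"
proof (rule abs_summable_summable, rule nonneg_bdd_above_summable_on)
  obtain b where b: "\<And>x. norm (\<phi> x) \<le> b" using C0_torus_bounded[OF \<phi>] by blast
  have "L2_cell \<phi>"
    by (rule bounded_L2_cell[OF continuous_measurable_cell b]) (use \<phi> in \<open>simp add: C0_torus_def\<close>)
  note bess = bessel[OF this]
  show "bdd_above (sum (\<lambda>m. norm (H m * dist_of (character m) \<phi>)) ` {F. F \<subseteq> UNIV \<and> finite F})"
  proof (rule bdd_aboveI2)
    fix F :: "(int^'n) set" assume F: "F \<in> {F. F \<subseteq> UNIV \<and> finite F}"
    have "(\<Sum>m\<in>F. norm (H m * dist_of (character m) \<phi>)) \<le> (\<Sum>m\<in>F. (norm (H m))\<^sup>2 + (norm (\<integral>x. \<phi> x * character m x \<partial>lebesgue_on torus_cell))\<^sup>2)"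
    proof (rule sum_mono)
      fix m
      have "norm (H m) * norm (dist_of (character m) \<phi>) \<le> ((norm (H m))\<^sup>2 + (norm (dist_of (character m) \<phi>))\<^sup>2) / 2"
        by (rule mult_le_half_squares)
      also have "\<dots> \<le> (norm (H m))\<^sup>2 + (norm (dist_of (character m) \<phi>))\<^sup>2" by simp
      finally show "norm (H m * dist_of (character m) \<phi>) \<le> (norm (H m))\<^sup>2 + (norm (\<integral>x. \<phi> x * character m x \<partial>lebesgue_on torus_cell))\<^sup>2"
        by (simp add: norm_mult dist_of_eq mult.commute)
    qed
    also have "\<dots> \<le> B + (2 * pi) ^ CARD('n) * (\<integral>x. (norm (\<phi> x))\<^sup>2 \<partial>lebesgue_on torus_cell)"
      unfolding sum.distrib using F by (intro add_mono H bess) auto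
    finally show "(\<Sum>m\<in>F. norm (H m * dist_of (character m) \<phi>)) \<le> B + (2 * pi) ^ CARD('n) * (\<integral>x. (norm (\<phi> x))\<^sup>2 \<partial>lebesgue_on torus_cell)" .
  qed
qed simp

lemma has_sum_finite_sum:
  fixes f :: "'i \<Rightarrow> 'a \<Rightarrow> complex"
  assumes "finite I" "\<And>i. i \<in> I \<Longrightarrow> (f i has_sum s i) A"
  shows "((\<lambda>x. \<Sum>i\<in>I. f i x) has_sum (\<Sum>i\<in>I. s i)) A"
  using assms by (induction I rule: finite_induct) (auto intro: has_sum_add)

lemma sum_option_UNIV: "(\<Sum>j\<in>UNIV. h j) = h None + (\<Sum>i\<in>UNIV. h (Some i))"
  for h :: "'n::finite option \<Rightarrow> 'a::comm_monoid_add"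
  unfolding UNIV_option_conv by (subst sum.insert) (auto simp: sum.reindex)

theorem corollary2:
  fixes g :: "real^'n \<Rightarrow> complex"
  assumes "g \<in> L2_mean_zero"
  shows "\<exists>(f0 :: real^'n \<Rightarrow> complex) (f :: 'n \<Rightarrow> real^'n \<Rightarrow> complex).
    f0 \<in> C0_torus \<and> dist_of f0 \<in> Hdot (real CARD('n) / 2) \<and>
    (\<forall>j. f j \<in> C0_torus \<and> dist_of (f j) \<in> Hdot (real CARD('n) / 2)) \<and>
    (\<forall>\<phi>\<in>test_functions.
      dist_of g \<phi> = frac_laplacian (real CARD('n) / 4) (dist_of f0) \<phi> +
        (\<Sum>j\<in>UNIV. frac_laplacian (real CARD('n) / 4) (conj_riesz j (dist_of (f j))) \<phi>))"
proof -
  let ?M = "lebesgue_on (torus_cell :: (real^'n) set)"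
  define V where "V = (2 * pi) ^ CARD('n)"
  have V: "V > 0" by (simp add: V_def)
  have cell: "torus_cell \<inter> space lebesgue \<in> sets lebesgue" by (simp add: torus_cell_def)
  have g: "L2_cell g"
  proof -
    have "g \<in> borel_measurable lebesgue" "set_integrable lebesgue torus_cell (\<lambda>x. (norm (g x))\<^sup>2)"
      using assms by (auto simp: L2_mean_zero_def L2_torus_def)
    then show ?thesis
      unfolding L2_cell_def set_integrable_def integrable_restrict_space[OF cell]
      by (auto intro: measurable_restrict_space1)
  qed
  define G where "G = torus_coeff g"
  define g2 where "g2 = (\<integral>x. (norm (g x))\<^sup>2 \<partial>?M)"
  have g2: "g2 \<ge> 0" unfolding g2_def by (rule Bochner_Integration.integral_nonneg) simp
  \<comment> \<open>Mean zero enters here: every synthesised function has vanishing zeroth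
    coefficient because \<open>weight 0 = 0\<close>.\<close>
  have G0: "G 0 = 0"
    using assms by (simp add: G_def torus_coeff_def L2_mean_zero_def set_integral_cell)
  \<comment> \<open>The added 1 makes r positive even for g = 0 and gives r \<le> r^2, so that the
    bound g2 / V has the squared form required.\<close>
  define r where "r = g2 / V + 1"
  have r: "r \<ge> 1" unfolding r_def using V g2 by simp
  have G: "(\<Sum>m\<in>S. (norm (G m))\<^sup>2) \<le> r\<^sup>2" if S: "finite S" for S
  proof -
    have "(\<Sum>m\<in>S. (norm (G m))\<^sup>2) = (\<Sum>m\<in>S. (norm (\<integral>x. g x * character (- m) x \<partial>?M))\<^sup>2) / V\<^sup>2"
      unfolding sum_divide_distrib G_def torus_coeff_def V_def[symmetric] using V
      by (simp add: norm_divide power_divide)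
    also have "(\<Sum>m\<in>S. (norm (\<integral>x. g x * character (- m) x \<partial>?M))\<^sup>2) = (\<Sum>m\<in>uminus ` S. (norm (\<integral>x. g x * character m x \<partial>?M))\<^sup>2)"
      by (subst sum.reindex) (auto simp: inj_on_def)
    also have "\<dots> \<le> V * g2" unfolding V_def g2_def by (rule bessel[OF g]) (use S in simp)
    finally have "(\<Sum>m\<in>S. (norm (G m))\<^sup>2) \<le> V * g2 / V\<^sup>2" using V by (simp add: divide_right_mono)
    also have "\<dots> \<le> r" using V by (simp add: r_def power2_eq_square)
    also have "\<dots> \<le> r\<^sup>2" using r by (simp add: power2_eq_square)
    finally show ?thesis .
  qed
  have r0: "r > 0" using r by simp
  obtain f R where f: "\<And>j. f j \<in> C0_torus"
    and R: "\<And>j T. finite T \<Longrightarrow> (\<Sum>m\<in>T. (weight m * norm (torus_coeff (f j) m))\<^sup>2) \<le> R\<^sup>2"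
    and Geq: "\<And>m. G m = synth (\<lambda>j. torus_coeff (f j)) m"
  proof (rule synthesis[OF G0 G r0])
    fix f :: "'n option \<Rightarrow> real^'n \<Rightarrow> complex" and R
    assume "\<And>j. f j \<in> C0_torus"
      and "\<And>j T. finite T \<Longrightarrow> (\<Sum>m\<in>T. (weight m * norm (torus_coeff (f j) m))\<^sup>2) \<le> R\<^sup>2"
      and "\<And>m. G m = synth (\<lambda>j. torus_coeff (f j)) m"
    then show thesis by (rule that)
  qed
  show ?thesis
  proof (intro exI[of _ "f None"] exI[of _ "\<lambda>i. f (Some i)"] conjI allI ballI)
    show "f None \<in> C0_torus" "\<And>i. f (Some i) \<in> C0_torus" by (rule f)+
    show "dist_of (f None) \<in> Hdot (real CARD('n) / 2)" "\<And>i. dist_of (f (Some i)) \<in> Hdot (real CARD('n) / 2)"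
      by (rule dist_of_Hdot[OF f R], assumption)+
    fix \<phi> :: "real^'n \<Rightarrow> complex" assume "\<phi> \<in> test_functions"
    then have \<phi>: "\<phi> \<in> C0_torus" by (rule test_functions_C0)
    define D where "D j m = of_real (weight m) * (symbol j m * torus_coeff (f j) m) * dist_of (character m) \<phi>" for j m
    have summable: "D j summable_on UNIV" for j
      unfolding D_def
    proof (rule summable_test_pairing[OF _ \<phi>])
      fix T :: "(int^'n) set" assume T: "finite T"
      have "(\<Sum>m\<in>T. (norm (of_real (weight m) * (symbol j m * torus_coeff (f j) m)))\<^sup>2) \<le> (\<Sum>m\<in>T. (weight m * norm (torus_coeff (f j) m))\<^sup>2)"
      proof (intro sum_mono power_mono)
        fix m :: "int^'n"
        show "norm (of_real (weight m) * (symbol j m * torus_coeff (f j) m)) \<le> weight m * norm (torus_coeff (f j) m)"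
          by (simp add: norm_mult norm_symbol_le mult_left_mono mult_left_le_one_le)
      qed simp
      then show "(\<Sum>m\<in>T. (norm (of_real (weight m) * (symbol j m * torus_coeff (f j) m)))\<^sup>2) \<le> R\<^sup>2"
        using R[OF T, of j] by linarith
    qed
    have D_None: "frac_laplacian (real CARD('n) / 4) (dist_of (f None)) \<phi> = infsum (D None) UNIV"
      unfolding frac_laplacian_def fourier_multiplier_def weight_powr_quarter fourier_coeff_dist_of
      by (simp add: D_def[abs_def] symbol_def mult.assoc)
    have D_Some: "frac_laplacian (real CARD('n) / 4) (conj_riesz i (dist_of (f (Some i)))) \<phi> = infsum (D (Some i)) UNIV" for i
    proof -
      have "fourier_coeff (conj_riesz i (dist_of (f (Some i)))) m = symbol (Some i) m * torus_coeff (f (Some i)) m" for m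
        by (simp add: conj_riesz_def fourier_coeff_multiplier fourier_coeff_dist_of symbol_def)
      then show ?thesis
        unfolding frac_laplacian_def fourier_multiplier_def weight_powr_quarter by (simp add: D_def[abs_def] mult.assoc)
    qed
    \<comment> \<open>The same series is summed twice: here componentwise, giving the right-hand
      side, and below by Parseval, giving the pairing with g.\<close>
    have "((\<lambda>m. \<Sum>j\<in>UNIV. D j m) has_sum (\<Sum>j\<in>UNIV. infsum (D j) UNIV)) UNIV"
      by (rule has_sum_finite_sum) (auto simp: summable)
    moreover have "(\<Sum>j\<in>UNIV. D j m) = G m * dist_of (character m) \<phi>" for m
      by (simp add: Geq synth_def D_def sum_distrib_left sum_distrib_right mult.assoc)
    ultimately have "((\<lambda>m. G m * dist_of (character m) \<phi>) has_sum (\<Sum>j\<in>UNIV. infsum (D j) UNIV)) UNIV"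
      by simp
    moreover have "((\<lambda>m. G m * dist_of (character m) \<phi>) has_sum dist_of g \<phi>) UNIV"
      using parseval[OF g \<phi>] by (simp add: G_def torus_coeff_def dist_of_eq)
    ultimately have "dist_of g \<phi> = (\<Sum>j\<in>UNIV. infsum (D j) UNIV)" using has_sum_unique by blast
    also have "\<dots> = infsum (D None) UNIV + (\<Sum>i\<in>UNIV. infsum (D (Some i)) UNIV)" by (rule sum_option_UNIV)
    finally show "dist_of g \<phi> = frac_laplacian (real CARD('n) / 4) (dist_of (f None)) \<phi> +
        (\<Sum>j\<in>UNIV. frac_laplacian (real CARD('n) / 4) (conj_riesz j (dist_of (f (Some j)))) \<phi>)"
      unfolding D_None D_Some .
  qed
qed

end
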